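(* Let $\Omega$ and $\Omega_1,\dots,\Omega_n$ be r.e. infinite sets, and let $P\in\mathbb{P}(\Omega)$ be a discrete probability space on $\Omega$. Let $X_1\colon\Omega\to\Omega_1,\dots,X_n\colon\Omega\to\Omega_n$ be random variables on $\Omega$. Suppose that (a) all of $X_1,\dots,X_n$ are partial recursive functions (with domain of definition precisely $\Omega$) and (b) $P$ is computable. Then the following conditions are equivalent to one another. (i) The random variables $X_1,\dots,X_n$ are independent on $P$. (ii) For every ensemble $\alpha$ for $P$ and every $k=1,\dots,n-1$, $X_k(\alpha)$ is Martin-Löf $X_k(P)$-random relative to $X_{k+1}(\alpha),\dots,X_n(\alpha)$. (iii) There exists an ensemble $\alpha$ for $P$ such that for every $k=1,\dots,n-1$, $X_k(\alpha)$ is Martin-Löf $X_k(P)$-random relative to $X_{k+1}(\alpha),\dots,X_n(\alpha)$.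
   Context: Alphabets and sequences. $\mathbb{N}=\{0,1,2,\dots\}$, $\mathbb{N}^+=\{1,2,3,\dots\}$. For a nonempty set $\Omega$ (alphabet), $\Omega^*$ is the set of finite strings over $\Omega$ (including the empty string $\lambda$), and $\Omega^\infty$ is the set of infinite sequences $\alpha=\alpha(1)\alpha(2)\alpha(3)\cdots$ over $\Omega$; $\alpha\upharpoonright_n$ is the string of the first $n$ elements of $\alpha$. A set $S\subset\Omega^*$ is prefix-free if no string in $S$ is a prefix of another string in $S$. For $S\subset\Omega^*$, $[S]^{\prec}=\{\alpha\in\Omega^\infty\mid \exists n\ge 0,\ \alpha\upharpoonright_n\in S\}$. An r.e. infinite set is an infinite recursively enumerable set (of finite objects usable as Turing machine inputs). Probability spaces. For a countably infinite set $\Omega$, a discrete probability space on $\Omega$ is a function $P\colon\Omega\to\mathbb{R}$ with $P(a)\ge 0$ for all $a$ and $\sum_{a\in\Omega}P(a)=1$; $\mathbb{P}(\Omega)$ is the set of all of them. For $A\subset\Omega$, $P(A)=\sum_{a\in A}P(a)$. For $\sigma=\sigma_1\cdots\sigma_n\in\Omega^*$, $P(\sigma)=P(\sigma_1)\cdots P(\sigma_n)$ and $P(\lambda)=1$. The generalized Bernoulli measure $\lambda_P$ is the probability measure on the Borel $\sigma$-field of $\Omega^\infty$ (generated by the open sets $[S]^{\prec}$, $S\subset\Omega^*$) determined by $\lambda_P([\{\sigma\}]^{\prec})=P(\sigma)$ for all $\sigma\in\Omega^*$. For $\Omega$ an r.e. infinite set, $P\in\mathbb{P}(\Omega)$ is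 computable if there is a partial recursive function $f$ with domain exactly $\Omega\times\mathbb{N}$ and values in $\mathbb{Q}$ such that $|P(a)-f(a,k)|\le 2^{-k}$ for all $a\in\Omega$, $k\in\mathbb{N}$. Ensembles. Let $\Omega$ be an r.e. infinite set and $P\in\mathbb{P}(\Omega)$. A Martin-Löf $P$-test is an r.e. set $\mathcal{C}\subset\mathbb{N}^+\times\Omega^*$ such that for every $n\in\mathbb{N}^+$ the set $\mathcal{C}_n=\{\sigma\mid(n,\sigma)\in\mathcal{C}\}$ is prefix-free and $\lambda_P([\mathcal{C}_n]^{\prec})<2^{-n}$. A sequence $\alpha\in\Omega^\infty$ is Martin-Löf $P$-random if for every Martin-Löf $P$-test $\mathcal{C}$ there is $n\in\mathbb{N}^+$ with $\alpha\notin[\mathcal{C}_n]^{\prec}$. An ensemble for $P$ is a Martin-Löf $P$-random sequence in $\Omega^\infty$. Relativization. Let $\beta_1,\dots,\beta_\ell$ be infinite sequences, each over an r.e. infinite set. A Martin-Löf $P$-test relative to $\beta_1,\dots,\beta_\ell$ is a set $\mathcal{C}\subset\mathbb{N}^+\times\Omega^*$ that is the set of inputs in $\mathbb{N}^+\times\Omega^*$ accepted by some oracle Turing machine which may query any $(k,m)\in\{1,\dots,\ell\}\times\mathbb{N}^+$ and receives the answer $\beta_k(m)$, and such that for every $n\in\mathbb{N}^+$ the set $\mathcal{C}_n$ is prefix-free and $\lambda_P([\mathcal{C}_n]^{\prec})<2^{-n}$. A sequence $\alpha\in\Omega^\infty$ is Martin-Löf $P$-random relative to $\beta_1,\dots,\beta_\ell$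 if for every such test there is $n\in\mathbb{N}^+$ with $\alpha\notin[\mathcal{C}_n]^{\prec}$. Random variables. A random variable on $\Omega$ is a function $X\colon\Omega\to\Omega'$ with $\Omega'$ countably infinite. $X(P)\in\mathbb{P}(\Omega')$ is given by $X(P)(x)=P(\{a\in\Omega\mid X(a)=x\})$. For $\alpha\in\Omega^\infty$, $X(\alpha)\in(\Omega')^\infty$ is given by $X(\alpha)(k)=X(\alpha(k))$. Random variables $X_i\colon\Omega\to\Omega_i$ ($i=1,\dots,n$) are independent on $P$ if $P(\{a\mid X_1(a)=x_1,\dots,X_n(a)=x_n\})=\prod_{i=1}^n P(\{a\mid X_i(a)=x_i\})$ for all $x_1\in\Omega_1,\dots,x_n\in\Omega_n$. *)

theory Defs
  imports "HOL-Probability.Probability" "HOL-Library.Sublist" "HOL-Library.Nat_Bijection"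
begin

section \<open>Computability, with oracles\<close>

text \<open>
  Finite objects are given by natural numbers (Goedel numbers); tuples, strings and rational
  numbers are coded by the bijections of \<^theory>\<open>HOL-Library.Nat_Bijection\<close>.
  The model of computation is Kleene's: zero, successor, projections, composition, primitive
  recursion and minimization. The extra scheme \<open>Query\<close> asks the oracles
  \<open>\<beta>\<^sub>1, \<dots>, \<beta>\<^sub>l\<close>: on \<open>(k, m)\<close> with \<open>1 \<le> k \<le> l\<close> and \<open>m \<ge> 1\<close> it returns \<open>\<beta>\<^sub>k(m)\<close>, and it has no
  value on any other input. In particular it is nowhere defined for the empty list of oracles, so
  that programs then describe exactly the ordinary partial recursive functions.
  Streams are indexed from 0, hence the shift from \<open>m\<close> to \<open>m - 1\<close> (and likewise for lists).
\<close>

datatype prog =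
    Zero | Succ | Proj nat | Query
  | Comp prog "prog list"
  | PrimRec prog prog
  | Minim prog

inductive eval :: "nat stream list \<Rightarrow> prog \<Rightarrow> nat list \<Rightarrow> nat \<Rightarrow> bool"
  for \<beta>s :: "nat stream list" where
  eval_Zero: "eval \<beta>s Zero xs 0"
| eval_Succ: "eval \<beta>s Succ [x] (Suc x)"
| eval_Proj: "i < length xs \<Longrightarrow> eval \<beta>s (Proj i) xs (xs ! i)"
| eval_Query: "1 \<le> k \<Longrightarrow> k \<le> length \<beta>s \<Longrightarrow> 1 \<le> m \<Longrightarrow>
    eval \<beta>s Query [k, m] ((\<beta>s ! (k - 1)) !! (m - 1))"
| eval_Comp: "list_all2 (\<lambda>g y. eval \<beta>s g xs y) gs ys \<Longrightarrow> eval \<beta>s f ys z \<Longrightarrow>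
    eval \<beta>s (Comp f gs) xs z"
| eval_PrimRec_0: "eval \<beta>s f xs y \<Longrightarrow> eval \<beta>s (PrimRec f g) (0 # xs) y"
| eval_PrimRec_Suc: "eval \<beta>s (PrimRec f g) (n # xs) y \<Longrightarrow> eval \<beta>s g (n # y # xs) z \<Longrightarrow>
    eval \<beta>s (PrimRec f g) (Suc n # xs) z"
| eval_Minim: "eval \<beta>s f (n # xs) 0 \<Longrightarrow> (\<And>m. m < n \<Longrightarrow> \<exists>y. eval \<beta>s f (m # xs) (Suc y)) \<Longrightarrow>
    eval \<beta>s (Minim f) xs n"

inductive_cases eval_cases:
  "eval \<beta>s Zero xs y" "eval \<beta>s Succ xs y" "eval \<beta>s (Proj i) xs y" "eval \<beta>s Query xs y"
  "eval \<beta>s (Comp f gs) xs y" "eval \<beta>s (PrimRec f g) (0 # xs) y"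
  "eval \<beta>s (PrimRec f g) (Suc n # xs) y" "eval \<beta>s (Minim f) xs y"

lemma eval_deterministic: "eval \<beta>s f xs y \<Longrightarrow> eval \<beta>s f xs z \<Longrightarrow> y = z"
proof (induction arbitrary: z rule: eval.induct)
  case (eval_Comp xs gs ys f w)
  from eval_Comp.prems obtain ys' where
    ys': "list_all2 (\<lambda>g y. eval \<beta>s g xs y) gs ys'" "eval \<beta>s f ys' z"
    by (auto elim: eval_cases)
  have "ys = ys'"
    using eval_Comp.IH(1) ys'(1) by (auto simp: list_all2_conv_all_nth intro!: nth_equalityI)
  then show ?case using eval_Comp.IH(2) ys'(2) by blast
next
  case (eval_Minim f n xs)
  from eval_Minim.prems have z: "eval \<beta>s f (z # xs) 0"
    "\<And>m. m < z \<Longrightarrow> \<exists>y. eval \<beta>s f (m # xs) (Suc y)"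
    by (auto elim: eval_cases)
  show ?case
  proof (cases n z rule: linorder_cases)
    case less
    then obtain y where "eval \<beta>s f (n # xs) (Suc y)" using z(2) by blast
    then show ?thesis using eval_Minim.IH(1) by blast
  next
    case greater
    then show ?thesis using eval_Minim.IH(2) z(1) by blast
  qed simp
next
  case (eval_PrimRec_0 f xs y g)
  from eval_PrimRec_0.prems have "eval \<beta>s f xs z" by (auto elim: eval_cases)
  then show ?case by (rule eval_PrimRec_0.IH)
next
  case (eval_PrimRec_Suc f g n xs y w)
  from eval_PrimRec_Suc.prems obtain y' where
    "eval \<beta>s (PrimRec f g) (n # xs) y'" "eval \<beta>s g (n # y' # xs) z"
    by (auto elim: eval_cases)
  then show ?case using eval_PrimRec_Suc.IH by metis
qed (auto elim: eval_cases)

definition halts :: "nat stream list \<Rightarrow> prog \<Rightarrow> nat list \<Rightarrow> bool" where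
  "halts \<beta>s f xs \<longleftrightarrow> (\<exists>y. eval \<beta>s f xs y)"

definition recursively_enumerable :: "nat set \<Rightarrow> bool" where
  "recursively_enumerable A \<longleftrightarrow> (\<exists>f. A = {x. halts [] f [x]})"

definition re_infinite :: "nat set \<Rightarrow> bool" where
  "re_infinite \<Omega> \<longleftrightarrow> recursively_enumerable \<Omega> \<and> infinite \<Omega>"

definition partial_recursive_on :: "nat set \<Rightarrow> (nat \<Rightarrow> nat) \<Rightarrow> bool" where
  "partial_recursive_on \<Omega> X \<longleftrightarrow> (\<exists>f. \<forall>a y. eval [] f [a] y \<longleftrightarrow> a \<in> \<Omega> \<and> y = X a)"


section \<open>Discrete probability spaces and Bernoulli measures\<close>

text \<open>
  A discrete probability space on \<open>\<Omega>\<close> is a probability mass function vanishing outside \<open>\<Omega>\<close>.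
\<close>

definition discrete_prob_spaces :: "nat set \<Rightarrow> nat pmf set" where
  "discrete_prob_spaces \<Omega> = {P. set_pmf P \<subseteq> \<Omega>}"

definition rat_decode :: "nat \<Rightarrow> rat" where
  "rat_decode c = (case prod_decode c of (p, q) \<Rightarrow> of_int (int_decode p) / of_nat (Suc q))"

definition computable_pmf :: "nat set \<Rightarrow> nat pmf \<Rightarrow> bool" where
  "computable_pmf \<Omega> P \<longleftrightarrow>
    (\<exists>f. (\<forall>a k. halts [] f [a, k] \<longleftrightarrow> a \<in> \<Omega>) \<and>
         (\<forall>a k c. eval [] f [a, k] c \<longrightarrow> \<bar>pmf P a - of_rat (rat_decode c)\<bar> \<le> (1/2) ^ k))"

definition cyl :: "nat set \<Rightarrow> nat list set \<Rightarrow> nat stream set" where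
  "cyl \<Omega> S = {\<alpha> \<in> streams \<Omega>. \<exists>n. stake n \<alpha> \<in> S}"

text \<open>
  The measure lives on all streams of natural numbers; the streams over \<open>\<Omega>\<close> have full measure
  if \<open>P\<close> is concentrated on \<open>\<Omega>\<close>.
\<close>

definition bernoulli :: "nat pmf \<Rightarrow> nat stream measure" where
  "bernoulli P = stream_space (measure_pmf P)"

lemma cyl_singleton:
  assumes "\<sigma> \<in> lists \<Omega>"
  shows "cyl \<Omega> {\<sigma>} = sstart \<Omega> \<sigma>"
proof (intro set_eqI iffI)
  fix \<alpha> assume "\<alpha> \<in> cyl \<Omega> {\<sigma>}"
  then obtain n where n: "\<alpha> \<in> streams \<Omega>" "stake n \<alpha> = \<sigma>" by (auto simp: cyl_def)
  then show "\<alpha> \<in> sstart \<Omega> \<sigma>" by (auto simp: sstart_eq stake_nth)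
next
  fix \<alpha> assume *: "\<alpha> \<in> sstart \<Omega> \<sigma>"
  then have s: "\<alpha> \<in> streams \<Omega>" using sstart_in_streams[OF assms] by auto
  have "stake (length \<sigma>) \<alpha> = \<sigma>"
    using * by (intro nth_equalityI) (auto simp: sstart_eq[OF s] stake_nth)
  with s show "\<alpha> \<in> cyl \<Omega> {\<sigma>}" by (auto simp: cyl_def)
qed

lemma measure_bernoulli_cyl:
  assumes "set_pmf P \<subseteq> \<Omega>" "\<sigma> \<in> lists \<Omega>"
  shows "measure (bernoulli P) (cyl \<Omega> {\<sigma>}) = prod_list (map (pmf P) \<sigma>)"
proof -
  interpret S: prob_space "stream_space (measure_pmf P)"
    by (rule prob_space.prob_space_stream_space[OF prob_space_measure_pmf])
  have sets: "sets (stream_space (measure_pmf P)) = sets (stream_space (count_space UNIV))"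
    by (intro sets_stream_space_cong) simp
  have meas[measurable]: "sstart \<Omega> \<tau> \<in> sets (stream_space (measure_pmf P))" for \<tau>
    unfolding sets by (rule sstart_sets)
  have "emeasure (stream_space (measure_pmf P)) (sstart \<Omega> \<tau>)
      = ennreal (prod_list (map (pmf P) \<tau>))" for \<tau>
  proof (induction \<tau>)
    case Nil
    have "AE \<alpha> in stream_space (measure_pmf P). \<forall>i. \<alpha> !! i \<in> \<Omega>"
      unfolding AE_all_countable
    proof
      fix i
      have "AE x in measure_pmf P. x \<in> \<Omega>" using assms(1) by (auto simp: AE_measure_pmf_iff)
      then have "AE \<alpha> in stream_space (measure_pmf P). stream_all (\<lambda>x. x \<in> \<Omega>) \<alpha>"
        by (intro prob_space.AE_stream_all[OF prob_space_measure_pmf]) auto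
      then show "AE \<alpha> in stream_space (measure_pmf P). \<alpha> !! i \<in> \<Omega>"
        by eventually_elim (simp add: stream.pred_set sset_range)
    qed
    then have "AE \<alpha> in stream_space (measure_pmf P). \<alpha> \<in> streams \<Omega>"
      by (simp add: streams_iff_snth)
    moreover have "streams \<Omega> \<in> sets (stream_space (measure_pmf P))" using meas[of "[]"] by simp
    ultimately show ?case by (simp add: S.emeasure_eq_1_AE)
  next
    case (Cons a \<tau>)
    have "emeasure (stream_space (measure_pmf P)) (sstart \<Omega> (a # \<tau>)) =
      (\<integral>\<^sup>+t. emeasure (stream_space (measure_pmf P))
        {x \<in> space (stream_space (measure_pmf P)). t ## x \<in> sstart \<Omega> (a # \<tau>)} \<partial>measure_pmf P)"
      by (rule prob_space.emeasure_stream_space[OF prob_space_measure_pmf meas])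
    also have "\<dots> = (\<integral>\<^sup>+t. ennreal (prod_list (map (pmf P) \<tau>)) * indicator {a} t \<partial>measure_pmf P)"
    proof (rule nn_integral_cong)
      fix t
      have "{x \<in> space (stream_space (measure_pmf P)). t ## x \<in> sstart \<Omega> (a # \<tau>)} =
          (if t = a then sstart \<Omega> \<tau> else {})"
        by (auto simp: space_stream_space)
      then show "emeasure (stream_space (measure_pmf P))
          {x \<in> space (stream_space (measure_pmf P)). t ## x \<in> sstart \<Omega> (a # \<tau>)} =
          ennreal (prod_list (map (pmf P) \<tau>)) * indicator {a} t"
        using Cons.IH by (auto split: split_indicator)
    qed
    also have "\<dots> = ennreal (prod_list (map (pmf P) \<tau>)) * ennreal (pmf P a)"
      by (simp add: nn_integral_cmult_indicator emeasure_pmf_single)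
    finally show ?case by (simp add: mult.commute ennreal_mult' prod_list_nonneg)
  qed
  then have "measure (stream_space (measure_pmf P)) (sstart \<Omega> \<sigma>) = prod_list (map (pmf P) \<sigma>)"
    by (auto simp: measure_def intro!: enn2real_ennreal prod_list_nonneg)
  then show ?thesis
    unfolding bernoulli_def cyl_singleton[OF assms(2)] .
qed


section \<open>Martin-Loef randomness\<close>

definition prefix_free :: "'a list set \<Rightarrow> bool" where
  "prefix_free S \<longleftrightarrow> (\<forall>\<sigma>\<in>S. \<forall>\<tau>\<in>S. prefix \<sigma> \<tau> \<longrightarrow> \<sigma> = \<tau>)"

definition small_sections :: "nat set \<Rightarrow> nat pmf \<Rightarrow> (nat \<times> nat list) set \<Rightarrow> bool" where
  "small_sections \<Omega> P C \<longleftrightarrow>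
    (\<forall>n\<ge>1. prefix_free (C `` {n}) \<and> measure (bernoulli P) (cyl \<Omega> (C `` {n})) < (1/2) ^ n)"

definition ml_test :: "nat set \<Rightarrow> nat pmf \<Rightarrow> (nat \<times> nat list) set \<Rightarrow> bool" where
  "ml_test \<Omega> P C \<longleftrightarrow>
    C \<subseteq> {1..} \<times> lists \<Omega> \<and> recursively_enumerable ((\<lambda>(n, \<sigma>). prod_encode (n, list_encode \<sigma>)) ` C) \<and>
    small_sections \<Omega> P C"

definition ensemble :: "nat set \<Rightarrow> nat pmf \<Rightarrow> nat stream \<Rightarrow> bool" where
  "ensemble \<Omega> P \<alpha> \<longleftrightarrow>
    \<alpha> \<in> streams \<Omega> \<and> (\<forall>C. ml_test \<Omega> P C \<longrightarrow> (\<exists>n\<ge>1. \<alpha> \<notin> cyl \<Omega> (C `` {n})))"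

text \<open>
  The relativized notions; for \<open>ml_test_rel\<close> the set of accepted inputs is the domain of a partial
  function that is recursive in the oracles \<open>\<beta>s\<close>.
\<close>

definition ml_test_rel ::
  "nat set \<Rightarrow> nat pmf \<Rightarrow> nat stream list \<Rightarrow> (nat \<times> nat list) set \<Rightarrow> bool" where
  "ml_test_rel \<Omega> P \<beta>s C \<longleftrightarrow>
    (\<exists>f. C = {(n, \<sigma>) \<in> {1..} \<times> lists \<Omega>. halts \<beta>s f [prod_encode (n, list_encode \<sigma>)]}) \<and>
    small_sections \<Omega> P C"

definition ml_random_rel :: "nat set \<Rightarrow> nat pmf \<Rightarrow> nat stream list \<Rightarrow> nat stream \<Rightarrow> bool" where
  "ml_random_rel \<Omega> P \<beta>s \<alpha> \<longleftrightarrow>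
    \<alpha> \<in> streams \<Omega> \<and> (\<forall>C. ml_test_rel \<Omega> P \<beta>s C \<longrightarrow> (\<exists>n\<ge>1. \<alpha> \<notin> cyl \<Omega> (C `` {n})))"

definition components_ml_random ::
  "nat \<Rightarrow> (nat \<Rightarrow> nat set) \<Rightarrow> nat pmf \<Rightarrow> (nat \<Rightarrow> nat \<Rightarrow> nat) \<Rightarrow> nat stream \<Rightarrow> bool" where
  "components_ml_random n \<Omega>' P X \<alpha> \<longleftrightarrow>
    (\<forall>k\<in>{1..n - 1}. ml_random_rel (\<Omega>' k) (map_pmf (X k) P)
      (map (\<lambda>j. smap (X j) \<alpha>) [k + 1..<n + 1]) (smap (X k) \<alpha>))"


section \<open>Independence\<close>

definition indep_rvs ::
  "nat set \<Rightarrow> nat pmf \<Rightarrow> nat \<Rightarrow> (nat \<Rightarrow> nat set) \<Rightarrow> (nat \<Rightarrow> nat \<Rightarrow> nat) \<Rightarrow> bool" where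
  "indep_rvs \<Omega> P n \<Omega>' X \<longleftrightarrow>
    (\<forall>x \<in> Pi {1..n} \<Omega>'.
      measure_pmf.prob P {a \<in> \<Omega>. \<forall>i\<in>{1..n}. X i a = x i} =
      (\<Prod>i=1..n. measure_pmf.prob P {a \<in> \<Omega>. X i a = x i}))"

end

theory Submission
  imports Defs
begin

text \<open>
  The implications (i) to (ii), (ii) to (iii) and (iii) to (i) have three different reasons.

  \<^bold>\<open>Independence implies relative randomness.\<close> This is the easy half of van Lambalgen's theorem.
  Suppose that a test \<open>C\<close> with oracles \<open>X\<^sub>k\<^sub>+\<^sub>1(\<alpha>), \<dots>, X\<^sub>n(\<alpha>)\<close> catches \<open>X\<^sub>k(\<alpha>)\<close>. Let the program that
  enumerates \<open>C\<close> read its oracle answers from an arbitrary sample over \<open>\<Omega>\<close>; this gives open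
  sets of sequences over \<open>\<Omega>\<close> that contain \<open>\<alpha>\<close>. The bound on the measure of \<open>C\<close> is known for the true
  oracles only, so the sets are trimmed: a finite part of the enumeration is used only if the
  sum of the probabilities of its strings stays below the bound. Under independence, given the later
  components, the \<open>k\<close>-th component hits the trimmed part with at most this probability
  (\<open>prob_trimmed_le\<close>). The trimming condition is semidecidable, because
  the numbers \<open>P(X\<^sub>k = x) = 1 - P(X\<^sub>k \<noteq> x)\<close> can be approximated from above
  (\<open>semidecidable_weight_less\<close>). So \<open>\<alpha>\<close> is caught by a test without oracles
  (\<open>independent_component_random\<close>).

  \<^bold>\<open>Ensembles exist,\<close> because there are countably many tests and each of them catches a null set
  (\<open>ensemble_exists\<close>).

  \<^bold>\<open>One relatively random ensemble implies independence.\<close> This is the law of large numbers. Write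
  \<open>f\<^sub>k\<close> for the frequency in \<open>\<alpha>\<close> of the event \<open>X\<^sub>k = x\<^sub>k, \<dots>, X\<^sub>n = x\<^sub>n\<close>. The positions where the
  later components have the prescribed values are computable from the oracles, so along these positions
  the random sequence \<open>X\<^sub>k(\<alpha>)\<close> takes the value \<open>x\<^sub>k\<close> with frequency \<open>P(X\<^sub>k = x\<^sub>k)\<close>; hence \<open>f\<^sub>k\<close> is
  asymptotically \<open>P(X\<^sub>k = x\<^sub>k) f\<^sub>k\<^sub>+\<^sub>1\<close>, and \<open>f\<^sub>1\<close> tends to the product of the probabilities
  (\<open>components_ml_random_frequencies\<close>). As \<open>\<alpha>\<close> is random for \<open>P\<close>, \<open>f\<^sub>1\<close> also tends to the joint
  probability (\<open>ensemble_joint_frequencies\<close>). Both limits are taken along the lengths \<open>2\<^sup>j\<close>,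
  for which Chebyshev's inequality already yields a test (\<open>frequency_along_powers\<close>).

  All tests are built from two general facts. A semidecidable family of open sets of small measure is
  as good as a test, since it can be made prefix-free (\<open>ml_random_rel_avoids\<close>). And
  a program with oracles can be evaluated computably up to a time bound from a finite part of the
  oracles (\<open>clocked\<close>); since the programs in question are fixed, this needs recursion over the
  syntax of a program, but no universal program.
\<close>


section \<open>Coded types and computable functions\<close>

text \<open>
  Computability is transferred from numbers to pairs, lists and truth values by codes. The codes need
  not exhaust the natural numbers (those of truth values do not), so nothing is said about a program
  on numbers that are not codes.
\<close>

class coded =
  fixes code :: "'a \<Rightarrow> nat"
  assumes code_inject: "code x = code y \<longleftrightarrow> x = y"

instantiation nat :: coded
begin
definition "code (n::nat) = n"
instance by standard (simp add: code_nat_def)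
end

instantiation bool :: coded
begin
definition "code b = (of_bool b :: nat)"
instance by standard (simp add: code_bool_def)
end

instantiation prod :: (coded, coded) coded
begin
definition "code p = prod_encode (code (fst p), code (snd p))"
instance by standard (auto simp: code_prod_def code_inject prod_eq_iff)
end

instantiation list :: (coded) coded
begin
definition "code xs = list_encode (map code xs)"
instance by standard (auto simp: code_list_def list_encode_eq inj_map_eq_map code_inject inj_def)
end

lemma code_Pair: "code (x, y) = prod_encode (code x, code y)"
  by (simp add: code_prod_def)

lemma code_Nil: "code [] = 0"
  by (simp add: code_list_def)

lemma code_Cons: "code (x # xs) = Suc (prod_encode (code x, code xs))"
  by (simp add: code_list_def)

lemma code_nat_list: "code (xs :: nat list) = list_encode xs"
  by (simp add: code_list_def code_nat_def[abs_def])

lemma length_le_code: "length xs \<le> code xs"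
proof (induction xs)
  case (Cons x xs)
  then show ?case using le_prod_encode_2[of "code xs" "code x"] by (simp add: code_Cons)
qed simp

definition computable :: "nat stream list \<Rightarrow> ('a::coded \<Rightarrow> 'b::coded) \<Rightarrow> bool" where
  "computable \<beta>s F \<longleftrightarrow> (\<exists>p. \<forall>x. eval \<beta>s p [code x] (code (F x)))"

named_theorems computable_intros


subsection \<open>Programs for pairing\<close>

lemma eval_Comp1: "eval \<beta>s g xs y \<Longrightarrow> eval \<beta>s f [y] z \<Longrightarrow> eval \<beta>s (Comp f [g]) xs z"
  by (rule eval_Comp[where ys = "[y]"]) auto

lemma eval_Comp2:
  "eval \<beta>s g xs y \<Longrightarrow> eval \<beta>s g' xs y' \<Longrightarrow> eval \<beta>s f [y, y'] z \<Longrightarrow> eval \<beta>s (Comp f [g, g']) xs z"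
  by (rule eval_Comp[where ys = "[y, y']"]) auto

lemma eval_Comp3:
  "eval \<beta>s g xs y \<Longrightarrow> eval \<beta>s g' xs y' \<Longrightarrow> eval \<beta>s g'' xs y'' \<Longrightarrow> eval \<beta>s f [y, y', y''] z \<Longrightarrow>
    eval \<beta>s (Comp f [g, g', g'']) xs z"
  by (rule eval_Comp[where ys = "[y, y', y'']"]) auto

lemmas eval_Comps = eval_Comp1 eval_Comp2 eval_Comp3

lemma eval_Proj': "i < length xs \<Longrightarrow> y = xs ! i \<Longrightarrow> eval \<beta>s (Proj i) xs y"
  by (simp add: eval_Proj)

lemma eval_PrimRec:
  assumes "eval \<beta>s f xs (h 0)" "\<And>m. m < n \<Longrightarrow> eval \<beta>s g (m # h m # xs) (h (Suc m))"
  shows "eval \<beta>s (PrimRec f g) (n # xs) (h n)"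
  using assms by (induction n) (auto intro: eval_PrimRec_0 eval_PrimRec_Suc)

text \<open>
  Cantor's pairing is \<open>prod_encode (m, n) = triangle (m + n) + m\<close>. It is inverted by \<open>rootP\<close>, which
  finds \<open>m + n\<close> as the least \<open>k\<close> such that the code lies below \<open>triangle (k + 1)\<close>.
\<close>

definition "addP = PrimRec (Proj 0) (Comp Succ [Proj 1])"
definition "predP = PrimRec Zero (Proj 0)"
definition "monusP = PrimRec (Proj 0) (Comp predP [Proj 1])"
definition "triP = PrimRec Zero (Comp Succ [Comp addP [Proj 0, Proj 1]])"
definition "pairP = Comp addP [Comp triP [addP], Proj 0]"
definition "rootP = Minim (Comp monusP [Comp triP [Comp Succ [Proj 0]], Comp Succ [Proj 1]])"
definition "fstP = Comp monusP [Comp triP [rootP], Proj 0]"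
definition "sndP = Comp monusP [fstP, rootP]"

lemma eval_addP: "eval \<beta>s addP [m, n] (m + n)"
  unfolding addP_def
  by (rule eval_PrimRec) (auto intro!: eval_Comps eval_Proj' eval_Succ)

lemma eval_predP: "eval \<beta>s predP [n] (n - 1)"
  unfolding predP_def by (rule eval_PrimRec) (auto intro!: eval_Zero eval_Proj')

lemma eval_monusP: "eval \<beta>s monusP [m, n] (n - m)"
  unfolding monusP_def
proof (rule eval_PrimRec)
  show "eval \<beta>s (Proj 0) [n] (n - 0)" by (auto intro!: eval_Proj')
  show "eval \<beta>s (Comp predP [Proj 1]) [k, n - k, n] (n - Suc k)" for k
    using eval_predP[of \<beta>s "n - k"] by (auto intro!: eval_Comps eval_Proj')
qed

lemma eval_triP: "eval \<beta>s triP [n] (triangle n)"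
  unfolding triP_def
  by (rule eval_PrimRec)
    (use eval_addP in \<open>auto intro!: eval_Zero eval_Comps eval_Proj' eval_Succ simp: add.commute\<close>)

lemma eval_pairP: "eval \<beta>s pairP [m, n] (prod_encode (m, n))"
  unfolding pairP_def prod_encode_def
  by (auto intro!: eval_Comps eval_Proj' eval_addP eval_triP)

lemma eval_rootP: "eval \<beta>s rootP [prod_encode (m, n)] (m + n)"
  unfolding rootP_def
proof (rule eval_Minim)
  let ?f = "Comp monusP [Comp triP [Comp Succ [Proj 0]], Comp Succ [Proj 1]]"
  have *: "eval \<beta>s ?f [k, z] (Suc z - triangle (Suc k))" for k z
    using eval_monusP[of \<beta>s "triangle (Suc k)" "Suc z"]
    by (auto intro!: eval_Comps eval_Proj' eval_triP eval_Succ simp del: diff_Suc_Suc triangle_Suc)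
  have "Suc (prod_encode (m, n)) - triangle (Suc (m + n)) = 0"
    by (simp add: prod_encode_def)
  with *[of "m + n" "prod_encode (m, n)"]
  show "eval \<beta>s ?f [m + n, prod_encode (m, n)] 0" by simp
  fix k assume "k < m + n"
  have "mono triangle" by (rule incseq_SucI) simp
  with \<open>k < m + n\<close> have "triangle (Suc k) \<le> triangle (m + n)" by (simp add: monoD del: triangle_Suc)
  then have "Suc (prod_encode (m, n)) - triangle (Suc k) =
      Suc (prod_encode (m, n) - triangle (Suc k))"
    by (simp add: prod_encode_def)
  with *[of k "prod_encode (m, n)"] show "\<exists>y. eval \<beta>s ?f [k, prod_encode (m, n)] (Suc y)"
    by (metis)
qed

lemma eval_fstP: "eval \<beta>s fstP [prod_encode (m, n)] m"
proof -
  have "m = prod_encode (m, n) - triangle (m + n)" by (simp add: prod_encode_def)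
  then have "eval \<beta>s monusP [triangle (m + n), prod_encode (m, n)] m"
    using eval_monusP[of \<beta>s "triangle (m + n)" "prod_encode (m, n)"] by simp
  then show ?thesis
    unfolding fstP_def by (auto intro!: eval_Comps eval_Proj' eval_triP eval_rootP)
qed

lemma eval_sndP: "eval \<beta>s sndP [prod_encode (m, n)] n"
  using eval_monusP[of \<beta>s m "m + n"]
  unfolding sndP_def by (auto intro!: eval_Comps eval_fstP eval_rootP)


subsection \<open>Closure properties\<close>

text \<open>
  The rules are stated for functions of one environment \<open>x\<close> and are meant for backward application. A
  rule with a bound variable adds it to the environment as a component of a pair, which is why
  projections occur in the premises. A function that is known to be computable in several arguments
  enters a term through \<open>computable_compose\<close> and its variants.
\<close>

lemma computableI: "(\<And>x. eval \<beta>s p [code x] (code (F x))) \<Longrightarrow> computable \<beta>s F"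
  by (auto simp: computable_def)

lemma computable_same_code:
  assumes "computable \<beta>s F" "\<And>x. code (G x) = code (F x)" shows "computable \<beta>s G"
  using assms by (simp add: computable_def)

lemma computable_id [computable_intros]: "computable \<beta>s (\<lambda>x. x)"
  by (rule computableI[where p = "Proj 0"]) (simp add: eval_Proj')

lemma computable_const [computable_intros]: "computable \<beta>s (\<lambda>x. c)"
proof -
  have "\<exists>p. \<forall>xs. eval \<beta>s p xs n" for n
  proof (induction n)
    case 0 show ?case using eval_Zero by blast
  next
    case (Suc n)
    then obtain p where "\<And>xs. eval \<beta>s p xs n" by blast
    then have "\<forall>xs. eval \<beta>s (Comp Succ [p]) xs (Suc n)" by (blast intro: eval_Comp1 eval_Succ)
    then show ?case by blast
  qed
  then show ?thesis unfolding computable_def by blast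
qed

lemma computable_compose:
  assumes "computable \<beta>s F" "computable \<beta>s G"
  shows "computable \<beta>s (\<lambda>x. F (G x))"
proof -
  obtain p q where "\<And>x. eval \<beta>s p [code x] (code (F x))" "\<And>x. eval \<beta>s q [code x] (code (G x))"
    using assms by (auto simp: computable_def)
  then show ?thesis by (intro computableI[where p = "Comp p [q]"] eval_Comp1)
qed

lemma computable_Pair [computable_intros]:
  assumes "computable \<beta>s F" "computable \<beta>s G"
  shows "computable \<beta>s (\<lambda>x. (F x, G x))"
proof -
  obtain p q where "\<And>x. eval \<beta>s p [code x] (code (F x))" "\<And>x. eval \<beta>s q [code x] (code (G x))"
    using assms by (auto simp: computable_def)
  then show ?thesis
    by (intro computableI[where p = "Comp pairP [p, q]"]) (auto simp: code_Pair intro: eval_Comp2 eval_pairP)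
qed

lemma computable_fst [computable_intros]:
  "computable \<beta>s F \<Longrightarrow> computable \<beta>s (\<lambda>x. fst (F x))"
  by (rule computable_compose[where F = fst])
    (auto intro!: computableI[where p = fstP] eval_fstP simp: code_prod_def)

lemma computable_snd [computable_intros]:
  "computable \<beta>s F \<Longrightarrow> computable \<beta>s (\<lambda>x. snd (F x))"
  by (rule computable_compose[where F = snd])
    (auto intro!: computableI[where p = sndP] eval_sndP simp: code_prod_def)

lemma computable_compose2:
  assumes "computable \<beta>s (\<lambda>z. H (fst z) (snd z))" "computable \<beta>s F" "computable \<beta>s G"
  shows "computable \<beta>s (\<lambda>x. H (F x) (G x))"
  using computable_compose[OF assms(1) computable_Pair[OF assms(2,3)]] by simp

lemma computable_compose3:
  assumes "computable \<beta>s (\<lambda>z. H (fst z) (fst (snd z)) (snd (snd z)))"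
    "computable \<beta>s F" "computable \<beta>s G" "computable \<beta>s G'"
  shows "computable \<beta>s (\<lambda>x. H (F x) (G x) (G' x))"
  using computable_compose[OF assms(1) computable_Pair[OF assms(2) computable_Pair[OF assms(3,4)]]]
  by simp

lemma computable_code [computable_intros]:
  "computable \<beta>s F \<Longrightarrow> computable \<beta>s (\<lambda>x. code (F x))"
  by (rule computable_same_code, assumption) (simp add: code_nat_def)

lemma computable_Suc [computable_intros]:
  "computable \<beta>s F \<Longrightarrow> computable \<beta>s (\<lambda>x. Suc (F x))"
  by (rule computable_compose[where F = Suc])
    (auto intro!: computableI[where p = Succ] eval_Succ simp: code_nat_def)

lemma computable_rec_nat [computable_intros]:
  assumes "computable \<beta>s F"
    and "computable \<beta>s (\<lambda>z. G (fst z) (fst (snd z)) (snd (snd z)))"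
    and "computable \<beta>s H"
  shows "computable \<beta>s (\<lambda>x. rec_nat (F x) (\<lambda>n y. G x n y) (H x))"
proof -
  obtain p q r where p: "\<And>x. eval \<beta>s p [code x] (code (F x))"
    and q: "\<And>z. eval \<beta>s q [code z] (code (G (fst z) (fst (snd z)) (snd (snd z))))"
    and r: "\<And>x. eval \<beta>s r [code x] (code (H x))"
    using assms unfolding computable_def by blast
  let ?q = "Comp q [Comp pairP [Proj 2, Comp pairP [Proj 0, Proj 1]]]"
  have q': "eval \<beta>s ?q [n, code y, code x] (code (G x n y))" for n x y
    using q[of "(x, n, y)"]
    by (auto simp: code_Pair code_nat_def numeral_2_eq_2 intro!: eval_Comps eval_Proj' eval_pairP)
  have "eval \<beta>s (PrimRec p ?q) [n, code x] (code (rec_nat (F x) (\<lambda>n y. G x n y) n :: 'b))" for n x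
    by (rule eval_PrimRec) (use p q' in auto)
  then show ?thesis
    by (intro computableI[where p = "Comp (PrimRec p ?q) [r, Proj 0]"])
      (rule eval_Comp2[OF r], auto simp: code_nat_def intro!: eval_Proj')
qed

lemma computable_add [computable_intros]:
  assumes "computable \<beta>s F" "computable \<beta>s G" shows "computable \<beta>s (\<lambda>x. F x + G x :: nat)"
  by (rule computable_compose2[where H = "(+)", OF _ assms],
      rule computableI[where p = "Comp addP [fstP, sndP]"])
    (auto simp: code_prod_def code_nat_def intro!: eval_Comps eval_addP eval_fstP eval_sndP)

lemma computable_diff [computable_intros]:
  assumes "computable \<beta>s F" "computable \<beta>s G" shows "computable \<beta>s (\<lambda>x. F x - G x :: nat)"
  by (rule computable_compose2[where H = "(-)", OF _ assms],
      rule computableI[where p = "Comp monusP [sndP, fstP]"])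
    (auto simp: code_prod_def code_nat_def intro!: eval_Comps eval_monusP eval_fstP eval_sndP)

lemma computable_mult [computable_intros]:
  assumes "computable \<beta>s F" "computable \<beta>s G" shows "computable \<beta>s (\<lambda>x. F x * G x :: nat)"
proof -
  have *: "m * n = rec_nat 0 (\<lambda>_ y. n + y) m" for m n :: nat by (induction m) auto
  show ?thesis unfolding * by (intro computable_intros assms computable_compose[OF assms(2)])
qed

lemma computable_power [computable_intros]:
  assumes "computable \<beta>s F" "computable \<beta>s G" shows "computable \<beta>s (\<lambda>x. F x ^ G x :: nat)"
proof -
  have *: "m ^ n = rec_nat 1 (\<lambda>_ y. m * y) n" for m n :: nat by (induction n) auto
  show ?thesis unfolding * by (intro computable_intros assms computable_compose[OF assms(1)])
qed

lemma computable_of_bool [computable_intros]: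
  "computable \<beta>s F \<Longrightarrow> computable \<beta>s (\<lambda>x. of_bool (F x) :: nat)"
  by (rule computable_same_code, assumption) (simp add: code_nat_def code_bool_def)

lemma computable_If [computable_intros]:
  assumes "computable \<beta>s B" "computable \<beta>s F" "computable \<beta>s G"
  shows "computable \<beta>s (\<lambda>x. if B x then F x else G x)"
proof -
  have *: "(if b then u else v) = rec_nat v (\<lambda>_ _. u) (of_bool b)" for b and u v :: 'b by simp
  show ?thesis unfolding * by (intro computable_intros assms computable_compose[OF assms(2)])
qed

lemma computable_eq [computable_intros]:
  assumes "computable \<beta>s F" "computable \<beta>s G" shows "computable \<beta>s (\<lambda>x. F x = G x)"
proof -
  have *: "(u = v) = rec_nat True (\<lambda>_ _. False) ((code u - code v) + (code v - code u))" for u v :: 'b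
  proof (cases "u = v")
    case False
    then have "code u \<noteq> code v" by (simp add: code_inject)
    then obtain k where "(code u - code v) + (code v - code u) = Suc k"
      by (metis add_is_0 diff_is_0_eq le_antisym not0_implies_Suc)
    with False show ?thesis by simp
  qed simp
  show ?thesis unfolding * by (intro computable_intros assms)
qed

lemma computable_not [computable_intros]:
  "computable \<beta>s F \<Longrightarrow> computable \<beta>s (\<lambda>x. \<not> F x)"
  using computable_eq[OF _ computable_const[of \<beta>s False]] by simp

lemma computable_conj [computable_intros]:
  assumes "computable \<beta>s F" "computable \<beta>s G" shows "computable \<beta>s (\<lambda>x. F x \<and> G x)"
  using computable_If[OF assms computable_const[of \<beta>s False]]
  by (rule computable_same_code) simp

lemma computable_disj [computable_intros]:
  assumes "computable \<beta>s F" "computable \<beta>s G" shows "computable \<beta>s (\<lambda>x. F x \<or> G x)"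
  using computable_If[OF assms(1) computable_const[of \<beta>s True] assms(2)]
  by (rule computable_same_code) simp

lemma computable_le [computable_intros]:
  assumes "computable \<beta>s F" "computable \<beta>s G" shows "computable \<beta>s (\<lambda>x. F x \<le> (G x :: nat))"
  using computable_eq[OF computable_diff[OF assms] computable_const[of \<beta>s 0]] by simp

lemma computable_less [computable_intros]:
  assumes "computable \<beta>s F" "computable \<beta>s G" shows "computable \<beta>s (\<lambda>x. F x < (G x :: nat))"
  using computable_le[OF computable_Suc[OF assms(1)] assms(2)] by (simp add: Suc_le_eq)

lemma computable_Least:
  assumes "computable \<beta>s (\<lambda>z. B (fst z) (snd z))" "\<And>x. \<exists>n. B x (n::nat)"
  shows "computable \<beta>s (\<lambda>x. LEAST n. B x n)"
proof -
  have "computable \<beta>s (\<lambda>z. \<not> B (fst z) (snd z))" using assms(1) by (rule computable_not)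
  then obtain p where p: "\<And>z. eval \<beta>s p [code z] (of_bool (\<not> B (fst z) (snd z)))"
    unfolding computable_def code_bool_def by blast
  let ?p = "Comp p [Comp pairP [Proj 1, Proj 0]]"
  have p': "eval \<beta>s ?p [n, code x] (of_bool (\<not> B x n))" for n x
    using p[of "(x, n)"]
    by (auto simp: code_Pair code_nat_def intro!: eval_Comps eval_Proj' eval_pairP)
  show ?thesis
  proof (rule computableI[where p = "Minim ?p"])
    fix x
    show "eval \<beta>s (Minim ?p) [code x] (code (LEAST n. B x n))"
    proof (rule eval_Minim)
      show "eval \<beta>s ?p [code (LEAST n. B x n), code x] 0"
        using p'[of "LEAST n. B x n" x] LeastI_ex[OF assms(2)[of x]] by (simp add: code_nat_def)
      fix m assume "m < code (LEAST n. B x n)"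
      then have "\<not> B x m" using not_less_Least by (auto simp: code_nat_def)
      then show "\<exists>y. eval \<beta>s ?p [m, code x] (Suc y)" using p'[of m x] by auto
    qed
  qed
qed

lemma computable_div [computable_intros]:
  assumes "computable \<beta>s F" "computable \<beta>s G" shows "computable \<beta>s (\<lambda>x. F x div G x :: nat)"
proof -
  have *: "m div n = (if n = 0 then 0 else LEAST k. n = 0 \<or> m < n * Suc k)" for m n :: nat
  proof (cases "n = 0")
    case False
    then have "(LEAST k. n = 0 \<or> m < n * Suc k) = m div n"
      by (intro Least_equality)
        (auto simp: dividend_less_times_div, metis div_le_mono less_Suc_eq_le mult_Suc_right nonzero_mult_div_cancel_left div_less_iff_less_mult less_mult_imp_div_less mult.commute)
    then show ?thesis using False by simp
  qed simp
  have ex: "\<exists>k. n = 0 \<or> m < n * Suc k" for m n :: nat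
    by (metis dividend_less_times_div mult_Suc_right gr0I)
  show ?thesis
    unfolding * 
    by (intro computable_intros assms computable_Least ex computable_compose[OF assms(1)] computable_compose[OF assms(2)])
qed

lemma computable_oracle:
  assumes "k < length \<beta>s" "computable \<beta>s F"
  shows "computable \<beta>s (\<lambda>x. (\<beta>s ! k) !! F x)"
proof -
  have "computable \<beta>s (\<lambda>x. Suc (F x))" using assms(2) by (rule computable_Suc)
  then obtain p where p: "\<And>x. eval \<beta>s p [code x] (Suc (F x))"
    unfolding computable_def code_nat_def by blast
  have "computable \<beta>s (\<lambda>x::'a. Suc k)" by (rule computable_const)
  then obtain q where q: "\<And>x::'a. eval \<beta>s q [code x] (Suc k)"
    unfolding computable_def code_nat_def by blast
  have "eval \<beta>s Query [Suc k, Suc m] (code ((\<beta>s ! k) !! m))" for m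
    using eval_Query[of "Suc k" \<beta>s "Suc m"] assms(1) by (simp add: code_nat_def)
  then show ?thesis
    by (intro computableI[where p = "Comp Query [q, p]"] eval_Comp2[OF q p])
qed


subsection \<open>Lists\<close>

lemma computable_Cons [computable_intros]:
  assumes "computable \<beta>s F" "computable \<beta>s G" shows "computable \<beta>s (\<lambda>x. F x # G x)"
  by (rule computable_compose2[where H = Cons, OF _ assms], rule computableI[where p = Succ])
    (auto simp: code_prod_def code_Cons intro: eval_Succ)

lemma computable_case_list [computable_intros]:
  assumes "computable \<beta>s L" "computable \<beta>s F"
    and "computable \<beta>s (\<lambda>z. G (fst z) (fst (snd z)) (snd (snd z)))"
  shows "computable \<beta>s (\<lambda>x. case L x of [] \<Rightarrow> F x | y # ys \<Rightarrow> G x y ys)"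
proof -
  obtain l p q where l: "\<And>x. eval \<beta>s l [code x] (code (L x))"
    and p: "\<And>x. eval \<beta>s p [code x] (code (F x))"
    and q: "\<And>z. eval \<beta>s q [code z] (code (G (fst z) (fst (snd z)) (snd (snd z))))"
    using assms unfolding computable_def by blast
  \<comment> \<open>Recursion on the sign of the code evaluates the second branch on codes of pairs only.\<close>
  let ?q = "Comp q [Comp pairP [Proj 2, Comp predP [Proj 3]]]"
  let ?s = "PrimRec Zero (Comp Succ [Zero])"
  let ?r = "PrimRec (Comp p [Proj 0]) ?q"
  have s: "eval \<beta>s ?s [c] (of_bool (c \<noteq> 0))" for c
    by (rule eval_PrimRec) (auto intro: eval_Zero eval_Comp1 eval_Succ)
  have r0: "eval \<beta>s ?r [0, code x, c] (code (F x))" for x c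
    by (auto intro!: eval_PrimRec_0 eval_Comps eval_Proj' p)
  have r: "eval \<beta>s ?r [of_bool (code (L x) \<noteq> 0), code x, code (L x)]
      (code (case L x of [] \<Rightarrow> F x | y # ys \<Rightarrow> G x y ys))" for x
  proof (cases "L x")
    case Nil
    then show ?thesis using r0 by (simp add: code_Nil)
  next
    case (Cons y ys)
    have "eval \<beta>s predP [code (L x)] (prod_encode (code y, code ys))"
      using eval_predP[of \<beta>s "code (L x)"] by (simp add: Cons code_Cons)
    then have "eval \<beta>s (Comp predP [Proj 3]) [0, w, code x, code (L x)]
      (prod_encode (code y, code ys))" for w
      by (auto intro!: eval_Comps eval_Proj')
    then have "eval \<beta>s (Comp pairP [Proj 2, Comp predP [Proj 3]]) [0, w, code x, code (L x)]
      (code (x, y, ys))" for w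
      by (auto simp: code_Pair intro!: eval_Comp2[OF _ _ eval_pairP] eval_Proj')
    then have "eval \<beta>s ?q [0, code (F x), code x, code (L x)] (code (G x y ys))"
      using q[of "(x, y, ys)"] by (auto intro: eval_Comp1)
    with r0[of x "code (L x)"] have "eval \<beta>s ?r [Suc 0, code x, code (L x)] (code (G x y ys))"
      by (rule eval_PrimRec_Suc)
    then show ?thesis by (simp add: Cons code_Cons)
  qed
  show ?thesis
    by (rule computableI[where p = "Comp ?r [Comp ?s [l], Proj 0, l]"], rule eval_Comp3[OF _ _ l r])
      (rule eval_Comp1[OF l s], simp add: eval_Proj')
qed

text \<open>
  Primitive recursion over a list is recursion over a number: the code of the list bounds its
  length, and steps after the end of the list do nothing.
\<close>

lemma computable_foldl [computable_intros]:
  assumes "computable \<beta>s (\<lambda>z. G (fst z) (fst (snd z)) (snd (snd z)))"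
    and "computable \<beta>s A" "computable \<beta>s L"
  shows "computable \<beta>s (\<lambda>x. foldl (\<lambda>a y. G x a y) (A x) (L x))"
proof -
  let ?step = "\<lambda>x s. case fst s of [] \<Rightarrow> s | y # ys \<Rightarrow> (ys, G x (snd s) y)"
  have "snd (rec_nat (l, a) (\<lambda>_. ?step x) n) = foldl (G x) a l" if "length l \<le> n" for l a n x
  proof -
    have "rec_nat (l, a) (\<lambda>_. ?step x) n = (drop n l, foldl (G x) a (take n l))" for n
    proof (induction n)
      case (Suc n)
      show ?case
      proof (cases "n < length l")
        case True
        then show ?thesis
          by (simp add: Suc take_Suc_conv_app_nth Cons_nth_drop_Suc[symmetric])
      qed (simp add: Suc)
    qed simp
    then show ?thesis using that by simp
  qed
  then have "foldl (G x) (A x) (L x) = snd (rec_nat (L x, A x) (\<lambda>_. ?step x) (code (L x)))" for x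
    by (simp add: length_le_code)
  moreover have "computable \<beta>s (\<lambda>x. snd (rec_nat (L x, A x) (\<lambda>_ s. ?step x s) (code (L x))))"
    by (intro computable_intros assms computable_compose3[OF assms(1)])
  ultimately show ?thesis by simp
qed

lemma computable_rev [computable_intros]:
  assumes "computable \<beta>s L" shows "computable \<beta>s (\<lambda>x. rev (L x))"
proof -
  have *: "rev l = foldl (\<lambda>a y. y # a) [] l" for l :: "'b list"
    by (simp add: foldl_conv_fold fold_Cons_rev)
  show ?thesis unfolding * by (intro assms computable_intros)
qed

lemma computable_foldr [computable_intros]:
  assumes "computable \<beta>s (\<lambda>z. G (fst z) (fst (snd z)) (snd (snd z)))"
    and "computable \<beta>s A" "computable \<beta>s L"
  shows "computable \<beta>s (\<lambda>x. foldr (\<lambda>y a. G x y a) (L x) (A x))"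
  unfolding foldr_conv_foldl by (intro computable_intros assms computable_compose3[OF assms(1)])

lemma computable_map [computable_intros]:
  assumes "computable \<beta>s (\<lambda>z. G (fst z) (snd z))" "computable \<beta>s L"
  shows "computable \<beta>s (\<lambda>x. map (\<lambda>y. G x y) (L x))"
proof -
  have *: "map g l = foldr (\<lambda>y a. g y # a) l []" for g :: "'b \<Rightarrow> 'c" and l by (induction l) auto
  show ?thesis unfolding * by (intro computable_intros assms computable_compose2[OF assms(1)])
qed

lemma computable_filter [computable_intros]:
  assumes "computable \<beta>s (\<lambda>z. G (fst z) (snd z))" "computable \<beta>s L"
  shows "computable \<beta>s (\<lambda>x. filter (\<lambda>y. G x y) (L x))"
proof -
  have *: "filter g l = foldr (\<lambda>y a. if g y then y # a else a) l []" for g :: "'b \<Rightarrow> bool" and l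
    by (induction l) auto
  show ?thesis unfolding * by (intro computable_intros assms computable_compose2[OF assms(1)])
qed

lemma computable_Ball_set [computable_intros]:
  assumes "computable \<beta>s (\<lambda>z. G (fst z) (snd z))" "computable \<beta>s L"
  shows "computable \<beta>s (\<lambda>x. \<forall>y\<in>set (L x). G x y)"
proof -
  have *: "(\<forall>y\<in>set l. g y) = foldr (\<lambda>y a. g y \<and> a) l True" for g :: "'b \<Rightarrow> bool" and l
    by (induction l) auto
  show ?thesis unfolding * by (intro computable_intros assms computable_compose2[OF assms(1)])
qed

lemma computable_Bex_set [computable_intros]:
  assumes "computable \<beta>s (\<lambda>z. G (fst z) (snd z))" "computable \<beta>s L"
  shows "computable \<beta>s (\<lambda>x. \<exists>y\<in>set (L x). G x y)"
proof -
  have *: "(\<exists>y\<in>set l. g y) = foldr (\<lambda>y a. g y \<or> a) l False" for g :: "'b \<Rightarrow> bool" and l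
    by (induction l) auto
  show ?thesis unfolding * by (intro computable_intros assms computable_compose2[OF assms(1)])
qed

lemma computable_sum_list [computable_intros]:
  assumes "computable \<beta>s L" shows "computable \<beta>s (\<lambda>x. sum_list (L x) :: nat)"
  unfolding sum_list.eq_foldr by (intro computable_intros assms)

lemma computable_prod_list [computable_intros]:
  assumes "computable \<beta>s L" shows "computable \<beta>s (\<lambda>x. prod_list (L x) :: nat)"
  unfolding prod_list.eq_foldr by (intro computable_intros assms)

lemma computable_length [computable_intros]:
  assumes "computable \<beta>s L" shows "computable \<beta>s (\<lambda>x. length (L x))"
proof -
  have *: "length l = foldr (\<lambda>_ a. Suc a) l 0" for l :: "'b list" by (induction l) auto
  show ?thesis unfolding * by (intro computable_intros assms)
qed

lemma computable_append [computable_intros]: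
  assumes "computable \<beta>s L" "computable \<beta>s M" shows "computable \<beta>s (\<lambda>x. L x @ M x)"
proof -
  have *: "l @ m = foldr (\<lambda>y a. y # a) l m" for l m :: "'b list" by (induction l) auto
  show ?thesis unfolding * by (intro computable_intros assms)
qed

lemma computable_drop [computable_intros]:
  assumes "computable \<beta>s N" "computable \<beta>s L" shows "computable \<beta>s (\<lambda>x. drop (N x) (L x))"
proof -
  have *: "drop n l = rec_nat l (\<lambda>_ r. case r of [] \<Rightarrow> [] | _ # r' \<Rightarrow> r') n" for n and l :: "'b list"
  proof (induction n)
    case (Suc n)
    have "(case r of [] \<Rightarrow> [] | _ # r' \<Rightarrow> r') = tl r" for r :: "'b list" by (cases r) auto
    with Suc show ?case by (simp add: drop_Suc drop_tl)
  qed simp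
  show ?thesis unfolding * by (intro computable_intros assms)
qed

lemma computable_take [computable_intros]:
  assumes "computable \<beta>s N" "computable \<beta>s L" shows "computable \<beta>s (\<lambda>x. take (N x) (L x))"
proof -
  have *: "take n l = rev (drop (length l - n) (rev l))" for n and l :: "'b list"
    by (cases "n \<le> length l") (auto simp: rev_drop)
  show ?thesis unfolding * by (intro computable_intros assms)
qed

lemma computable_butlast [computable_intros]:
  assumes "computable \<beta>s L" shows "computable \<beta>s (\<lambda>x. butlast (L x))"
  unfolding butlast_conv_take by (intro computable_intros assms)

lemma computable_upt [computable_intros]:
  assumes "computable \<beta>s N" shows "computable \<beta>s (\<lambda>x. [0..<N x])"
proof -
  have *: "[0..<n] = rec_nat [] (\<lambda>k r. r @ [k]) n" for n by (induction n) auto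
  show ?thesis unfolding * by (intro computable_intros assms)
qed

text \<open>
  The guard is part of the function because \<open>xs ! i\<close> has no known value beyond the end of \<open>xs\<close>.
\<close>

lemma computable_nth_default:
  assumes "computable \<beta>s D" "computable \<beta>s L" "computable \<beta>s N"
  shows "computable \<beta>s (\<lambda>x. if N x < length (L x) then L x ! N x else D x)"
proof -
  have *: "(if n < length l then l ! n else d) = (case drop n l of [] \<Rightarrow> d | y # _ \<Rightarrow> y)"
    for n d and l :: "'b list"
    by (auto split: list.split simp: nth_via_drop)
  show ?thesis unfolding * by (intro computable_intros assms)
qed

lemma computable_list_decode [computable_intros]:
  "computable \<beta>s F \<Longrightarrow> computable \<beta>s (\<lambda>x. list_decode (F x))"
  by (rule computable_same_code, assumption) (simp add: code_nat_list code_nat_def)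

lemma computable_prod_decode [computable_intros]:
  "computable \<beta>s F \<Longrightarrow> computable \<beta>s (\<lambda>x. prod_decode (F x))"
  by (rule computable_same_code, assumption) (simp add: code_prod_def code_nat_def)

lemma computable_fixed_map:
  assumes "\<And>g. g \<in> set gs \<Longrightarrow> computable \<beta>s (\<lambda>x. h g x)"
  shows "computable \<beta>s (\<lambda>x. map (\<lambda>g. h g x) gs)"
  using assms by (induction gs) (auto intro!: computable_intros)


section \<open>Clocked evaluation\<close>

text \<open>
  The value \<open>0\<close> stands for \<open>no value so far\<close> and \<open>Suc y\<close> for the value \<open>y\<close>. The function \<open>q\<close> answers
  the oracle queries in the same format. The clock \<open>s\<close> only has to bound the search in \<open>Minim\<close>,
  everything else terminates by recursion over the program.
\<close>

fun clocked :: "(nat list \<Rightarrow> nat) \<Rightarrow> nat \<Rightarrow> prog \<Rightarrow> nat list \<Rightarrow> nat" where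
  "clocked q s Zero xs = 1"
| "clocked q s Succ xs = (case xs of [] \<Rightarrow> 0 | x # zs \<Rightarrow> if zs = [] then Suc (Suc x) else 0)"
| "clocked q s (Proj i) xs = (if i < length xs then Suc (xs ! i) else 0)"
| "clocked q s Query xs = q xs"
| "clocked q s (Comp f gs) xs =
    (if \<exists>y\<in>set (map (\<lambda>g. clocked q s g xs) gs). y = 0 then 0
     else clocked q s f (map (\<lambda>y. y - 1) (map (\<lambda>g. clocked q s g xs) gs)))"
| "clocked q s (PrimRec f g) xs = (case xs of [] \<Rightarrow> 0 | n # zs \<Rightarrow>
    rec_nat (clocked q s f zs) (\<lambda>m y. if y = 0 then 0 else clocked q s g (m # (y - 1) # zs)) n)"
| "clocked q s (Minim f) xs =
    (case filter (\<lambda>n. clocked q s f (n # xs) = 1 \<and>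
        (\<forall>m\<in>set [0..<n]. 1 < clocked q s f (m # xs))) [0..<s]
     of [] \<Rightarrow> 0 | n # _ \<Rightarrow> Suc n)"

lemma clocked_Comp_iff:
  "clocked q s (Comp f gs) xs = Suc z \<longleftrightarrow>
    (\<exists>ys. list_all2 (\<lambda>g y. clocked q s g xs = Suc y) gs ys \<and> clocked q s f ys = Suc z)"
    (is "?L \<longleftrightarrow> ?R")
proof
  assume ?L
  then have pos: "\<forall>g\<in>set gs. clocked q s g xs \<noteq> 0"
    and z: "clocked q s f (map (\<lambda>g. clocked q s g xs - 1) gs) = Suc z"
    by (auto simp: o_def split: if_splits)
  have "list_all2 (\<lambda>g y. clocked q s g xs = Suc y) gs (map (\<lambda>g. clocked q s g xs - 1) gs)"
    using pos by (auto simp: list_all2_conv_all_nth)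
  with z show ?R by blast
next
  assume ?R
  then obtain ys where ys: "list_all2 (\<lambda>g y. clocked q s g xs = Suc y) gs ys"
    and z: "clocked q s f ys = Suc z" by blast
  have "map (\<lambda>g. clocked q s g xs - 1) gs = ys"
    using ys by (auto simp: list_all2_conv_all_nth intro!: nth_equalityI)
  moreover have "\<forall>g\<in>set gs. clocked q s g xs \<noteq> 0"
    using ys by (auto simp: list_all2_conv_all_nth in_set_conv_nth)
  ultimately show ?L using z by (auto simp: o_def)
qed

lemma clocked_PrimRec_Suc_iff:
  "clocked q s (PrimRec f g) (Suc n # xs) = Suc z \<longleftrightarrow>
    (\<exists>y. clocked q s (PrimRec f g) (n # xs) = Suc y \<and> clocked q s g (n # y # xs) = Suc z)"
  by (cases "clocked q s (PrimRec f g) (n # xs)") auto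

lemma clocked_Minim_iff:
  "clocked q s (Minim f) xs = Suc n \<longleftrightarrow>
    n < s \<and> clocked q s f (n # xs) = 1 \<and> (\<forall>m<n. \<exists>y. clocked q s f (m # xs) = Suc (Suc y))"
    (is "?L \<longleftrightarrow> ?R n")
proof -
  define Q where "Q n \<longleftrightarrow> clocked q s f (n # xs) = 1 \<and>
        (\<forall>m\<in>set [0..<n]. 1 < clocked q s f (m # xs))" for n
  have Q_iff: "Q n \<longleftrightarrow> clocked q s f (n # xs) = 1 \<and> (\<forall>m<n. \<exists>y. clocked q s f (m # xs) = Suc (Suc y))"
    for n
  proof -
    have "1 < k \<longleftrightarrow> (\<exists>y. k = Suc (Suc y))" for k :: nat by presburger
    then show ?thesis unfolding Q_def by auto
  qed
  have unique: "n = m" if "Q n" "Q m" for n m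
    using that by (metis Q_iff One_nat_def Suc_inject nat.distinct(1) linorder_neqE_nat)
  have *: "clocked q s (Minim f) xs = (case filter Q [0..<s] of [] \<Rightarrow> 0 | n # _ \<Rightarrow> Suc n)"
    unfolding Q_def by simp
  show ?thesis
  proof
    assume ?L
    then obtain ms where "filter Q [0..<s] = n # ms" unfolding * by (auto split: list.splits)
    then have "n \<in> set (filter Q [0..<s])" by simp
    then show "?R n" by (auto simp: Q_iff)
  next
    assume "?R n"
    then have "Q n" "n \<in> set (filter Q [0..<s])" by (auto simp: Q_iff)
    then obtain m ms where m: "filter Q [0..<s] = m # ms" by (cases "filter Q [0..<s]") auto
    then have "m \<in> set (filter Q [0..<s])" by simp
    then have "m = n" using unique \<open>Q n\<close> by auto
    with m show ?L unfolding * by simp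
  qed
qed

lemma clocked_PrimRec_0: "clocked q s (PrimRec f g) (0 # xs) = clocked q s f xs"
  by simp

lemmas clocked_iffs = clocked_Comp_iff clocked_PrimRec_0 clocked_PrimRec_Suc_iff clocked_Minim_iff

declare clocked.simps(5-7) [simp del]

lemma clocked_mono:
  assumes "\<And>xs y. q xs = Suc y \<Longrightarrow> q' xs = Suc y" "s \<le> s'"
  shows "clocked q s f xs = Suc y \<Longrightarrow> clocked q' s' f xs = Suc y"
proof (induction f arbitrary: xs y)
  case (Comp f gs)
  from Comp.prems obtain ys where "list_all2 (\<lambda>g y. clocked q s g xs = Suc y) gs ys"
    "clocked q s f ys = Suc y" unfolding clocked_Comp_iff by blast
  with Comp.IH show ?case unfolding clocked_Comp_iff
    by (intro exI[of _ ys]) (auto simp: list_all2_conv_all_nth)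
next
  case (PrimRec f g)
  show ?case
  proof (cases xs)
    case Nil
    then show ?thesis using PrimRec.prems by (simp add: clocked.simps)
  next
    case (Cons n zs)
    have "clocked q s (PrimRec f g) (n # zs) = Suc y \<Longrightarrow> clocked q' s' (PrimRec f g) (n # zs) = Suc y"
      for y using PrimRec.IH by (induction n arbitrary: y) (auto simp: clocked_iffs)
    then show ?thesis using PrimRec.prems Cons by simp
  qed
next
  case (Minim f)
  from Minim.prems have "y < s" "clocked q s f (y # xs) = Suc 0"
    "\<forall>m<y. \<exists>z. clocked q s f (m # xs) = Suc (Suc z)"
    unfolding clocked_Minim_iff One_nat_def by blast+
  then have "y < s'" "clocked q' s' f (y # xs) = Suc 0"
    "\<forall>m<y. \<exists>z. clocked q' s' f (m # xs) = Suc (Suc z)"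
    using assms(2) Minim.IH by (simp, blast, blast)
  then show ?case unfolding clocked_Minim_iff One_nat_def by blast
qed (use assms in \<open>auto split: if_splits list.splits\<close>)

lemma clocked_sound:
  assumes "\<And>xs y. q xs = Suc y \<Longrightarrow> eval \<beta>s Query xs y"
  shows "clocked q s f xs = Suc y \<Longrightarrow> eval \<beta>s f xs y"
proof (induction f arbitrary: xs y)
  case (Comp f gs)
  from Comp.prems obtain ys where "list_all2 (\<lambda>g y. clocked q s g xs = Suc y) gs ys"
    "clocked q s f ys = Suc y" unfolding clocked_Comp_iff by blast
  with Comp.IH show ?case
    by (intro eval_Comp[of _ _ _ ys]) (auto simp: list_all2_conv_all_nth)
next
  case (PrimRec f g)
  show ?case
  proof (cases xs)
    case Nil
    then show ?thesis using PrimRec.prems by (simp add: clocked.simps)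
  next
    case (Cons n zs)
    have "clocked q s (PrimRec f g) (n # zs) = Suc y \<Longrightarrow> eval \<beta>s (PrimRec f g) (n # zs) y"
      for y
    proof (induction n arbitrary: y)
      case 0
      then show ?case
        by (intro eval_PrimRec_0 PrimRec.IH(1)) (simp add: clocked_PrimRec_0)
    next
      case (Suc n)
      then obtain w where "clocked q s (PrimRec f g) (n # zs) = Suc w"
        "clocked q s g (n # w # zs) = Suc y"
        unfolding clocked_PrimRec_Suc_iff by blast
      then show ?case by (intro eval_PrimRec_Suc[OF Suc.IH] PrimRec.IH(2))
    qed
    then show ?thesis using PrimRec.prems Cons by simp
  qed
next
  case (Minim f)
  from Minim.prems have *: "clocked q s f (y # xs) = Suc 0"
    "\<And>m. m < y \<Longrightarrow> \<exists>z. clocked q s f (m # xs) = Suc (Suc z)"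
    unfolding clocked_Minim_iff One_nat_def by blast+
  show ?case
  proof (rule eval_Minim)
    show "eval \<beta>s f (y # xs) 0" using *(1) by (rule Minim.IH)
    show "\<exists>z. eval \<beta>s f (m # xs) (Suc z)" if "m < y" for m
      using *(2)[OF that] Minim.IH by blast
  qed
qed (use assms in \<open>auto split: if_splits list.splits intro: eval_Zero eval_Succ eval_Proj\<close>)

text \<open>
  A terminating computation asks finitely many queries, so it is found once the clock and the
  finite parts \<open>q s\<close> of the oracles are large enough.
\<close>

lemma clocked_complete:
  fixes q :: "nat \<Rightarrow> nat list \<Rightarrow> nat"
  assumes mono: "\<And>s t xs y. s \<le> t \<Longrightarrow> q s xs = Suc y \<Longrightarrow> q t xs = Suc y"
    and query: "\<And>xs y. eval \<beta>s Query xs y \<Longrightarrow> \<exists>s. q s xs = Suc y"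
  shows "eval \<beta>s f xs y \<Longrightarrow> \<exists>s. clocked (q s) s f xs = Suc y"
proof -
  have up: "clocked (q t) t f xs = Suc y" if "clocked (q s) s f xs = Suc y" "s \<le> t" for s t f xs y
    by (rule clocked_mono[OF _ that(2,1)]) (rule mono[OF that(2)])
  show "eval \<beta>s f xs y \<Longrightarrow> \<exists>s. clocked (q s) s f xs = Suc y"
  proof (induction rule: eval.induct)
    case (eval_Query k m)
    then show ?case using query[OF eval.eval_Query] by auto
  next
    case (eval_Comp xs gs ys f z)
    then obtain t where t: "clocked (q t) t f ys = Suc z" by blast
    have "\<exists>s. list_all2 (\<lambda>g y. clocked (q s) s g xs = Suc y) gs ys"
      using eval_Comp.IH(1)
    proof (induction rule: list_all2_induct)
      case (Cons g gs y ys)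
      then obtain s s' where s: "clocked (q s) s g xs = Suc y"
        "list_all2 (\<lambda>g y. clocked (q s') s' g xs = Suc y) gs ys" by blast
      then show ?case
        by (intro exI[of _ "max s s'"])
          (auto intro: up[OF _ max.cobounded1] up[OF _ max.cobounded2] elim!: list_all2_mono)
    qed simp
    then obtain s where s: "list_all2 (\<lambda>g y. clocked (q s) s g xs = Suc y) gs ys" by blast
    show ?case unfolding clocked_Comp_iff
      using s t
      by (intro exI[of _ "max s t"] exI[of _ ys])
        (auto intro: up[OF _ max.cobounded1] up[OF _ max.cobounded2] elim!: list_all2_mono)
  next
    case (eval_PrimRec_Suc f g n xs y z)
    then obtain s t where "clocked (q s) s (PrimRec f g) (n # xs) = Suc y"
      "clocked (q t) t g (n # y # xs) = Suc z" by blast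
    then show ?case unfolding clocked_iffs
      by (intro exI[of _ "max s t"] exI[of _ y])
        (auto intro: up[OF _ max.cobounded1] up[OF _ max.cobounded2])
  next
    case (eval_Minim f n xs)
    then obtain s where s: "clocked (q s) s f (n # xs) = Suc 0" by blast
    have "\<exists>t. \<forall>m<k. \<exists>y. clocked (q t) t f (m # xs) = Suc (Suc y)" if "k \<le> n" for k
      using that
    proof (induction k)
      case (Suc k)
      then obtain t where t: "\<forall>m<k. \<exists>y. clocked (q t) t f (m # xs) = Suc (Suc y)" by auto
      obtain t' y where t': "clocked (q t') t' f (k # xs) = Suc (Suc y)"
        using eval_Minim.IH(2)[of k] Suc.prems by auto
      have "\<exists>y. clocked (q (max t t')) (max t t') f (m # xs) = Suc (Suc y)" if "m < Suc k" for m
      proof (cases "m = k")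
        case True
        then show ?thesis using up[OF t' max.cobounded2] by auto
      next
        case False
        then have "m < k" using that by simp
        then show ?thesis using t up[OF _ max.cobounded1] by blast
      qed
      then show ?case by blast
    qed simp
    then obtain t where t: "\<forall>m<n. \<exists>y. clocked (q t) t f (m # xs) = Suc (Suc y)" by blast
    let ?u = "max (max s t) (Suc n)"
    have "clocked (q ?u) ?u f (n # xs) = Suc 0" by (rule up[OF s]) auto
    moreover have "\<exists>y. clocked (q ?u) ?u f (m # xs) = Suc (Suc y)" if m: "m < n" for m
    proof -
      obtain y where "clocked (q t) t f (m # xs) = Suc (Suc y)" using t m by blast
      then have "clocked (q ?u) ?u f (m # xs) = Suc (Suc y)"
        by (rule up) auto
      then show ?thesis by blast
    qed
    ultimately show ?case unfolding clocked_iffs One_nat_def by (intro exI[of _ ?u]) auto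
  qed (auto simp: clocked_iffs)
qed

text \<open>
  Every fixed program has its own clocked version, built along its syntax.
\<close>

lemma computable_clocked_aux:
  assumes q: "computable \<beta>s (\<lambda>z. q (fst z) (snd z))" and s: "computable \<beta>s s"
  shows "computable \<beta>s (\<lambda>z. clocked (q (fst z)) (s (fst z)) f (snd z))"
proof (induction f)
  case Query
  then show ?case using q by simp
next
  case (Comp f gs)
  have 1: "computable \<beta>s (\<lambda>z. map (\<lambda>g. clocked (q (fst z)) (s (fst z)) g (snd z)) gs)"
    using Comp.IH(2) by (rule computable_fixed_map)
  show ?case unfolding clocked.simps
    by (intro computable_intros 1 computable_compose2[OF Comp.IH(1)])
next
  case (PrimRec f g)
  show ?case unfolding clocked.simps
    by (intro computable_intros computable_compose2[OF PrimRec.IH(1)]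
        computable_compose2[OF PrimRec.IH(2)])
next
  case (Minim f)
  show ?case unfolding clocked.simps
    by (intro computable_intros computable_compose2[OF Minim.IH] computable_compose[OF s])
next
  case (Proj i)
  have "computable \<beta>s (\<lambda>z::'a \<times> nat list. if i < length (map Suc (snd z)) then map Suc (snd z) ! i else 0)"
    by (intro computable_nth_default computable_intros)
  moreover have "(if i < length (map Suc xs) then map Suc xs ! i else 0) =
    (if i < length xs then Suc (xs ! i) else 0)" for xs by simp
  ultimately show ?case by simp
qed (unfold clocked.simps, (intro computable_intros)+)

lemma computable_clocked:
  assumes "computable \<beta>s (\<lambda>z. q (fst z) (snd z))" "computable \<beta>s S" "computable \<beta>s L"
  shows "computable \<beta>s (\<lambda>x. clocked (q x) (S x) f (L x))"
  using computable_compose[OF computable_clocked_aux[OF assms(1,2), of f]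
      computable_Pair[OF computable_id assms(3)]] by simp


section \<open>Semidecidable predicates\<close>

text \<open>
  Projections of computable predicates are easier to combine than domains of programs. For sets of
  numbers and without oracles, the two notions agree by \<open>semidecidable_halts\<close> and
  \<open>semidecidable_domain\<close>.
\<close>

definition semidecidable :: "nat stream list \<Rightarrow> ('a::coded \<Rightarrow> bool) \<Rightarrow> bool" where
  "semidecidable \<beta>s R \<longleftrightarrow>
    (\<exists>D. computable \<beta>s (\<lambda>z. D (fst z) (snd z)) \<and> (\<forall>x. R x \<longleftrightarrow> (\<exists>s::nat. D x s)))"

lemma semidecidableI:
  "computable \<beta>s (\<lambda>z. D (fst z) (snd z)) \<Longrightarrow> (\<And>x. R x \<longleftrightarrow> (\<exists>s::nat. D x s)) \<Longrightarrow> semidecidable \<beta>s R"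
  by (auto simp: semidecidable_def)

lemma semidecidable_computable:
  assumes "computable \<beta>s R" shows "semidecidable \<beta>s R"
  by (rule semidecidableI[where D = "\<lambda>x _. R x"])
    (intro computable_compose[OF assms] computable_intros, simp)

lemma semidecidable_compose:
  assumes "semidecidable \<beta>s R" "computable \<beta>s F" shows "semidecidable \<beta>s (\<lambda>x. R (F x))"
proof -
  obtain D where D: "computable \<beta>s (\<lambda>z. D (fst z) (snd z))" "\<And>x. R x \<longleftrightarrow> (\<exists>s::nat. D x s)"
    using assms(1) unfolding semidecidable_def by blast
  show ?thesis
    by (rule semidecidableI[where D = "\<lambda>x s. D (F x) s"])
      (intro computable_compose2[OF D(1)] computable_compose[OF assms(2)] computable_intros, simp add: D(2))
qed

lemma semidecidable_ex:
  assumes "semidecidable \<beta>s (\<lambda>z. R (fst z) (snd z))" shows "semidecidable \<beta>s (\<lambda>x. \<exists>n::nat. R x n)"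
proof -
  obtain D where D: "computable \<beta>s (\<lambda>z. D (fst z) (snd z))"
    "\<And>x n. R x n \<longleftrightarrow> (\<exists>s::nat. D (x, n) s)"
    using assms(1) unfolding semidecidable_def by auto
  have "(\<exists>n. R x n) \<longleftrightarrow> (\<exists>k. D (x, fst (prod_decode k)) (snd (prod_decode k)))" for x
    unfolding D(2) by (metis fst_conv snd_conv prod_encode_inverse)
  then show ?thesis
    by (intro semidecidableI[where D = "\<lambda>x k. D (x, fst (prod_decode k)) (snd (prod_decode k))"]
        computable_compose2[OF D(1)] computable_intros)
qed

lemma semidecidable_conj:
  assumes "semidecidable \<beta>s R" "semidecidable \<beta>s S" shows "semidecidable \<beta>s (\<lambda>x. R x \<and> S x)"
proof -
  obtain D where D: "computable \<beta>s (\<lambda>z. D (fst z) (snd z))" "\<And>x. R x \<longleftrightarrow> (\<exists>s::nat. D x s)"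
    using assms(1) unfolding semidecidable_def by blast
  obtain E where E: "computable \<beta>s (\<lambda>z. E (fst z) (snd z))" "\<And>x. S x \<longleftrightarrow> (\<exists>s::nat. E x s)"
    using assms(2) unfolding semidecidable_def by blast
  have "R x \<and> S x \<longleftrightarrow> (\<exists>k. D x (fst (prod_decode k)) \<and> E x (snd (prod_decode k)))" for x
    unfolding D(2) E(2) by (metis fst_conv snd_conv prod_encode_inverse)
  then show ?thesis
    by (intro semidecidableI[where D = "\<lambda>x k. D x (fst (prod_decode k)) \<and> E x (snd (prod_decode k))"]
        computable_compose2[OF D(1)] computable_compose2[OF E(1)] computable_intros)
qed

lemma semidecidable_halts:
  assumes "semidecidable \<beta>s R"
  shows "\<exists>f. \<forall>x. halts \<beta>s f [code x] \<longleftrightarrow> R x"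
proof -
  obtain D where D: "computable \<beta>s (\<lambda>z. D (fst z) (snd z))" "\<And>x. R x \<longleftrightarrow> (\<exists>s::nat. D x s)"
    using assms(1) unfolding semidecidable_def by blast
  have "computable \<beta>s (\<lambda>z. \<not> D (fst z) (snd z))" using D(1) by (rule computable_not)
  then obtain p where p: "\<And>z. eval \<beta>s p [code z] (of_bool (\<not> D (fst z) (snd z)))"
    unfolding computable_def code_bool_def by blast
  let ?p = "Comp p [Comp pairP [Proj 1, Proj 0]]"
  have p': "eval \<beta>s ?p [n, code x] (of_bool (\<not> D x n))" for n x
    using p[of "(x, n)"]
    by (auto simp: code_Pair code_nat_def intro!: eval_Comps eval_Proj' eval_pairP)
  have "halts \<beta>s (Minim ?p) [code x] \<longleftrightarrow> R x" for x
  proof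
    assume "halts \<beta>s (Minim ?p) [code x]"
    then obtain n where "eval \<beta>s (Minim ?p) [code x] n" by (auto simp: halts_def)
    then have "eval \<beta>s ?p [n, code x] 0" by (auto elim: eval_cases(8))
    with p'[of n x] have "(0::nat) = of_bool (\<not> D x n)" by (rule eval_deterministic[rotated])
    then show "R x" using D(2) by (auto split: if_splits)
  next
    assume "R x"
    then obtain s where "D x s" using D(2) by blast
    have "eval \<beta>s (Minim ?p) [code x] (LEAST s. D x s)"
    proof (rule eval_Minim)
      show "eval \<beta>s ?p [LEAST s. D x s, code x] 0"
        using p'[of "LEAST s. D x s" x] LeastI[of "D x", OF \<open>D x s\<close>] by simp
      fix m assume "m < (LEAST s. D x s)"
      then have "\<not> D x m" by (rule not_less_Least)
      then show "\<exists>y. eval \<beta>s ?p [m, code x] (Suc y)" using p'[of m x] by auto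
    qed
    then show "halts \<beta>s (Minim ?p) [code x]" by (auto simp: halts_def)
  qed
  then show ?thesis by blast
qed

text \<open>
  Clocked evaluation turns a partial recursive function into a total one that is
  computable relative to any oracles.
\<close>

lemma clocked_no_oracle:
  obtains F :: "nat list \<Rightarrow> nat \<Rightarrow> nat" where
    "\<And>\<beta>s. computable \<beta>s (\<lambda>z. F (fst z) (snd z))"
    "\<And>xs y. eval [] f xs y \<longleftrightarrow> (\<exists>s. F xs s = Suc y)"
    "\<And>xs s t y. F xs s = Suc y \<Longrightarrow> s \<le> t \<Longrightarrow> F xs t = Suc y"
proof
  let ?F = "\<lambda>xs s. clocked (\<lambda>_. 0) s f xs"
  show "computable \<beta>s (\<lambda>z. ?F (fst z) (snd z))" for \<beta>s
    by (intro computable_clocked computable_intros)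
  show "?F xs s = Suc y \<Longrightarrow> s \<le> t \<Longrightarrow> ?F xs t = Suc y" for xs s t y
    by (rule clocked_mono[of "\<lambda>_. 0"]) auto
  have "\<not> eval [] Query xs y" for xs y by (auto elim: eval_cases)
  then show "eval [] f xs y \<longleftrightarrow> (\<exists>s. ?F xs s = Suc y)" for xs y
    using clocked_sound[of "\<lambda>_. 0" "[]" _ f xs y] clocked_complete[of "\<lambda>_ _. 0" "[]" f xs y]
    by auto
qed

lemma semidecidable_domain:
  assumes "recursively_enumerable A" shows "semidecidable \<beta>s (\<lambda>x. x \<in> A)"
proof -
  obtain f where f: "A = {x. halts [] f [x]}" using assms by (auto simp: recursively_enumerable_def)
  obtain F :: "nat list \<Rightarrow> nat \<Rightarrow> nat" where F: "\<And>\<beta>s. computable \<beta>s (\<lambda>z. F (fst z) (snd z))"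
    "\<And>xs y. eval [] f xs y \<longleftrightarrow> (\<exists>s. F xs s = Suc y)"
    "\<And>xs s t y. F xs s = Suc y \<Longrightarrow> s \<le> t \<Longrightarrow> F xs t = Suc y"
    by (rule clocked_no_oracle[of f]) (rule that)
  have nz: "k \<noteq> 0 \<longleftrightarrow> (\<exists>y. k = Suc y)" for k :: nat by (cases k) auto
  have "x \<in> A \<longleftrightarrow> (\<exists>s. F [x] s \<noteq> 0)" for x
    unfolding f halts_def F(2) mem_Collect_eq nz by blast
  then show ?thesis
    by (rule semidecidableI[rotated]) (intro computable_intros computable_compose2[OF F(1)])
qed

lemma partial_recursive_clocked:
  assumes "partial_recursive_on A X"
  obtains F :: "nat \<Rightarrow> nat \<Rightarrow> nat" where
    "\<And>\<beta>s. computable \<beta>s (\<lambda>z. F (fst z) (snd z))"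
    "\<And>a s. F a s = 0 \<or> F a s = Suc (X a) \<and> a \<in> A"
    "\<And>a s t. F a s \<noteq> 0 \<Longrightarrow> s \<le> t \<Longrightarrow> F a t \<noteq> 0"
    "\<And>a. a \<in> A \<Longrightarrow> \<exists>s. F a s \<noteq> 0"
proof -
  obtain f where f: "\<And>a y. eval [] f [a] y \<longleftrightarrow> a \<in> A \<and> y = X a"
    using assms by (auto simp: partial_recursive_on_def)
  obtain F :: "nat list \<Rightarrow> nat \<Rightarrow> nat" where F: "\<And>\<beta>s. computable \<beta>s (\<lambda>z. F (fst z) (snd z))"
    "\<And>xs y. eval [] f xs y \<longleftrightarrow> (\<exists>s. F xs s = Suc y)"
    "\<And>xs s t y. F xs s = Suc y \<Longrightarrow> s \<le> t \<Longrightarrow> F xs t = Suc y"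
    by (rule clocked_no_oracle[of f]) (rule that)
  have nz: "k \<noteq> 0 \<longleftrightarrow> (\<exists>y. k = Suc y)" for k :: nat by (cases k) auto
  show ?thesis
  proof (rule that[of "\<lambda>a s. F [a] s"])
    show "computable \<beta>s (\<lambda>z. F [fst z] (snd z))" for \<beta>s
      by (intro computable_intros computable_compose2[OF F(1)])
    show "F [a] s = 0 \<or> F [a] s = Suc (X a) \<and> a \<in> A" for a s
      using f F(2) by (cases "F [a] s") auto
    show "F [a] s \<noteq> 0 \<Longrightarrow> s \<le> t \<Longrightarrow> F [a] t \<noteq> 0" for a s t
      unfolding nz using F(3) by blast
    show "\<exists>s. F [a] s \<noteq> 0" if "a \<in> A" for a
      unfolding nz using f[of a "X a"] that F(2)[of "[a]" "X a"] by blast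
  qed
qed

text \<open>
  That \<open>A\<close> is recursively enumerable matters for the empty list, where a constant function must have
  the domain \<open>A\<close>.
\<close>

lemma partial_recursive_list_encode:
  assumes "\<And>i. i \<in> set is \<Longrightarrow> partial_recursive_on A (X i)" "recursively_enumerable A"
  shows "partial_recursive_on A (\<lambda>a. list_encode (map (\<lambda>i. X i a) is))"
  using assms(1)
proof (induction "is")
  case Nil
  obtain f where f: "A = {x. halts [] f [x]}"
    using assms(2) by (auto simp: recursively_enumerable_def)
  have "eval [] (Comp Zero [f]) [a] y \<longleftrightarrow> a \<in> A \<and> y = 0" for a y
  proof
    assume "a \<in> A \<and> y = 0"
    then show "eval [] (Comp Zero [f]) [a] y"
      unfolding f halts_def by (blast intro: eval_Comp1 eval_Zero)
  next
    assume "eval [] (Comp Zero [f]) [a] y"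
    then obtain ys where "list_all2 (\<lambda>g y. eval [] g [a] y) [f] ys" "eval [] Zero ys y"
      by (rule eval_cases(5))
    then show "a \<in> A \<and> y = 0"
      unfolding f halts_def by (auto simp: list_all2_Cons1 elim: eval_cases(1))
  qed
  then show ?case
    unfolding partial_recursive_on_def by (intro exI[of _ "Comp Zero [f]"]) simp
next
  case (Cons i "is")
  have "partial_recursive_on A (X i)" by (rule Cons.prems) simp
  then obtain f where f: "\<And>a y. eval [] f [a] y \<longleftrightarrow> a \<in> A \<and> y = X i a"
    unfolding partial_recursive_on_def by blast
  have "partial_recursive_on A (\<lambda>a. list_encode (map (\<lambda>i. X i a) is))"
    by (rule Cons.IH, rule Cons.prems) simp
  then obtain g where g: "\<And>a y. eval [] g [a] y \<longleftrightarrow>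
      a \<in> A \<and> y = list_encode (map (\<lambda>i. X i a) is)"
    unfolding partial_recursive_on_def by blast
  note fg = f g
  have val: "eval [] (Comp Succ [Comp pairP [f, g]]) [a] (list_encode (map (\<lambda>i. X i a) (i # is)))"
    if "a \<in> A" for a
  proof -
    have "eval [] (Comp pairP [f, g]) [a] (prod_encode (X i a, list_encode (map (\<lambda>i. X i a) is)))"
      by (rule eval_Comp2[OF _ _ eval_pairP]) (simp_all add: fg that)
    then show ?thesis by (simp add: eval_Comp1[OF _ eval_Succ])
  qed
  have "eval [] (Comp Succ [Comp pairP [f, g]]) [a] y \<longleftrightarrow>
      a \<in> A \<and> y = list_encode (map (\<lambda>i. X i a) (i # is))" (is "?L \<longleftrightarrow> ?R") for a y
  proof
    assume ?R
    then show ?L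
      using val by blast
  next
    assume L: ?L
    then obtain ys where "list_all2 (\<lambda>g y. eval [] g [a] y) [Comp pairP [f, g]] ys"
      by (rule eval_cases(5))
    then obtain y' where "eval [] (Comp pairP [f, g]) [a] y'" by (auto simp: list_all2_Cons1)
    then obtain ys' where "list_all2 (\<lambda>g y. eval [] g [a] y) [f, g] ys'"
      by (rule eval_cases(5))
    then have a: "a \<in> A" by (auto simp: list_all2_Cons1 fg)
    have "eval [] (Comp Succ [Comp pairP [f, g]]) [a] (list_encode (map (\<lambda>i. X i a) (i # is)))"
      using a by (rule val)
    with L a show ?R using eval_deterministic by blast
  qed
  then show ?case
    unfolding partial_recursive_on_def by (intro exI[of _ "Comp Succ [Comp pairP [f, g]]"]) blast
qed


section \<open>Bernoulli measures and finite samples\<close>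

lemma sets_bernoulli: "sets (bernoulli P) = sets (stream_space (count_space UNIV))"
  unfolding bernoulli_def by (intro sets_stream_space_cong) simp

lemma space_bernoulli [simp]: "space (bernoulli P) = UNIV"
  by (simp add: bernoulli_def space_stream_space)

lemma prob_space_bernoulli: "prob_space (bernoulli P)"
  unfolding bernoulli_def by (rule prob_space.prob_space_stream_space[OF prob_space_measure_pmf])

lemma stake_event [measurable]: "{\<alpha>. stake k \<alpha> \<in> A} \<in> sets (bernoulli P)"
proof -
  have "stake k -` A \<inter> space (stream_space (count_space (UNIV :: nat set)))
      \<in> sets (stream_space (count_space UNIV))"
    by (rule measurable_sets[OF measurable_stake]) simp
  then show ?thesis by (simp add: sets_bernoulli vimage_def space_stream_space)
qed

lemma streams_event [measurable]: "streams \<Omega> \<in> sets (bernoulli (P :: nat pmf))"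
  using sstart_sets[of \<Omega> "[]"] by (simp add: sets_bernoulli)

lemma cyl_eq: "cyl \<Omega> S = streams \<Omega> \<inter> (\<Union>k. {\<alpha>. stake k \<alpha> \<in> S})"
  by (auto simp: cyl_def)

lemma cyl_event [measurable]: "cyl \<Omega> S \<in> sets (bernoulli P)"
  unfolding cyl_eq by measurable

text \<open>
  Events that depend on the first \<open>k\<close> symbols are events in a discrete space of lists, in which
  independence and moments are elementary.
\<close>

lemma measure_bernoulli_stake:
  "measure (bernoulli P) {\<alpha>. stake k \<alpha> \<in> A} = measure_pmf.prob (replicate_pmf k P) A"
proof -
  interpret prob_space "bernoulli P" by (rule prob_space_bernoulli)
  have "emeasure (bernoulli P) {\<alpha>. stake k \<alpha> \<in> A} = emeasure (replicate_pmf k P) A"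
  proof (induction k arbitrary: A)
    case 0
    then show ?case using emeasure_space_1 by (auto simp: indicator_def)
  next
    case (Suc k)
    have "emeasure (bernoulli P) {\<alpha>. stake (Suc k) \<alpha> \<in> A} =
      (\<integral>\<^sup>+t. emeasure (bernoulli P) {\<alpha>. stake k \<alpha> \<in> {\<tau>. t # \<tau> \<in> A}} \<partial>measure_pmf P)"
      using prob_space.emeasure_stream_space[OF prob_space_measure_pmf, of
          "{\<alpha>. stake (Suc k) \<alpha> \<in> A}" P] stake_event[of "Suc k" A P]
      by (simp add: bernoulli_def space_stream_space)
    also have "\<dots> = (\<integral>\<^sup>+t. emeasure (replicate_pmf k P) {\<tau>. t # \<tau> \<in> A} \<partial>measure_pmf P)"
      by (simp only: Suc)
    also have "\<dots> = emeasure (replicate_pmf (Suc k) P) A"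
      by (simp add: emeasure_bind_pmf map_pmf_def[symmetric] vimage_def)
    finally show ?case .
  qed
  then show ?thesis by (simp add: measure_def)
qed

lemma measure_cyl_le:
  assumes "\<And>k. measure_pmf.prob (replicate_pmf k P) {\<tau>. \<exists>l\<le>k. take l \<tau> \<in> S} \<le> c"
  shows "measure (bernoulli P) (cyl \<Omega> S) \<le> c"
proof -
  interpret prob_space "bernoulli P" by (rule prob_space_bernoulli)
  let ?A = "\<lambda>k. {\<alpha>. stake k \<alpha> \<in> {\<tau>. \<exists>l\<le>k. take l \<tau> \<in> S}}"
  have A: "?A k = {\<alpha>. \<exists>l\<le>k. stake l \<alpha> \<in> S}" for k
    by (auto simp: take_stake min_def)
  have "(\<lambda>k. measure (bernoulli P) (?A k)) \<longlonglongrightarrow> measure (bernoulli P) (\<Union>k. ?A k)"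
  proof (rule finite_Lim_measure_incseq)
    show "range ?A \<subseteq> sets (bernoulli P)" by (intro image_subsetI stake_event)
    show "incseq ?A" unfolding A incseq_def by (auto intro: order_trans)
  qed
  then have "measure (bernoulli P) (\<Union>k. ?A k) \<le> c"
    by (rule LIMSEQ_le_const2) (use assms in \<open>simp only: measure_bernoulli_stake, blast\<close>)
  moreover have "measure (bernoulli P) (cyl \<Omega> S) \<le> measure (bernoulli P) (\<Union>k. ?A k)"
    
  proof (rule finite_measure_mono)
    show "cyl \<Omega> S \<subseteq> (\<Union>k. ?A k)" unfolding A by (auto simp: cyl_def)
    show "(\<Union>k. ?A k) \<in> sets (bernoulli P)" by (intro sets.countable_UN image_subsetI stake_event)
  qed
  ultimately show ?thesis by simp
qed

lemma prob_replicate_prefix: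
  "measure_pmf.prob (replicate_pmf k P) {\<tau>. prefix \<sigma> \<tau>} \<le> prod_list (map (pmf P) \<sigma>)"
proof (induction \<sigma> arbitrary: k)
  case Nil
  then show ?case by simp
next
  case (Cons a \<sigma>)
  show ?case
  proof (cases k)
    case 0
    have "0 \<le> prod_list (map (pmf P) (a # \<sigma>))" by (rule prod_list_nonneg) auto
    then show ?thesis using 0 by (simp add: indicator_def)
  next
    case (Suc j)
    have "emeasure (replicate_pmf k P) {\<tau>. prefix (a # \<sigma>) \<tau>} =
      (\<integral>\<^sup>+t. emeasure (replicate_pmf j P) {\<tau>. t = a \<and> prefix \<sigma> \<tau>} \<partial>measure_pmf P)"
      by (simp add: Suc emeasure_bind_pmf map_pmf_def[symmetric] vimage_def eq_commute[of a])
    also have "\<dots> = (\<integral>\<^sup>+t. emeasure (replicate_pmf j P) {\<tau>. prefix \<sigma> \<tau>} * indicator {a} t \<partial>measure_pmf P)"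
      by (intro nn_integral_cong) (auto split: split_indicator)
    also have "\<dots> = emeasure (replicate_pmf j P) {\<tau>. prefix \<sigma> \<tau>} * ennreal (pmf P a)"
      by (simp add: nn_integral_cmult_indicator emeasure_pmf_single)
    finally have "measure_pmf.prob (replicate_pmf k P) {\<tau>. prefix (a # \<sigma>) \<tau>} =
        measure_pmf.prob (replicate_pmf j P) {\<tau>. prefix \<sigma> \<tau>} * pmf P a"
      by (simp add: measure_def enn2real_mult)
    also have "\<dots> \<le> prod_list (map (pmf P) \<sigma>) * pmf P a"
      by (intro mult_right_mono Cons) auto
    finally show ?thesis by (simp add: mult.commute)
  qed
qed

text \<open>
  The cylinders of the strings in a prefix-free set are disjoint.
\<close>

lemma sum_weights_prefix_free:
  assumes "set_pmf P \<subseteq> \<Omega>" "finite F" "F \<subseteq> S" "S \<subseteq> lists \<Omega>" "prefix_free S"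
  shows "(\<Sum>\<sigma>\<in>F. prod_list (map (pmf P) \<sigma>)) \<le> measure (bernoulli P) (cyl \<Omega> S)"
proof -
  interpret prob_space "bernoulli P" by (rule prob_space_bernoulli)
  have "disjoint_family_on (\<lambda>\<sigma>. cyl \<Omega> {\<sigma>}) F"
    unfolding disjoint_family_on_def
  proof (intro ballI impI)
    fix \<sigma> \<tau> assume st: "\<sigma> \<in> F" "\<tau> \<in> F" "\<sigma> \<noteq> \<tau>"
    have "False" if \<alpha>: "\<alpha> \<in> cyl \<Omega> {\<sigma>}" "\<alpha> \<in> cyl \<Omega> {\<tau>}" for \<alpha>
    proof -
      obtain k l where kl: "stake k \<alpha> = \<sigma>" "stake l \<alpha> = \<tau>" using \<alpha> by (auto simp: cyl_def)
      have "prefix (stake i \<alpha>) (stake j \<alpha>)" if "i \<le> j" for i j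
        using that take_is_prefix[of i "stake j \<alpha>"] by (simp add: take_stake min_def)
      then have "prefix \<sigma> \<tau> \<or> prefix \<tau> \<sigma>" using kl linorder_le_cases by metis
      then show False using st assms(3,5) unfolding prefix_free_def by blast
    qed
    then show "cyl \<Omega> {\<sigma>} \<inter> cyl \<Omega> {\<tau>} = {}" by blast
  qed
  then have "measure (bernoulli P) (\<Union>\<sigma>\<in>F. cyl \<Omega> {\<sigma>}) = (\<Sum>\<sigma>\<in>F. measure (bernoulli P) (cyl \<Omega> {\<sigma>}))"
    using assms(2) by (intro finite_measure_finite_Union) auto
  also have "\<dots> = (\<Sum>\<sigma>\<in>F. prod_list (map (pmf P) \<sigma>))"
    using assms by (intro sum.cong measure_bernoulli_cyl) auto
  finally have "(\<Sum>\<sigma>\<in>F. prod_list (map (pmf P) \<sigma>)) = measure (bernoulli P) (\<Union>\<sigma>\<in>F. cyl \<Omega> {\<sigma>})"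
    by simp
  also have "\<dots> \<le> measure (bernoulli P) (cyl \<Omega> S)"
  proof (rule finite_measure_mono[OF _ cyl_event])
    show "(\<Union>\<sigma>\<in>F. cyl \<Omega> {\<sigma>}) \<subseteq> cyl \<Omega> S" using assms(3) by (auto simp: cyl_def)
  qed
  finally show ?thesis .
qed


section \<open>Randomness\<close>

lemma common_clock:
  assumes "\<And>a s t. Q a s \<Longrightarrow> s \<le> t \<Longrightarrow> Q a (t::nat)"
  shows "(\<forall>a\<in>set xs. \<exists>s. Q a s) \<longleftrightarrow> (\<exists>s. \<forall>a\<in>set xs. Q a s)"
proof
  show "\<forall>a\<in>set xs. \<exists>s. Q a s \<Longrightarrow> \<exists>s. \<forall>a\<in>set xs. Q a s"
  proof (induction xs)
    case (Cons x xs)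
    then obtain s t where st: "\<forall>a\<in>set xs. Q a s" "Q x t" by auto
    have "Q a (max s t)" if "a \<in> set (x # xs)" for a
    proof (cases "a = x")
      case True
      then show ?thesis using assms[OF st(2) max.cobounded2] by simp
    next
      case False
      then have "Q a s" using st(1) that by simp
      then show ?thesis by (rule assms[OF _ max.cobounded1])
    qed
    then show ?case by blast
  qed simp
qed blast

lemma semidecidable_lists:
  assumes "recursively_enumerable A" shows "semidecidable \<beta>s (\<lambda>xs. xs \<in> lists A)"
proof -
  have "partial_recursive_on A (\<lambda>a. list_encode (map (\<lambda>i. (\<lambda>_ _. 0) i a) ([] :: nat list)))"
    by (rule partial_recursive_list_encode[OF _ assms]) simp
  then obtain F :: "nat \<Rightarrow> nat \<Rightarrow> nat" where F: "\<And>\<beta>s. computable \<beta>s (\<lambda>z. F (fst z) (snd z))"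
    "\<And>a s. F a s = 0 \<or> F a s = Suc (list_encode (map (\<lambda>i. (\<lambda>_ _. 0) i a) ([] :: nat list))) \<and> a \<in> A"
    "\<And>a s t. F a s \<noteq> 0 \<Longrightarrow> s \<le> t \<Longrightarrow> F a t \<noteq> 0"
    "\<And>a. a \<in> A \<Longrightarrow> \<exists>s. F a s \<noteq> 0"
    by (rule partial_recursive_clocked) (rule that)
  have "a \<in> A \<longleftrightarrow> (\<exists>s. F a s \<noteq> 0)" for a using F(2)[of a] F(4)[of a] by metis
  then have "xs \<in> lists A \<longleftrightarrow> (\<exists>s. \<forall>a\<in>set xs. F a s \<noteq> 0)" for xs
    using common_clock[of "\<lambda>a s. F a s \<noteq> 0" xs, OF F(3)] by (simp add: in_lists_conv_set)
  then show ?thesis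
    by (rule semidecidableI[rotated]) (intro computable_intros computable_compose2[OF F(1)])
qed

text \<open>
  Prefix-freeness of tests is inessential: the property of \<open>\<tau>\<close> that a search of length \<open>|\<tau>|\<close> finds a
  prefix of \<open>\<tau>\<close> in \<open>R n\<close> is decidable and closed under extensions, so its minimal
  strings form a prefix-free set, and this set generates the same open set as \<open>R n\<close>.
\<close>

lemma ml_random_rel_avoids:
  fixes R :: "nat \<Rightarrow> nat list \<Rightarrow> bool"
  assumes random: "ml_random_rel \<Omega> P \<beta>s \<alpha>"
    and R: "semidecidable \<beta>s (\<lambda>z. R (fst z) (snd z))"
    and small: "\<And>n. n \<ge> 1 \<Longrightarrow> measure (bernoulli P) (cyl \<Omega> {\<sigma>. R n \<sigma>}) < (1/2) ^ n"
  obtains n where "n \<ge> 1" "\<And>k. \<not> R n (stake k \<alpha>)"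
proof -
  interpret prob_space "bernoulli P" by (rule prob_space_bernoulli)
  obtain D :: "nat \<times> nat list \<Rightarrow> nat \<Rightarrow> bool" where
    D: "computable \<beta>s (\<lambda>z. D (fst z) (snd z))" "\<And>x. R (fst x) (snd x) \<longleftrightarrow> (\<exists>s. D x s)"
    using R unfolding semidecidable_def by blast
  define E where "E n \<tau> \<longleftrightarrow>
    (\<exists>l\<in>set [0..<Suc (length \<tau>)]. \<exists>s\<in>set [0..<Suc (length \<tau>)]. D (n, take l \<tau>) s)" for n \<tau>
  define M where "M n \<tau> \<longleftrightarrow> E n \<tau> \<and> (\<tau> = [] \<or> \<not> E n (butlast \<tau>))" for n \<tau>
  define C where "C = {(n, \<sigma>) \<in> {1..} \<times> lists \<Omega>. M n \<sigma>}"
  have E_iff: "E n \<tau> \<longleftrightarrow> (\<exists>l\<le>length \<tau>. \<exists>s\<le>length \<tau>. D (n, take l \<tau>) s)" for n \<tau>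
    unfolding E_def by (simp only: set_upt atLeast0LessThan lessThan_Suc_atMost) auto
  have E_mono: "E n \<tau>'" if E: "E n \<tau>" and pre: "prefix \<tau> \<tau>'" for n \<tau> \<tau>'
  proof -
    obtain l s where ls: "l \<le> length \<tau>" "s \<le> length \<tau>" "D (n, take l \<tau>) s"
      using E unfolding E_iff by blast
    have "take l \<tau>' = take l \<tau>" using ls(1) pre by (auto elim: prefixE)
    then have "D (n, take l \<tau>') s" using ls(3) by simp
    moreover have "l \<le> length \<tau>'" "s \<le> length \<tau>'"
      using prefix_length_le[OF pre] ls by simp_all
    ultimately show ?thesis unfolding E_iff by blast
  qed
  have E_comp: "computable \<beta>s (\<lambda>z. E (fst z) (snd z))"
    unfolding E_def by (intro computable_intros computable_compose2[OF D(1)])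
  have "computable \<beta>s (\<lambda>z. M (fst z) (snd z))"
    unfolding M_def by (intro computable_intros computable_compose2[OF E_comp])
  from semidecidable_halts[OF semidecidable_computable[OF this]]
  obtain f where f: "\<And>n \<sigma>. halts \<beta>s f [prod_encode (n, list_encode \<sigma>)] \<longleftrightarrow> M n \<sigma>"
    by (auto simp: code_Pair code_nat_def code_nat_list)
  have "prefix_free (C `` {n})" for n
    unfolding prefix_free_def
  proof (intro ballI impI)
    fix \<sigma> \<tau> assume st: "\<sigma> \<in> C `` {n}" "\<tau> \<in> C `` {n}" "prefix \<sigma> \<tau>"
    show "\<sigma> = \<tau>"
    proof (rule ccontr)
      assume "\<sigma> \<noteq> \<tau>"
      with st(3) obtain \<rho> where "\<tau> = \<sigma> @ \<rho>" "\<rho> \<noteq> []" by (auto elim: prefixE)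
      then have "\<tau> \<noteq> []" "prefix \<sigma> (butlast \<tau>)" by (auto simp: butlast_append)
      moreover have "E n \<sigma>" using st(1) by (auto simp: C_def M_def)
      ultimately have "E n (butlast \<tau>)" "\<tau> \<noteq> []" using E_mono by blast+
      then show False using st(2) by (auto simp: C_def M_def)
    qed
  qed
  moreover have "measure (bernoulli P) (cyl \<Omega> (C `` {n})) < (1/2) ^ n" if "n \<ge> 1" for n
  proof -
    have "cyl \<Omega> (C `` {n}) \<subseteq> cyl \<Omega> {\<sigma>. R n \<sigma>}"
    proof
      fix \<gamma> assume "\<gamma> \<in> cyl \<Omega> (C `` {n})"
      then obtain k where k: "\<gamma> \<in> streams \<Omega>" "E n (stake k \<gamma>)" by (auto simp: cyl_def C_def M_def)
      then obtain l s where "l \<le> k" "D (n, take l (stake k \<gamma>)) s" by (auto simp: E_iff)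
      then have "R n (stake l \<gamma>)" using D(2)[of "(n, stake l \<gamma>)"] by (auto simp: take_stake min_def)
      with k(1) show "\<gamma> \<in> cyl \<Omega> {\<sigma>. R n \<sigma>}" by (auto simp: cyl_def)
    qed
    then have "measure (bernoulli P) (cyl \<Omega> (C `` {n})) \<le> measure (bernoulli P) (cyl \<Omega> {\<sigma>. R n \<sigma>})"
      by (rule finite_measure_mono) (rule cyl_event)
    with small[OF that] show ?thesis by simp
  qed
  ultimately have "small_sections \<Omega> P C" unfolding small_sections_def by blast
  moreover have "C = {(n, \<sigma>) \<in> {1..} \<times> lists \<Omega>. halts \<beta>s f [prod_encode (n, list_encode \<sigma>)]}"
    unfolding C_def f ..
  ultimately have "ml_test_rel \<Omega> P \<beta>s C" unfolding ml_test_rel_def by blast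
  then obtain n where n: "n \<ge> 1" "\<alpha> \<notin> cyl \<Omega> (C `` {n})"
    using random by (auto simp: ml_random_rel_def)
  have \<alpha>: "\<alpha> \<in> streams \<Omega>" using random by (simp add: ml_random_rel_def)
  have "\<not> R n (stake k \<alpha>)" for k
  proof
    assume "R n (stake k \<alpha>)"
    then obtain s where s: "D (n, stake k \<alpha>) s" using D(2)[of "(n, stake k \<alpha>)"] by auto
    have "E n (stake (max k s) \<alpha>)"
      unfolding E_iff using s
      by (intro exI[of _ k] exI[of _ s] conjI) (auto simp: take_stake min_def)
    then have E: "E n (stake (LEAST m. E n (stake m \<alpha>)) \<alpha>)" by (rule LeastI)
    let ?m = "LEAST m. E n (stake m \<alpha>)"
    have "M n (stake ?m \<alpha>)"
    proof (cases ?m)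
      case 0
      then show ?thesis using E by (simp add: M_def)
    next
      case (Suc j)
      then have "\<not> E n (stake j \<alpha>)" by (intro not_less_Least) simp
      moreover have "butlast (stake (Suc j) \<alpha>) = stake j \<alpha>" by (simp add: stake_Suc del: stake.simps)
      ultimately show ?thesis using E Suc by (simp add: M_def del: stake.simps)
    qed
    moreover have "stake ?m \<alpha> \<in> lists \<Omega>"
      using \<alpha> by (auto simp: in_lists_conv_set in_set_conv_nth streams_iff_snth)
    ultimately have "\<alpha> \<in> cyl \<Omega> (C `` {n})" using n(1) \<alpha> by (auto simp: cyl_def C_def)
    with n(2) show False by simp
  qed
  with n(1) show thesis by (rule that)
qed

text \<open>
  A relativized test is cut down to strings over \<open>\<Omega>\<close> after the fact, whereas a test
  must be recursively enumerable as a whole. For a recursively enumerable \<open>\<Omega>\<close> there is no difference.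
\<close>

lemma ensemble_ml_random_rel:
  assumes "ensemble \<Omega> P \<alpha>" "recursively_enumerable \<Omega>"
  shows "ml_random_rel \<Omega> P [] \<alpha>"
proof -
  have "\<exists>n\<ge>1. \<alpha> \<notin> cyl \<Omega> (C `` {n})" if "ml_test_rel \<Omega> P [] C" for C
  proof -
    from that obtain f where f: "C = {(n, \<sigma>) \<in> {1..} \<times> lists \<Omega>. halts [] f [prod_encode (n, list_encode \<sigma>)]}"
      and small: "small_sections \<Omega> P C"
      unfolding ml_test_rel_def by blast
    have "recursively_enumerable {x. halts [] f [x]}" by (auto simp: recursively_enumerable_def)
    then have "semidecidable [] (\<lambda>x. x \<in> {x. halts [] f [x]})" by (rule semidecidable_domain)
    then have s3: "semidecidable [] (\<lambda>z :: nat \<times> nat list. code z \<in> {x. halts [] f [x]})"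
      by (rule semidecidable_compose) (intro computable_intros)
    have s1: "semidecidable [] (\<lambda>z :: nat \<times> nat list. 1 \<le> fst z)"
      by (rule semidecidable_computable) (intro computable_intros)
    have s2: "semidecidable [] (\<lambda>z :: nat \<times> nat list. snd z \<in> lists \<Omega>)"
      by (rule semidecidable_compose[OF semidecidable_lists[OF assms(2)]]) (intro computable_intros)
    from semidecidable_halts[OF semidecidable_conj[OF s1 semidecidable_conj[OF s2 s3]]]
    obtain g where "\<forall>z :: nat \<times> nat list. halts [] g [code z] \<longleftrightarrow>
        1 \<le> fst z \<and> snd z \<in> lists \<Omega> \<and> code z \<in> {x. halts [] f [x]}"
      by blast
    then have g: "halts [] g [prod_encode (n, list_encode \<sigma>)] \<longleftrightarrow> (n, \<sigma>) \<in> C" for n \<sigma>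
      by (simp add: f code_Pair code_nat_def code_nat_list)
    have "(\<lambda>(n, \<sigma>). prod_encode (n, list_encode \<sigma>)) ` C = {x. halts [] g [x]}"
    proof (intro set_eqI iffI)
      fix x assume x: "x \<in> {x. halts [] g [x]}"
      have "x = prod_encode (fst (prod_decode x), list_encode (list_decode (snd (prod_decode x))))"
        by simp
      with x show "x \<in> (\<lambda>(n, \<sigma>). prod_encode (n, list_encode \<sigma>)) ` C"
        using g[of "fst (prod_decode x)" "list_decode (snd (prod_decode x))"]
        by (intro image_eqI[where x = "(fst (prod_decode x), list_decode (snd (prod_decode x)))"]) auto
    qed (auto simp: g)
    then have "ml_test \<Omega> P C"
      unfolding ml_test_def recursively_enumerable_def using small by (auto simp: f)
    then show ?thesis using assms(1) by (auto simp: ensemble_def)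
  qed
  then show ?thesis using assms(1) by (auto simp: ml_random_rel_def ensemble_def)
qed

instance prog :: countable by countable_datatype

text \<open>
  Each test catches a null set, and there are only countably many tests because there are only
  countably many programs.
\<close>

lemma ensemble_exists:
  assumes "set_pmf P \<subseteq> \<Omega>" shows "\<exists>\<alpha>. ensemble \<Omega> P \<alpha>"
proof -
  interpret prob_space "bernoulli P" by (rule prob_space_bernoulli)
  let ?enc = "\<lambda>(n, \<sigma>). prod_encode (n, list_encode \<sigma>)"
  have inj: "inj ?enc" by (auto simp: inj_def list_encode_eq)
  have "{C. ml_test \<Omega> P C} \<subseteq> range (\<lambda>f. ?enc -` {x. halts [] f [x]})"
  proof
    fix C assume "C \<in> {C. ml_test \<Omega> P C}"
    then obtain f where f: "?enc ` C = {x. halts [] f [x]}"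
      by (auto simp: ml_test_def recursively_enumerable_def)
    have "C = ?enc -` (?enc ` C)" using inj by (simp add: inj_vimage_image_eq)
    then show "C \<in> range (\<lambda>f. ?enc -` {x. halts [] f [x]})" unfolding f by blast
  qed
  then have count: "countable {C. ml_test \<Omega> P C}" by (rule countable_subset) simp
  let ?N = "\<lambda>C. (\<Inter>n\<in>{1..}. cyl \<Omega> (C `` {n}))"
  have "?N C \<in> null_sets (bernoulli P)" if "ml_test \<Omega> P C" for C
  proof -
    have meas: "?N C \<in> sets (bernoulli P)" by (intro sets.countable_INT') auto
    have "measure (bernoulli P) (?N C) \<le> (1/2) ^ n" if "n \<ge> 1" for n
    proof -
      have "measure (bernoulli P) (?N C) \<le> measure (bernoulli P) (cyl \<Omega> (C `` {n}))"
        using that by (intro finite_measure_mono) auto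
      also have "\<dots> \<le> (1/2) ^ n"
        using \<open>ml_test \<Omega> P C\<close> that by (auto simp: ml_test_def small_sections_def less_imp_le)
      finally show ?thesis .
    qed
    moreover have "(\<lambda>n. (1/2 :: real) ^ n) \<longlonglongrightarrow> 0" by (rule LIMSEQ_realpow_zero) auto
    ultimately have "measure (bernoulli P) (?N C) \<le> 0"
      by (intro LIMSEQ_le_const) auto
    then have "measure (bernoulli P) (?N C) = 0" by (simp add: measure_le_0_iff)
    with meas show ?thesis by (simp add: null_sets_def emeasure_eq_measure)
  qed
  then have null: "(\<Union>C\<in>{C. ml_test \<Omega> P C}. ?N C) \<in> null_sets (bernoulli P)"
    using count by (intro null_sets_UN') auto
  have full: "measure (bernoulli P) (streams \<Omega>) = 1"
    using measure_bernoulli_cyl[OF assms, of "[]"] by (simp add: cyl_singleton)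
  have "\<not> streams \<Omega> \<subseteq> (\<Union>C\<in>{C. ml_test \<Omega> P C}. ?N C)"
  proof
    assume "streams \<Omega> \<subseteq> (\<Union>C\<in>{C. ml_test \<Omega> P C}. ?N C)"
    then have "streams \<Omega> \<in> null_sets (bernoulli P)"
      by (rule null_sets_subset[OF null streams_event])
    then show False using full by (simp add: measure_eq_0_null_sets)
  qed
  then show ?thesis unfolding ensemble_def by blast
qed


section \<open>Weighted frequencies in random sequences\<close>

text \<open>
  The predicate \<open>b\<close> selects the positions that are counted.
\<close>

definition deviation :: "(nat \<Rightarrow> bool) \<Rightarrow> real \<Rightarrow> bool list \<Rightarrow> real" where
  "deviation b p \<omega> = (\<Sum>i<length \<omega>. of_bool (b i) * (of_bool (\<omega> ! i) - p))"

lemma deviation_Cons: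
  "deviation b p (x # \<omega>) = of_bool (b 0) * (of_bool x - p) + deviation (\<lambda>i. b (Suc i)) p \<omega>"
  unfolding deviation_def length_Cons sum.lessThan_Suc_shift by simp

lemma finite_set_replicate_bool: "finite (set_pmf (replicate_pmf N (Q :: bool pmf)))"
  unfolding set_replicate_pmf
  by (rule finite_subset[OF _ finite_lists_length_eq[of UNIV N]]) auto

lemma expectation_replicate_Suc:
  fixes f :: "bool list \<Rightarrow> real"
  shows "measure_pmf.expectation (replicate_pmf (Suc N) Q) f =
    pmf Q True * measure_pmf.expectation (replicate_pmf N Q) (\<lambda>\<omega>. f (True # \<omega>)) +
    pmf Q False * measure_pmf.expectation (replicate_pmf N Q) (\<lambda>\<omega>. f (False # \<omega>))"
proof -
  have "measure_pmf.expectation (replicate_pmf (Suc N) Q) f =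
    (\<Sum>a\<in>UNIV. pmf Q a *\<^sub>R measure_pmf.expectation (map_pmf ((#) a) (replicate_pmf N Q)) f)"
    unfolding replicate_pmf.simps map_pmf_def[symmetric]
    by (rule pmf_expectation_bind) (simp_all add: finite_set_replicate_bool)
  then show ?thesis by (simp add: UNIV_bool)
qed

text \<open>
  Induction on the length, splitting off the first trial: the selection \<open>b\<close> is fixed in advance, so the
  summands are independent with mean \<open>0\<close> and variance at most \<open>1\<close>.
\<close>

lemma deviation_moments:
  "measure_pmf.expectation (replicate_pmf N Q) (deviation b (pmf Q True)) = 0 \<and>
   measure_pmf.expectation (replicate_pmf N Q) (\<lambda>\<omega>. (deviation b (pmf Q True) \<omega>)\<^sup>2) \<le> N"
proof (induction N arbitrary: b)
  case 0
  then show ?case by (simp add: deviation_def)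
next
  case (Suc N)
  let ?p = "pmf Q True" and ?b = "\<lambda>i. b (Suc i)"
  let ?E = "measure_pmf.expectation (replicate_pmf N Q)"
  let ?S = "deviation ?b ?p"
  have p: "0 \<le> ?p" "?p \<le> 1" "pmf Q False = 1 - ?p"
    using sum_pmf_eq_1[OF finite subset_UNIV, of Q] by (simp_all add: pmf_le_1 UNIV_bool)
  have int: "integrable (measure_pmf (replicate_pmf N Q)) h" for h :: "bool list \<Rightarrow> real"
    by (rule integrable_measure_pmf_finite[OF finite_set_replicate_bool])
  have E1: "?E (\<lambda>\<omega>. c + ?S \<omega>) = c" for c
    using Suc[of ?b] int by simp
  have E2: "?E (\<lambda>\<omega>. (c + ?S \<omega>)\<^sup>2) = c\<^sup>2 + ?E (\<lambda>\<omega>. (?S \<omega>)\<^sup>2)" for c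
    using Suc[of ?b] int by (simp add: power2_sum mult.assoc)
  have "measure_pmf.expectation (replicate_pmf (Suc N) Q) (deviation b ?p) = 0"
    unfolding expectation_replicate_Suc deviation_Cons E1 by (simp add: p algebra_simps)
  moreover have "measure_pmf.expectation (replicate_pmf (Suc N) Q) (\<lambda>\<omega>. (deviation b ?p \<omega>)\<^sup>2)
      = of_bool (b 0) * (?p * (1 - ?p)) + ?E (\<lambda>\<omega>. (?S \<omega>)\<^sup>2)"
    unfolding expectation_replicate_Suc deviation_Cons E2
    by (cases "b 0") (simp_all add: p power2_eq_square algebra_simps)
  moreover have "?p * (1 - ?p) \<le> 1" using p mult_le_one[of ?p "1 - ?p"] by simp
  ultimately show ?case using Suc[of ?b] by (cases "b 0") auto
qed

lemma map_replicate_pmf: "map_pmf (map g) (replicate_pmf N P) = replicate_pmf N (map_pmf g P)"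
proof (induction N)
  case (Suc N)
  then show ?case
    by (simp add: map_pmf_def[symmetric] map_bind_pmf bind_map_pmf pmf.map_comp o_def flip: Suc)
qed simp

text \<open>
  Chebyshev's inequality. Passing to truth values first makes the sample space finite, so that all
  expectations exist.
\<close>

lemma prob_deviation_le:
  assumes "t > 0"
  shows "measure_pmf.prob (replicate_pmf N P)
      {\<sigma>. t \<le> \<bar>deviation b (measure_pmf.prob P A) (map (\<lambda>a. a \<in> A) \<sigma>)\<bar>} \<le> N / t\<^sup>2"
proof -
  let ?Q = "map_pmf (\<lambda>a. a \<in> A) P"
  have p: "measure_pmf.prob P A = pmf ?Q True"
    by (simp add: pmf_map vimage_def)
  let ?D = "deviation b (pmf ?Q True)"
  have "measure_pmf.prob (replicate_pmf N P) {\<sigma>. t \<le> \<bar>?D (map (\<lambda>a. a \<in> A) \<sigma>)\<bar>} =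
    measure_pmf.prob (map_pmf (map (\<lambda>a. a \<in> A)) (replicate_pmf N P)) {\<omega>. t \<le> \<bar>?D \<omega>\<bar>}"
    by (simp add: vimage_def)
  also have "\<dots> = measure_pmf.prob (replicate_pmf N ?Q) {\<omega>. t \<le> \<bar>?D \<omega>\<bar>}"
    by (simp add: map_replicate_pmf)
  also have "\<dots> \<le> measure_pmf.expectation (replicate_pmf N ?Q) (\<lambda>\<omega>. (?D \<omega>)\<^sup>2) / t\<^sup>2"
    using measure_pmf.Chebyshev_inequality[where M = "replicate_pmf N ?Q" and f = ?D and a = t] assms
      deviation_moments[of N ?Q b]
    by (simp add: integrable_measure_pmf_finite[OF finite_set_replicate_bool])
  also have "\<dots> \<le> N / t\<^sup>2"
    using deviation_moments[of N ?Q b] by (intro divide_right_mono) auto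
  finally show ?thesis unfolding p .
qed

text \<open>
  The test for a precision \<open>1 / v\<close> looks for a deviation of order \<open>2\<^sup>j / v\<close> among the first \<open>2\<^sup>j\<close> symbols,
  for some \<open>j \<ge> n + c\<close>. By Chebyshev's inequality this has probability at most \<open>v\<^sup>2 / 2\<^sup>j\<close> for each \<open>j\<close>,
  and these bounds form a geometric series. Comparing with a rational \<open>u / v\<close>
  instead of the probability \<open>p\<close> makes the comparison decidable, whatever the real number \<open>p\<close> is.
  The function \<open>F\<close> is a clocked version of \<open>Y\<close>, which need not be defined outside \<open>\<Omega>\<close>.
\<close>

lemma frequency_along_powers:
  fixes b :: "nat \<Rightarrow> bool" and Y :: "nat \<Rightarrow> nat" and F :: "nat \<Rightarrow> nat \<Rightarrow> nat"
  assumes random: "ml_random_rel \<Omega> P \<beta>s \<alpha>"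
    and b: "computable \<beta>s b"
    and F: "computable \<beta>s (\<lambda>z. F (fst z) (snd z))"
      "\<And>a s. F a s \<noteq> 0 \<Longrightarrow> F a s = Suc (Y a)"
      "\<And>a s t. F a s \<noteq> 0 \<Longrightarrow> s \<le> t \<Longrightarrow> F a t \<noteq> 0"
      "\<And>a. a \<in> \<Omega> \<Longrightarrow> \<exists>s. F a s \<noteq> 0"
  shows "(\<lambda>j. (\<Sum>i<2^j. of_bool (b i) *
      (of_bool (Y (\<alpha> !! i) = y) - measure_pmf.prob P {a. Y a = y})) / 2 ^ j) \<longlonglongrightarrow> 0"
proof -
  interpret prob_space "bernoulli P" by (rule prob_space_bernoulli)
  define A where "A = {a. Y a = y}"
  define p where "p = measure_pmf.prob P A"
  have p01: "0 \<le> p" "p \<le> 1" by (simp_all add: p_def)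
  define S0 where "S0 N = (\<Sum>i<N. of_bool (b i) :: nat)" for N
  define S1 where "S1 \<sigma> = (\<Sum>i<length \<sigma>. of_bool (b i \<and> \<sigma> ! i \<in> A) :: nat)" for \<sigma>
  define dev where "dev \<sigma> = deviation b p (map (\<lambda>a. a \<in> A) \<sigma>)" for \<sigma>
  have dev_eq: "dev \<sigma> = S1 \<sigma> - p * S0 (length \<sigma>)" for \<sigma>
  proof -
    have "dev \<sigma> = (\<Sum>i<length \<sigma>. of_bool (b i \<and> \<sigma> ! i \<in> A) - p * of_bool (b i))"
      unfolding dev_def deviation_def length_map
    proof (rule sum.cong[OF refl])
      show "of_bool (b i) * (of_bool (map (\<lambda>a. a \<in> A) \<sigma> ! i) - p) =
          of_bool (b i \<and> \<sigma> ! i \<in> A) - p * of_bool (b i)" if "i \<in> {..<length \<sigma>}" for i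
        using that by (cases "b i") auto
    qed
    then show ?thesis by (simp add: S0_def S1_def sum_subtractf sum_distrib_left del: sum_of_bool_eq)
  qed
  have S0_le: "S0 N \<le> N" for N
    unfolding S0_def using sum_mono[of "{..<N}" "\<lambda>i. of_bool (b i) :: nat" "\<lambda>_. 1"] by simp
  have bound: "\<exists>j0. \<forall>j\<ge>j0. \<bar>dev (stake (2^j) \<alpha>)\<bar> \<le> 3 * 2^j / v" if v: "v > 0" for v :: nat
  proof -
    define u where "u = nat \<lfloor>p * v\<rfloor>"
    have "real u = of_int \<lfloor>p * v\<rfloor>" unfolding u_def using p01 by simp
    then have u: "real u \<le> p * v" "p * v \<le> real u + 1" by linarith+
    \<comment> \<open>The geometric series from \<open>j = n + c\<close> on sums up to \<open>2 v\<^sup>2 / 2\<^sup>n\<^sup>+\<^sup>c\<close>.\<close>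
    obtain c where c: "2 * (real v)\<^sup>2 < 2 ^ c"
      using real_arch_pow[of 2 "2 * (real v)\<^sup>2"] by auto
    \<comment> \<open>Replacing \<open>p\<close> by \<open>u / v\<close> costs at most \<open>length \<sigma>\<close>, so a gap above \<open>2 * length \<sigma>\<close> leaves a true one.\<close>
    define far where "far \<sigma> \<longleftrightarrow> u * S0 (length \<sigma>) + 2 * length \<sigma> < v * S1 \<sigma> \<or>
      v * S1 \<sigma> + 2 * length \<sigma> < u * S0 (length \<sigma>)" for \<sigma>
    have far_iff: "far \<sigma> \<longleftrightarrow> 2 * real (length \<sigma>) < \<bar>real v * S1 \<sigma> - real u * S0 (length \<sigma>)\<bar>" for \<sigma>
      unfolding far_def by (simp flip: of_nat_less_iff[where 'a = real]) linarith
    have diff: "\<bar>(real v * S1 \<sigma> - real u * S0 (length \<sigma>)) - v * dev \<sigma>\<bar> \<le> length \<sigma>" for \<sigma>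
    proof -
      have "(real v * S1 \<sigma> - real u * S0 (length \<sigma>)) - v * dev \<sigma> = (p * v - u) * S0 (length \<sigma>)"
        unfolding dev_eq by (simp add: algebra_simps)
      moreover have "0 \<le> (p * v - u) * S0 (length \<sigma>)" using u by simp
      moreover have "(p * v - u) * S0 (length \<sigma>) \<le> 1 * real (S0 (length \<sigma>))"
        using u by (intro mult_right_mono) auto
      ultimately show ?thesis using S0_le[of "length \<sigma>"] by simp
    qed
    define R where "R n \<sigma> \<longleftrightarrow> (\<exists>s. \<forall>a\<in>set \<sigma>. F a s \<noteq> 0) \<and>
      (\<exists>j\<ge>n + c. length \<sigma> = 2 ^ j) \<and> far \<sigma>" for n \<sigma>
    \<comment> \<open>\<open>T\<close> is \<open>S1\<close> computed with the clocked version of \<open>Y\<close>.\<close>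
    define T where "T \<sigma> s = sum_list (map (\<lambda>i. of_bool (b i \<and>
      F (if i < length \<sigma> then \<sigma> ! i else 0) s = Suc y) :: nat) [0..<length \<sigma>])" for \<sigma> s
    define D where "D = (\<lambda>z s. (\<forall>a\<in>set (snd z). F a s \<noteq> 0) \<and>
      (\<exists>j\<in>set [0..<Suc (length (snd z))]. fst z + c \<le> j \<and> length (snd z) = 2 ^ j) \<and>
      (u * sum_list (map (\<lambda>i. of_bool (b i)) [0..<length (snd z)]) + 2 * length (snd z) < v * T (snd z) s \<or>
      v * T (snd z) s + 2 * length (snd z) < u * sum_list (map (\<lambda>i. of_bool (b i)) [0..<length (snd z)])))"
    have "computable \<beta>s (\<lambda>z. D (fst z) (snd z))"
      unfolding D_def T_def
      by (intro computable_intros computable_compose[OF b] computable_compose2[OF F(1)]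
          computable_nth_default)
    moreover have "R n \<sigma> \<longleftrightarrow> (\<exists>s. D (n, \<sigma>) s)" for n \<sigma>
    proof -
      have S0: "sum_list (map (\<lambda>i. of_bool (b i)) [0..<N]) = S0 N" for N
        by (simp add: S0_def atLeast0LessThan interv_sum_list_conv_sum_set_nat del: sum_of_bool_eq)
      have T: "T \<sigma> s = S1 \<sigma>" if "\<forall>a\<in>set \<sigma>. F a s \<noteq> 0" for s
      proof -
        have "(F (\<sigma> ! i) s = Suc y) \<longleftrightarrow> \<sigma> ! i \<in> A" if "i < length \<sigma>" for i
          using F(2)[of "\<sigma> ! i" s] \<open>\<forall>a\<in>set \<sigma>. F a s \<noteq> 0\<close> that by (auto simp: A_def)
        then show ?thesis
          unfolding T_def S1_def
          by (simp only: interv_sum_list_conv_sum_set_nat set_upt atLeast0LessThan)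
             (rule sum.cong, simp_all)
      qed
      have len: "(\<exists>j\<in>set [0..<Suc (length \<sigma>)]. n + c \<le> j \<and> length \<sigma> = 2 ^ j) \<longleftrightarrow>
          (\<exists>j\<ge>n + c. length \<sigma> = 2 ^ j)"
      proof
        assume "\<exists>j\<ge>n + c. length \<sigma> = 2 ^ j"
        then obtain j where j: "n + c \<le> j" "length \<sigma> = 2 ^ j" by blast
        then have "j \<in> set [0..<Suc (length \<sigma>)]"
          using less_exp[of j] by (simp add: less_Suc_eq del: upt_Suc)
        with j show "\<exists>j\<in>set [0..<Suc (length \<sigma>)]. n + c \<le> j \<and> length \<sigma> = 2 ^ j" by blast
      qed blast
      show ?thesis unfolding R_def D_def fst_conv snd_conv S0 len far_def using T by auto
    qed
    ultimately have semi: "semidecidable \<beta>s (\<lambda>z. R (fst z) (snd z))"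
      by (intro semidecidableI[where D = D]) auto
    have small: "measure (bernoulli P) (cyl \<Omega> {\<sigma>. R n \<sigma>}) < (1/2) ^ n" if "n \<ge> 1" for n
    proof -
      define B where "B i = {\<gamma>. stake (2 ^ (n + c + i)) \<gamma> \<in> {\<sigma>. 2 ^ (n + c + i) / v \<le> \<bar>dev \<sigma>\<bar>}}" for i
      have B: "measure (bernoulli P) (B i) \<le> v\<^sup>2 / 2 ^ (n + c) * (1/2) ^ i" for i
      proof -
        have "measure (bernoulli P) (B i) \<le> 2 ^ (n + c + i) / (2 ^ (n + c + i) / real v)\<^sup>2"
          unfolding B_def measure_bernoulli_stake dev_def p_def
          using prob_deviation_le[of "2 ^ (n + c + i) / real v" "2 ^ (n + c + i)" P b A] v by simp
        also have "\<dots> = v\<^sup>2 / 2 ^ (n + c) * (1/2) ^ i"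
          by (simp add: power2_eq_square power_add field_simps)
        finally show ?thesis .
      qed
      have geo: "summable (\<lambda>i. (real v)\<^sup>2 / 2 ^ (n + c) * (1/2) ^ i)"
        by (intro summable_mult summable_geometric) auto
      have summ: "summable (\<lambda>i. measure (bernoulli P) (B i))"
        by (rule summable_comparison_test'[OF geo, of 0]) (use B in auto)
      have "cyl \<Omega> {\<sigma>. R n \<sigma>} \<subseteq> (\<Union>i. B i)"
      proof
        fix \<gamma> assume "\<gamma> \<in> cyl \<Omega> {\<sigma>. R n \<sigma>}"
        then obtain k where k: "R n (stake k \<gamma>)" by (auto simp: cyl_def)
        then obtain j where j: "j \<ge> n + c" "k = 2 ^ j" and "far (stake k \<gamma>)" by (auto simp: R_def)
        then have "2 * real k < \<bar>real v * S1 (stake k \<gamma>) - real u * S0 k\<bar>"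
          by (simp add: far_iff)
        with diff[of "stake k \<gamma>"] have "real k \<le> \<bar>real v * dev (stake k \<gamma>)\<bar>" by simp
        then have "real k / v \<le> \<bar>dev (stake k \<gamma>)\<bar>"
          using v by (simp add: abs_mult field_simps)
        moreover have "n + c + (j - (n + c)) = j" using j(1) by simp
        ultimately have "\<gamma> \<in> B (j - (n + c))" using j(2) by (simp add: B_def)
        then show "\<gamma> \<in> (\<Union>i. B i)" by blast
      qed
      then have "measure (bernoulli P) (cyl \<Omega> {\<sigma>. R n \<sigma>}) \<le> measure (bernoulli P) (\<Union>i. B i)"
        by (rule finite_measure_mono) (auto simp: B_def intro!: sets.countable_UN stake_event simp del: mem_Collect_eq)
      also have "\<dots> \<le> (\<Sum>i. measure (bernoulli P) (B i))"
        by (rule finite_measure_subadditive_countably[OF _ summ])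
           (unfold B_def, intro image_subsetI stake_event)
      also have "\<dots> \<le> (\<Sum>i. (real v)\<^sup>2 / 2 ^ (n + c) * (1/2) ^ i)"
        by (rule suminf_le[OF _ summ geo]) (use B in simp)
      also have "\<dots> = 2 * (real v)\<^sup>2 / 2 ^ (n + c)"
        by (subst suminf_mult) (simp_all add: suminf_geometric summable_geometric)
      also have "\<dots> < (1/2) ^ n"
        using c by (simp add: power_add field_simps)
      finally show ?thesis .
    qed
    obtain n where n: "\<And>k. \<not> R n (stake k \<alpha>)"
      using ml_random_rel_avoids[OF random semi small] by blast
    have "\<bar>dev (stake (2^j) \<alpha>)\<bar> \<le> 3 * 2^j / v" if j: "j \<ge> n + c" for j
    proof -
      let ?\<sigma> = "stake (2^j) \<alpha>"
      have "set ?\<sigma> \<subseteq> \<Omega>"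
        using random by (auto simp: ml_random_rel_def in_set_conv_nth streams_iff_snth)
      then have "\<forall>a\<in>set ?\<sigma>. \<exists>s. F a s \<noteq> 0" using F(4) by blast
      then have "\<exists>s. \<forall>a\<in>set ?\<sigma>. F a s \<noteq> 0"
        by (subst (asm) common_clock) (use F(3) in blast)+
      moreover have "\<exists>i\<ge>n + c. length ?\<sigma> = 2 ^ i" using j by (intro exI[of _ j]) simp
      ultimately have "\<not> far ?\<sigma>" using n[of "2^j"] unfolding R_def by blast
      then have "\<bar>real v * S1 ?\<sigma> - real u * S0 (2^j)\<bar> \<le> 2 * 2^j" by (simp add: far_iff)
      with diff[of ?\<sigma>] have "\<bar>real v * dev ?\<sigma>\<bar> \<le> 3 * 2^j" by simp
      then show ?thesis using v by (simp add: abs_mult field_simps)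
    qed
    then show ?thesis by blast
  qed
  have dev_stake: "dev (stake N \<alpha>) = (\<Sum>i<N. of_bool (b i) * (of_bool (Y (\<alpha> !! i) = y) - p))" for N
    unfolding dev_def deviation_def by (simp add: A_def)
  have "(\<lambda>j. dev (stake (2^j) \<alpha>) / 2^j) \<longlonglongrightarrow> 0"
  proof (rule LIMSEQ_I)
    fix r :: real assume "r > 0"
    then obtain v :: nat where v: "3 / r < v" using reals_Archimedean2 by blast
    with \<open>r > 0\<close> have v0: "v > 0" by (cases v) (auto simp: field_simps)
    obtain j0 where j0: "\<And>j. j \<ge> j0 \<Longrightarrow> \<bar>dev (stake (2^j) \<alpha>)\<bar> \<le> 3 * 2^j / v"
      using bound[OF v0] by blast
    have "norm (dev (stake (2^j) \<alpha>) / 2^j - 0) < r" if "j \<ge> j0" for j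
    proof -
      have "\<bar>dev (stake (2^j) \<alpha>)\<bar> / 2^j \<le> (3 * 2^j / v) / 2^j"
        by (rule divide_right_mono[OF j0[OF that]]) simp
      also have "\<dots> = 3 / v" by simp
      also have "\<dots> < r" using v v0 \<open>r > 0\<close> by (simp add: field_simps)
      finally show ?thesis by simp
    qed
    then show "\<exists>no. \<forall>n\<ge>no. norm (dev (stake (2^n) \<alpha>) / 2^n - 0) < r" by blast
  qed
  then show ?thesis unfolding dev_stake p_def A_def .
qed


section \<open>Upper approximation of weights\<close>

definition weight :: "nat pmf \<Rightarrow> nat list \<Rightarrow> real" where
  "weight P \<sigma> = prod_list (map (pmf P) \<sigma>)"

text \<open>
  The integer part of \<open>2\<^sup>K r\<close> for the rational \<open>r\<close> with code \<open>c\<close>, truncated at \<open>0\<close>. Even codes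
  are those of the nonnegative numerators.
\<close>

definition dyadic_floor :: "nat \<Rightarrow> nat \<Rightarrow> nat" where
  "dyadic_floor c K =
    2 ^ K * (let p = fst (prod_decode c) in if 2 * (p div 2) = p then p div 2 else 0)
      div Suc (snd (prod_decode c))"

text \<open>
  One unit is subtracted (on natural numbers, hence not below \<open>0\<close>) to obtain a lower bound
  in spite of the error of the rational approximation.
\<close>

lemma dyadic_floor:
  assumes "0 \<le> r" "\<bar>r - of_rat (rat_decode c)\<bar> \<le> (1/2) ^ K"
  shows "real (dyadic_floor c K - 1) \<le> 2 ^ K * r" "2 ^ K * r \<le> real (dyadic_floor c K - 1) + 3"
proof -
  obtain p q where c: "prod_decode c = (p, q)" by fastforce
  define x :: real where "x = of_rat (rat_decode c)"
  have x: "x = of_int (int_decode p) / real (Suc q)"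
    by (simp add: x_def rat_decode_def c of_rat_divide of_rat_add)
  define num where "num = (if even p then p div 2 else 0)"
  have df: "dyadic_floor c K = 2 ^ K * num div Suc q"
    by (auto simp: dyadic_floor_def c num_def Let_def elim!: evenE)
  have close: "2 ^ K * r \<le> 2 ^ K * x + 1" "2 ^ K * x \<le> 2 ^ K * r + 1"
    using assms(2) unfolding x_def[symmetric] by (auto simp: abs_le_iff field_simps)
  have fl: "real (2 ^ K * num div Suc q) \<le> 2 ^ K * num / Suc q"
    "2 ^ K * num / Suc q \<le> real (2 ^ K * num div Suc q) + 1"
  proof -
    have "real (2 ^ K * num div Suc q) = of_int \<lfloor>real (2 ^ K * num) / real (Suc q)\<rfloor>"
      by (subst floor_divide_of_nat_eq) simp
    then show "real (2 ^ K * num div Suc q) \<le> 2 ^ K * num / Suc q"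
      "2 ^ K * num / Suc q \<le> real (2 ^ K * num div Suc q) + 1" by linarith+
  qed
  have 1: "2 ^ K * x \<le> 2 ^ K * num / Suc q"
  proof -
    have "int_decode p \<le> int num"
      by (auto simp: num_def int_decode_def sum_decode_def)
    then have "real_of_int (int_decode p) \<le> real num" by linarith
    then show ?thesis unfolding x by (simp add: divide_right_mono)
  qed
  show "2 ^ K * r \<le> real (dyadic_floor c K - 1) + 3"
    using close(1) 1 fl(2) unfolding df by linarith
  show "real (dyadic_floor c K - 1) \<le> 2 ^ K * r"
  proof (cases "num = 0")
    case True
    then show ?thesis using assms(1) by (simp add: df)
  next
    case False
    then have "even p" by (auto simp: num_def split: if_splits)
    then have "int_decode p = int num"
      by (auto simp: num_def int_decode_def sum_decode_def)
    then have "2 ^ K * x = 2 ^ K * num / Suc q" unfolding x by simp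
    moreover have "0 \<le> 2 ^ K * r" using assms(1) by simp
    ultimately show ?thesis using fl(1) close(2) unfolding df
      by (cases "2 ^ K * num div Suc q") auto
  qed
qed

lemma computable_pmf_clocked:
  assumes "computable_pmf \<Omega> P"
  obtains G :: "nat \<Rightarrow> nat \<Rightarrow> nat \<Rightarrow> nat" where
    "\<And>\<beta>s. computable \<beta>s (\<lambda>z. G (fst z) (fst (snd z)) (snd (snd z)))"
    "\<And>a K s t. G a K s \<noteq> 0 \<Longrightarrow> s \<le> t \<Longrightarrow> G a K t \<noteq> 0"
    "\<And>a K. a \<in> \<Omega> \<Longrightarrow> \<exists>s. G a K s \<noteq> 0"
    "\<And>a K s. G a K s \<noteq> 0 \<Longrightarrow> real (G a K s - 1) \<le> 2 ^ K * pmf P a"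
    "\<And>a K s. G a K s \<noteq> 0 \<Longrightarrow> 2 ^ K * pmf P a \<le> real (G a K s - 1) + 3"
proof -
  obtain f where f: "\<And>a k. halts [] f [a, k] \<longleftrightarrow> a \<in> \<Omega>"
    "\<And>a k c. eval [] f [a, k] c \<Longrightarrow> \<bar>pmf P a - of_rat (rat_decode c)\<bar> \<le> (1/2) ^ k"
    using assms unfolding computable_pmf_def by blast
  obtain F :: "nat list \<Rightarrow> nat \<Rightarrow> nat" where F: "\<And>\<beta>s. computable \<beta>s (\<lambda>z. F (fst z) (snd z))"
    "\<And>xs y. eval [] f xs y \<longleftrightarrow> (\<exists>s. F xs s = Suc y)"
    "\<And>xs s t y. F xs s = Suc y \<Longrightarrow> s \<le> t \<Longrightarrow> F xs t = Suc y"
    by (rule clocked_no_oracle[of f]) (rule that)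
  define G where "G a K s = (if F [a, K] s = 0 then 0 else Suc (dyadic_floor (F [a, K] s - 1) K - 1))"
    for a K s
  have G_nz: "G a K s \<noteq> 0 \<longleftrightarrow> (\<exists>c. F [a, K] s = Suc c)" for a K s
    by (cases "F [a, K] s") (auto simp: G_def)
  have approx: "real (G a K s - 1) \<le> 2 ^ K * pmf P a \<and> 2 ^ K * pmf P a \<le> real (G a K s - 1) + 3"
    if "G a K s \<noteq> 0" for a K s
  proof -
    from that obtain c where c: "F [a, K] s = Suc c" unfolding G_nz by blast
    then have "\<bar>pmf P a - of_rat (rat_decode c)\<bar> \<le> (1/2) ^ K" using f(2) F(2) by blast
    from dyadic_floor[OF pmf_nonneg this] show ?thesis by (simp add: G_def c)
  qed
  show ?thesis
  proof (rule that[of G])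
    show "computable \<beta>s (\<lambda>z. G (fst z) (fst (snd z)) (snd (snd z)))" for \<beta>s
      unfolding G_def dyadic_floor_def Let_def
      by (intro computable_intros computable_compose2[OF F(1)])
    show "G a K s \<noteq> 0 \<Longrightarrow> s \<le> t \<Longrightarrow> G a K t \<noteq> 0" for a K s t
      unfolding G_nz using F(3) by blast
    show "\<exists>s. G a K s \<noteq> 0" if "a \<in> \<Omega>" for a K
      unfolding G_nz using f(1)[of a K] that F(2) unfolding halts_def by blast
  qed (use approx in blast)+
qed

lemma tendsto_sum_prod_list:
  fixes g :: "'a \<Rightarrow> real" and \<epsilon> :: "nat \<Rightarrow> real"
  assumes "\<epsilon> \<longlonglongrightarrow> 0"
  shows "(\<lambda>K. \<Sum>\<sigma>\<leftarrow>ys. prod_list (map (\<lambda>x. g x + \<epsilon> K) \<sigma>)) \<longlonglongrightarrow>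
    (\<Sum>\<sigma>\<leftarrow>ys. prod_list (map g \<sigma>))"
proof -
  have "(\<lambda>K. g x + \<epsilon> K) \<longlonglongrightarrow> g x + 0" for x by (intro tendsto_intros assms)
  then have "(\<lambda>K. prod_list (map (\<lambda>x. g x + \<epsilon> K) \<sigma>)) \<longlonglongrightarrow> prod_list (map g \<sigma>)" for \<sigma>
    by (induction \<sigma>) (auto intro!: tendsto_intros)
  then show ?thesis by (induction ys) (auto intro!: tendsto_intros)
qed

lemma prod_list_mono_real:
  fixes f g :: "'a \<Rightarrow> real"
  assumes "\<And>x. x \<in> set xs \<Longrightarrow> 0 \<le> f x" "\<And>x. x \<in> set xs \<Longrightarrow> f x \<le> g x"
  shows "prod_list (map f xs) \<le> prod_list (map g xs)"
  using assms
proof (induction xs)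
  case (Cons x xs)
  moreover have "0 \<le> prod_list (map f xs)"
    using Cons.prems(1) by (intro prod_list_nonneg) auto
  moreover have "0 \<le> g x" using Cons.prems[of x] by auto
  ultimately show ?case by (auto intro!: mult_mono)
qed simp

text \<open>
  With finitely many \<open>a < K\<close> and lower bounds for their probabilities in multiples of \<open>2\<^sup>-\<^sup>K\<close>, the
  complement of \<open>X a \<noteq> x\<close> gives an upper bound \<open>u x K t / 2\<^sup>K\<close> for the probability of \<open>x\<close>. If the
  clock \<open>t\<close> is large enough for \<open>K\<close>, the error is at most \<open>\<epsilon> K\<close>, uniformly in \<open>x\<close>: the mass of
  \<open>{K..}\<close> plus \<open>K\<close> rounding errors. So the strict inequality holds iff it holds for some of the
  upper bounds, by continuity of the weights.
\<close>

lemma semidecidable_weight_less: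
  assumes P: "set_pmf P \<subseteq> \<Omega>" "computable_pmf \<Omega> P" and X: "partial_recursive_on \<Omega> X"
  shows "semidecidable \<beta>s (\<lambda>z. (\<Sum>\<sigma>\<leftarrow>fst z. weight (map_pmf X P) \<sigma>) < (1/2) ^ snd z)"
proof -
  let ?Q = "map_pmf X P"
  obtain G :: "nat \<Rightarrow> nat \<Rightarrow> nat \<Rightarrow> nat" where
    G: "\<And>\<beta>s. computable \<beta>s (\<lambda>z. G (fst z) (fst (snd z)) (snd (snd z)))"
    "\<And>a K s t. G a K s \<noteq> 0 \<Longrightarrow> s \<le> t \<Longrightarrow> G a K t \<noteq> 0"
    "\<And>a K. a \<in> \<Omega> \<Longrightarrow> \<exists>s. G a K s \<noteq> 0"
    "\<And>a K s. G a K s \<noteq> 0 \<Longrightarrow> real (G a K s - 1) \<le> 2 ^ K * pmf P a"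
    "\<And>a K s. G a K s \<noteq> 0 \<Longrightarrow> 2 ^ K * pmf P a \<le> real (G a K s - 1) + 3"
    by (rule computable_pmf_clocked[OF P(2)]) (rule that)
  obtain F :: "nat \<Rightarrow> nat \<Rightarrow> nat" where
    F: "\<And>\<beta>s. computable \<beta>s (\<lambda>z. F (fst z) (snd z))"
    "\<And>a s. F a s = 0 \<or> F a s = Suc (X a) \<and> a \<in> \<Omega>"
    "\<And>a s t. F a s \<noteq> 0 \<Longrightarrow> s \<le> t \<Longrightarrow> F a t \<noteq> 0"
    "\<And>a. a \<in> \<Omega> \<Longrightarrow> \<exists>s. F a s \<noteq> 0"
    by (rule partial_recursive_clocked[OF X]) (rule that)
  define low where "low x K t a = (if G a K t \<noteq> 0 \<and> F a t \<noteq> 0 \<and> F a t \<noteq> Suc x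
    then G a K t - 1 else 0)" for x K t a
  define u where "u x K t = 2 ^ K - sum_list (map (\<lambda>a. low x K t a) [0..<K])" for x K t
  have pmf_Q: "pmf ?Q x = measure_pmf.prob P {a. X a = x}" for x
    by (simp add: pmf_map vimage_def)
  have compl: "measure_pmf.prob P {a. X a \<noteq> x} = 1 - pmf ?Q x" for x
    unfolding pmf_Q using measure_pmf.prob_compl[of "{a. X a = x}" P]
    by (simp add: Compl_eq_Diff_UNIV[symmetric] Collect_neg_eq[symmetric])
  have sum_low: "sum_list (map (\<lambda>a. low x K t a) [0..<K]) = (\<Sum>a<K. low x K t a)" for x K t
    by (simp add: interv_sum_list_conv_sum_set_nat atLeast0LessThan)
  have low_le: "real (low x K t a) \<le> 2 ^ K * (if X a \<noteq> x then pmf P a else 0)" for x K t a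
    using F(2)[of a t] G(4)[of a K t] by (auto simp: low_def)
  have sums: "(\<Sum>a<K. if X a \<noteq> x then pmf P a else 0) = measure_pmf.prob P {a. a < K \<and> X a \<noteq> x}" for K x
    by (subst measure_measure_pmf_finite) (auto simp: sum.If_cases intro!: sum.cong)
  have low_sum_le: "real (\<Sum>a<K. low x K t a) \<le> 2 ^ K * (1 - pmf ?Q x)" for x K t
  proof -
    have "real (\<Sum>a<K. low x K t a) \<le> (\<Sum>a<K. 2 ^ K * (if X a \<noteq> x then pmf P a else 0))"
      unfolding of_nat_sum by (rule sum_mono[OF low_le])
    also have "\<dots> = 2 ^ K * measure_pmf.prob P {a. a < K \<and> X a \<noteq> x}"
      unfolding sum_distrib_left[symmetric] sums ..
    also have "\<dots> \<le> 2 ^ K * measure_pmf.prob P {a. X a \<noteq> x}"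
      by (intro mult_left_mono measure_pmf.finite_measure_mono) auto
    finally show ?thesis unfolding compl .
  qed
  have u_eq: "real (u x K t) = 2 ^ K - real (\<Sum>a<K. low x K t a)" for x K t
  proof -
    have "real (\<Sum>a<K. low x K t a) \<le> 2 ^ K"
      using low_sum_le[where x = x and K = K and t = t] pmf_nonneg[of ?Q x]
      by (smt (verit) mult_left_le zero_le_power)
    then have "(\<Sum>a<K. low x K t a) \<le> 2 ^ K"
      by (metis of_nat_le_iff of_nat_numeral of_nat_power)
    then show ?thesis unfolding u_def sum_low by (simp add: of_nat_diff)
  qed
  have upper: "pmf ?Q x \<le> u x K t / 2 ^ K" for x K t
    using low_sum_le[of x K t] unfolding u_eq by (simp add: field_simps)
  define \<epsilon> where "\<epsilon> K = measure_pmf.prob P {K..} + 3 * real K / 2 ^ K" for K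
  have \<epsilon>: "\<epsilon> \<longlonglongrightarrow> 0"
  proof -
    have "(\<lambda>K. measure_pmf.prob P {K..}) \<longlonglongrightarrow> measure_pmf.prob P (\<Inter>K. {K..})"
      by (rule measure_pmf.finite_Lim_measure_decseq) (auto simp: decseq_def)
    moreover have "(\<Inter>K. {K..}) = ({} :: nat set)"
    proof (intro equals0I)
      fix k :: nat assume "k \<in> (\<Inter>K. {K..})"
      then have "Suc k \<le> k" by blast
      then show False by simp
    qed
    ultimately have "(\<lambda>K. measure_pmf.prob P {K..}) \<longlonglongrightarrow> 0" by simp
    moreover have "(\<lambda>K. real K * (1/2) ^ K) \<longlonglongrightarrow> 0"
      using powser_times_n_limit_0[of "1/2 :: real"] by simp
    then have "(\<lambda>K. 3 * (real K * (1/2) ^ K)) \<longlonglongrightarrow> 0" by (rule tendsto_mult_right_zero)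
    ultimately have "(\<lambda>K. measure_pmf.prob P {K..} + 3 * (real K * (1/2) ^ K)) \<longlonglongrightarrow> 0"
      by (rule tendsto_add_zero)
    then show ?thesis unfolding \<epsilon>_def by (simp add: power_one_over field_simps)
  qed
  have lower: "\<exists>t. \<forall>x. u x K t / 2 ^ K \<le> pmf ?Q x + \<epsilon> K" for K
  proof -
    have "\<forall>a\<in>set (filter (\<lambda>a. a \<in> \<Omega>) [0..<K]). \<exists>t. G a K t \<noteq> 0 \<and> F a t \<noteq> 0"
    proof
      fix a assume "a \<in> set (filter (\<lambda>a. a \<in> \<Omega>) [0..<K])"
      then obtain s t where "G a K s \<noteq> 0" "F a t \<noteq> 0" using G(3) F(4) by fastforce
      then have "G a K (max s t) \<noteq> 0" "F a (max s t) \<noteq> 0"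
        using G(2) F(3) max.cobounded1 max.cobounded2 by blast+
      then show "\<exists>t. G a K t \<noteq> 0 \<and> F a t \<noteq> 0" by blast
    qed
    then have "\<exists>t. \<forall>a\<in>set (filter (\<lambda>a. a \<in> \<Omega>) [0..<K]). G a K t \<noteq> 0 \<and> F a t \<noteq> 0"
      by (subst (asm) common_clock) (use G(2) F(3) in blast)+
    then obtain t where t: "\<And>a. a < K \<Longrightarrow> a \<in> \<Omega> \<Longrightarrow> G a K t \<noteq> 0 \<and> F a t \<noteq> 0" by auto
    have "u x K t / 2 ^ K \<le> pmf ?Q x + \<epsilon> K" for x
    proof -
      have "2 ^ K * (if X a \<noteq> x then pmf P a else 0) - 3 \<le> low x K t a" if "a < K" for a
      proof (cases "a \<in> \<Omega>")
        case True
        then show ?thesis using t[OF that True] F(2)[of a t] G(5)[of a K t] by (auto simp: low_def)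
      next
        case False
        then have "pmf P a = 0" using P(1) by (auto simp: set_pmf_eq)
        then show ?thesis by simp
      qed
      then have "(\<Sum>a<K. 2 ^ K * (if X a \<noteq> x then pmf P a else 0) - 3) \<le> (\<Sum>a<K. real (low x K t a))"
        by (intro sum_mono) auto
      then have 1: "2 ^ K * measure_pmf.prob P {a. a < K \<and> X a \<noteq> x} - 3 * real K \<le> (\<Sum>a<K. real (low x K t a))"
        unfolding sum_subtractf sum_distrib_left[symmetric] sums by (simp add: mult.commute)
      have "measure_pmf.prob P {a. X a \<noteq> x} \<le> measure_pmf.prob P ({a. a < K \<and> X a \<noteq> x} \<union> {K..})"
        by (rule measure_pmf.finite_measure_mono) auto
      also have "\<dots> \<le> measure_pmf.prob P {a. a < K \<and> X a \<noteq> x} + measure_pmf.prob P {K..}"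
        by (rule measure_Un_le) auto
      finally have "1 - pmf ?Q x - measure_pmf.prob P {K..} \<le> measure_pmf.prob P {a. a < K \<and> X a \<noteq> x}"
        unfolding compl by simp
      then have "2 ^ K * (1 - pmf ?Q x - measure_pmf.prob P {K..}) \<le> 2 ^ K * measure_pmf.prob P {a. a < K \<and> X a \<noteq> x}"
        by (rule mult_left_mono) simp
      with 1 have "u x K t \<le> 2 ^ K * (pmf ?Q x + measure_pmf.prob P {K..}) + 3 * real K"
        unfolding u_eq by (simp add: algebra_simps)
      then show ?thesis unfolding \<epsilon>_def by (simp add: field_simps)
    qed
    then show ?thesis by blast
  qed
  \<comment> \<open>The sum of the upper bounds with common denominator \<open>2 ^ (K * sum_list (map length ys))\<close>.\<close>
  define W where "W ys K t = sum_list (map (\<lambda>\<sigma>. prod_list (map (\<lambda>x. u x K t) \<sigma>) *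
    2 ^ (K * (sum_list (map length ys) - length \<sigma>))) ys)" for ys K t
  have W: "real (W ys K t) = 2 ^ (K * sum_list (map length ys)) *
      (\<Sum>\<sigma>\<leftarrow>ys. prod_list (map (\<lambda>x. u x K t / 2 ^ K) \<sigma>))" for ys K t
  proof -
    let ?M = "sum_list (map length ys)"
    have "real (prod_list (map (\<lambda>x. u x K t) \<sigma>) * 2 ^ (K * (?M - length \<sigma>))) =
      2 ^ (K * ?M) * prod_list (map (\<lambda>x. u x K t / 2 ^ K) \<sigma>)" if "\<sigma> \<in> set ys" for \<sigma>
    proof -
      have "length \<sigma> \<le> ?M" using that by (intro member_le_sum_list) auto
      then have M: "K * ?M = K * (?M - length \<sigma>) + K * length \<sigma>"
        by (simp flip: distrib_left)
      have "prod_list (map (\<lambda>x. u x K t / 2 ^ K) \<sigma>) * 2 ^ (K * length \<sigma>) = prod_list (map (\<lambda>x. u x K t) \<sigma>)"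
        by (induction \<sigma>) (auto simp: power_add field_simps)
      then show ?thesis unfolding M power_add by (simp add: mult_ac)
    qed
    then have "map (\<lambda>\<sigma>. real (prod_list (map (\<lambda>x. u x K t) \<sigma>) * 2 ^ (K * (?M - length \<sigma>)))) ys =
      map (\<lambda>\<sigma>. 2 ^ (K * ?M) * prod_list (map (\<lambda>x. u x K t / 2 ^ K) \<sigma>)) ys" by (intro map_cong) auto
    moreover have "real (sum_list (map h zs)) = sum_list (map (\<lambda>\<sigma>. real (h \<sigma>)) zs)"
      for h :: "nat list \<Rightarrow> nat" and zs by (induction zs) auto
    ultimately show ?thesis unfolding W_def by (simp only: sum_list_const_mult)
  qed
  have W_iff: "W ys K t * 2 ^ n < 2 ^ (K * sum_list (map length ys)) \<longleftrightarrow>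
      (\<Sum>\<sigma>\<leftarrow>ys. prod_list (map (\<lambda>x. u x K t / 2 ^ K) \<sigma>)) < (1/2) ^ n" for ys K t n
  proof -
    have "W ys K t * 2 ^ n < 2 ^ (K * sum_list (map length ys)) \<longleftrightarrow>
      real (W ys K t) * 2 ^ n < 2 ^ (K * sum_list (map length ys))"
      using of_nat_less_iff[where 'a = real, of "W ys K t * 2 ^ n"
          "2 ^ (K * sum_list (map length ys))"] by simp
    then show ?thesis unfolding W by (simp add: field_simps)
  qed
  have main: "(\<Sum>\<sigma>\<leftarrow>ys. weight ?Q \<sigma>) < (1/2) ^ n \<longleftrightarrow>
    (\<exists>K t. W ys K t * 2 ^ n < 2 ^ (K * sum_list (map length ys)))" for ys n
    unfolding W_iff
  proof
    assume "(\<Sum>\<sigma>\<leftarrow>ys. weight ?Q \<sigma>) < (1/2) ^ n"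
    then have "\<forall>\<^sub>F K in sequentially. (\<Sum>\<sigma>\<leftarrow>ys. prod_list (map (\<lambda>x. pmf ?Q x + \<epsilon> K) \<sigma>)) < (1/2) ^ n"
      unfolding weight_def by (rule order_tendstoD(2)[OF tendsto_sum_prod_list[OF \<epsilon>]])
    then obtain K where K: "(\<Sum>\<sigma>\<leftarrow>ys. prod_list (map (\<lambda>x. pmf ?Q x + \<epsilon> K) \<sigma>)) < (1/2) ^ n"
      by (auto simp: eventually_sequentially)
    obtain t where "\<And>x. u x K t / 2 ^ K \<le> pmf ?Q x + \<epsilon> K" using lower by blast
    then have "(\<Sum>\<sigma>\<leftarrow>ys. prod_list (map (\<lambda>x. u x K t / 2 ^ K) \<sigma>)) \<le>
        (\<Sum>\<sigma>\<leftarrow>ys. prod_list (map (\<lambda>x. pmf ?Q x + \<epsilon> K) \<sigma>))"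
      by (intro sum_list_mono prod_list_mono_real) auto
    then have "(\<Sum>\<sigma>\<leftarrow>ys. prod_list (map (\<lambda>x. u x K t / 2 ^ K) \<sigma>)) < (1/2) ^ n"
      using K by (rule order_le_less_trans)
    then show "\<exists>K t. (\<Sum>\<sigma>\<leftarrow>ys. prod_list (map (\<lambda>x. u x K t / 2 ^ K) \<sigma>)) < (1/2) ^ n" by blast
  next
    assume "\<exists>K t. (\<Sum>\<sigma>\<leftarrow>ys. prod_list (map (\<lambda>x. u x K t / 2 ^ K) \<sigma>)) < (1/2) ^ n"
    then obtain K t where "(\<Sum>\<sigma>\<leftarrow>ys. prod_list (map (\<lambda>x. u x K t / 2 ^ K) \<sigma>)) < (1/2) ^ n" by blast
    moreover have "(\<Sum>\<sigma>\<leftarrow>ys. weight ?Q \<sigma>) \<le> (\<Sum>\<sigma>\<leftarrow>ys. prod_list (map (\<lambda>x. u x K t / 2 ^ K) \<sigma>))"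
      unfolding weight_def using upper by (intro sum_list_mono prod_list_mono_real) auto
    ultimately show "(\<Sum>\<sigma>\<leftarrow>ys. weight ?Q \<sigma>) < (1/2) ^ n" by linarith
  qed
  have u_comp: "computable \<beta>s (\<lambda>z. u (fst z) (fst (snd z)) (snd (snd z)))"
    unfolding u_def low_def
    by (intro computable_intros computable_compose3[OF G(1)] computable_compose2[OF F(1)])
  show ?thesis
    unfolding main W_def
    by (intro semidecidable_ex semidecidable_computable computable_intros
        computable_compose3[OF u_comp])
qed


section \<open>Random components of an independent pair\<close>

lemma replicate_pair_pmf:
  "replicate_pmf L (pair_pmf A B) =
    map_pmf (\<lambda>(u, v). zip u v) (pair_pmf (replicate_pmf L A) (replicate_pmf L B))"
proof (induction L)
  case 0
  show ?case by (simp add: pair_return_pmf1)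
next
  case (Suc L)
  let ?A = "replicate_pmf L A" and ?B = "replicate_pmf L B"
  have "replicate_pmf (Suc L) (pair_pmf A B) = pair_pmf A B \<bind>
      (\<lambda>p. map_pmf (\<lambda>(u, v). zip u v) (pair_pmf ?A ?B) \<bind> (\<lambda>w. return_pmf (p # w)))"
    by (simp only: replicate_pmf.simps Suc)
  also have "\<dots> =
    A \<bind> (\<lambda>x. B \<bind> (\<lambda>y. ?A \<bind> (\<lambda>u. ?B \<bind> (\<lambda>v. return_pmf ((x, y) # zip u v)))))"
    by (simp add: map_pmf_def pair_pmf_def bind_assoc_pmf bind_return_pmf)
  also have "\<dots> = A \<bind> (\<lambda>x. ?A \<bind> (\<lambda>u. B \<bind> (\<lambda>y. ?B \<bind> (\<lambda>v. return_pmf ((x, y) # zip u v)))))"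
    by (subst bind_commute_pmf[of B]) simp
  also have "\<dots> = map_pmf (\<lambda>(u, v). zip u v) (pair_pmf (replicate_pmf (Suc L) A) (replicate_pmf (Suc L) B))"
    by (simp add: map_pmf_def pair_pmf_def bind_assoc_pmf bind_return_pmf)
  finally show ?case .
qed

text \<open>
  Fubini's theorem: it suffices to bound the probability of each section.
\<close>

lemma prob_pair_pmf_le:
  assumes "\<And>v. v \<in> set_pmf B \<Longrightarrow> measure_pmf.prob A {u. (u, v) \<in> E} \<le> c" "0 \<le> c"
  shows "measure_pmf.prob (pair_pmf A B) E \<le> c"
proof -
  have "pair_pmf A B = bind_pmf B (\<lambda>v. map_pmf (\<lambda>u. (u, v)) A)"
    unfolding pair_pmf_def map_pmf_def by (rule bind_commute_pmf)
  then have "emeasure (pair_pmf A B) E = (\<integral>\<^sup>+v. emeasure A {u. (u, v) \<in> E} \<partial>measure_pmf B)"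
    by (simp add: emeasure_bind_pmf vimage_def)
  also have "\<dots> \<le> (\<integral>\<^sup>+v. ennreal c \<partial>measure_pmf B)"
    by (rule nn_integral_mono_AE)
      (use assms in \<open>simp add: AE_measure_pmf_iff measure_pmf.emeasure_eq_measure ennreal_leI\<close>)
  also have "\<dots> = ennreal c" by (simp add: measure_pmf.emeasure_space_1[simplified])
  finally show ?thesis
    using assms(2) by (simp add: measure_pmf.emeasure_eq_measure)
qed

lemma prob_some_prefix_le:
  "measure_pmf.prob (replicate_pmf L P) {u. \<exists>\<sigma>\<in>set ys. prefix \<sigma> u} \<le> (\<Sum>\<sigma>\<leftarrow>ys. weight P \<sigma>)"
proof (induction ys)
  case (Cons \<sigma> ys)
  have "measure_pmf.prob (replicate_pmf L P) {u. \<exists>\<sigma>\<in>set (\<sigma> # ys). prefix \<sigma> u} \<le>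
    measure_pmf.prob (replicate_pmf L P) ({u. prefix \<sigma> u} \<union> {u. \<exists>\<sigma>\<in>set ys. prefix \<sigma> u})"
    by (rule measure_pmf.finite_measure_mono) auto
  also have "\<dots> \<le> measure_pmf.prob (replicate_pmf L P) {u. prefix \<sigma> u} +
      measure_pmf.prob (replicate_pmf L P) {u. \<exists>\<sigma>\<in>set ys. prefix \<sigma> u}"
    by (rule measure_Un_le) auto
  also have "\<dots> \<le> weight P \<sigma> + (\<Sum>\<sigma>\<leftarrow>ys. weight P \<sigma>)"
    unfolding weight_def by (intro add_mono prob_replicate_prefix Cons[unfolded weight_def])
  finally show ?case by simp
qed simp

text \<open>
  Fix the second components \<open>v\<close>. The finite sets \<open>C\<close> of the prefixes of \<open>v\<close> increase, so all those whose
  weight is below \<open>c\<close> are contained in the last one of them. The event for \<open>v\<close> is therefore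
  that the first components extend a string from one set of weight below \<open>c\<close>.
\<close>

lemma prob_trimmed_le:
  fixes C :: "'b list \<Rightarrow> nat list list" and Q :: "'b pmf"
  assumes mono: "\<And>v v'. prefix v v' \<Longrightarrow> set (C v) \<subseteq> set (C v')" and c: "0 \<le> c"
  shows "measure_pmf.prob (replicate_pmf L (pair_pmf P Q))
    {w. \<exists>l\<le>L. \<exists>\<sigma>\<in>set (C (map snd (take l w))). prefix \<sigma> (map fst (take l w)) \<and>
      (\<Sum>\<sigma>\<leftarrow>C (map snd (take l w)). weight P \<sigma>) < c} \<le> c" (is "measure _ ?E \<le> c")
proof -
  have "measure_pmf.prob (replicate_pmf L P) {u. (u, v) \<in> (\<lambda>(u, v). zip u v) -` ?E} \<le> c"
    if "v \<in> set_pmf (replicate_pmf L Q)" for v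
  proof -
    have v: "length v = L" using that by (simp add: set_replicate_pmf)
    define Ls where "Ls = {l. l \<le> L \<and> (\<Sum>\<sigma>\<leftarrow>C (take l v). weight P \<sigma>) < c}"
    have fin: "finite Ls" by (simp add: Ls_def)
    define ys where "ys = (if Ls = {} then [] else C (take (Max Ls) v))"
    have ys: "(\<Sum>\<sigma>\<leftarrow>ys. weight P \<sigma>) \<le> c"
    proof (cases "Ls = {}")
      case False
      then have "Max Ls \<in> Ls" by (rule Max_in[OF fin])
      with False show ?thesis by (simp add: ys_def) (simp add: Ls_def)
    qed (simp add: ys_def c)
    have "\<exists>\<sigma>\<in>set ys. prefix \<sigma> u" if u: "length u = L" "zip u v \<in> ?E" for u
    proof -
      obtain l \<sigma> where l: "l \<le> L" "\<sigma> \<in> set (C (map snd (take l (zip u v))))"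
        "prefix \<sigma> (map fst (take l (zip u v)))"
        "(\<Sum>\<sigma>\<leftarrow>C (map snd (take l (zip u v))). weight P \<sigma>) < c"
        using u(2) by blast
      have s: "map snd (take l (zip u v)) = take l v" "map fst (take l (zip u v)) = take l u"
        using u(1) v by (simp_all add: take_map[symmetric])
      have "l \<in> Ls" using l(1,4) unfolding s by (simp add: Ls_def)
      then have "l \<le> Max Ls" "Ls \<noteq> {}" using fin by auto
      then have "prefix (take l v) (take (Max Ls) v)"
        by (metis min.absorb1 take_is_prefix take_take)
      then have "\<sigma> \<in> set ys" using mono l(2) \<open>Ls \<noteq> {}\<close> unfolding s ys_def by auto
      moreover have "prefix \<sigma> u"
        using l(3) take_is_prefix[of l u] unfolding s by (rule prefix_order.trans)
      ultimately show ?thesis by blast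
    qed
    then have "measure_pmf.prob (replicate_pmf L P) {u. (u, v) \<in> (\<lambda>(u, v). zip u v) -` ?E} \<le>
        measure_pmf.prob (replicate_pmf L P) {u. \<exists>\<sigma>\<in>set ys. prefix \<sigma> u}"
      by (intro measure_pmf.finite_measure_mono_AE) (auto simp: AE_measure_pmf_iff set_replicate_pmf)
    also have "\<dots> \<le> c" using prob_some_prefix_le[of L P ys] ys by linarith
    finally show ?thesis .
  qed
  then show ?thesis
    unfolding replicate_pair_pmf measure_map_pmf by (rule prob_pair_pmf_le[OF _ c])
qed

text \<open>
  Oracle answers that can be read off a finite sample: \<open>v\<close> lists the values of the \<open>l\<close> oracles
  position by position. The inner conditionals avoid list positions without a known value, which
  keeps the function computable.
\<close>

definition sample_query :: "nat \<Rightarrow> nat list list \<Rightarrow> nat list \<Rightarrow> nat" where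
  "sample_query l v xs = (case xs of [] \<Rightarrow> 0 | i # xs' \<Rightarrow> (case xs' of [] \<Rightarrow> 0 | m # xs'' \<Rightarrow>
    if xs'' = [] \<and> 1 \<le> i \<and> i \<le> l \<and> 1 \<le> m \<and> m \<le> length v
    then Suc (if i - 1 < length (if m - 1 < length v then v ! (m - 1) else [])
      then (if m - 1 < length v then v ! (m - 1) else []) ! (i - 1) else 0)
    else 0))"

lemma sample_query_mono: "sample_query l v xs = Suc y \<Longrightarrow> prefix v v' \<Longrightarrow> sample_query l v' xs = Suc y"
  by (auto simp: sample_query_def nth_append elim!: prefixE split: list.splits if_splits)

lemma sample_query_eval:
  "(\<exists>k. sample_query (length Ys) (map (\<lambda>a. map (\<lambda>Y. Y a) Ys) (stake k \<alpha>)) xs = Suc y) \<longleftrightarrow>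
    eval (map (\<lambda>Y. smap Y \<alpha>) Ys) Query xs y" (is "?L \<longleftrightarrow> ?R")
proof
  assume ?L
  then obtain k where "sample_query (length Ys) (map (\<lambda>a. map (\<lambda>Y. Y a) Ys) (stake k \<alpha>)) xs = Suc y"
    by blast
  then obtain i m where im: "xs = [i, m]" "1 \<le> i" "i \<le> length Ys" "1 \<le> m" "m \<le> k"
    "y = (Ys ! (i - 1)) (\<alpha> !! (m - 1))"
    by (auto simp: sample_query_def split: list.splits if_splits)
  then show ?R
    using eval_Query[of i "map (\<lambda>Y. smap Y \<alpha>) Ys" m] by simp
next
  assume ?R
  then obtain i m where im: "xs = [i, m]" "1 \<le> i" "i \<le> length Ys" "1 \<le> m"
    "y = (map (\<lambda>Y. smap Y \<alpha>) Ys ! (i - 1)) !! (m - 1)"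
    by (auto elim: eval_cases(4))
  then have "sample_query (length Ys) (map (\<lambda>a. map (\<lambda>Y. Y a) Ys) (stake m \<alpha>)) xs = Suc y"
    by (auto simp: sample_query_def)
  then show ?L by blast
qed

lemma computable_sample_query:
  assumes "computable \<beta>s V" "computable \<beta>s Z"
  shows "computable \<beta>s (\<lambda>x. sample_query l (V x) (Z x))"
  unfolding sample_query_def
  by (intro computable_intros assms computable_nth_default computable_compose[OF assms(1)])

text \<open>
  The strings that \<open>f\<close> accepts at level \<open>n\<close>, as far as a sample \<open>v\<close> of the oracles reveals them; its
  length serves as clock and as bound on the codes.
\<close>

definition sample_hits :: "prog \<Rightarrow> nat \<Rightarrow> nat \<Rightarrow> nat list list \<Rightarrow> nat list list" where
  "sample_hits f l n v =
    filter (\<lambda>\<sigma>. clocked (sample_query l v) (length v) f [prod_encode (n, list_encode \<sigma>)] \<noteq> 0)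
      (map (\<lambda>c. list_decode c) [0..<length v])"

lemma sample_hits_iff:
  "\<sigma> \<in> set (sample_hits f l n v) \<longleftrightarrow> list_encode \<sigma> < length v \<and>
    (\<exists>y. clocked (sample_query l v) (length v) f [prod_encode (n, list_encode \<sigma>)] = Suc y)"
proof -
  have "\<sigma> \<in> list_decode ` {0..<N} \<longleftrightarrow> list_encode \<sigma> < N" for N
    by (auto intro!: image_eqI[where x = "list_encode \<sigma>"])
  moreover have "k \<noteq> 0 \<longleftrightarrow> (\<exists>y. k = Suc y)" for k :: nat by (cases k) auto
  ultimately show ?thesis unfolding sample_hits_def by auto
qed

lemma sample_hits_mono:
  assumes "prefix v v'" shows "set (sample_hits f l n v) \<subseteq> set (sample_hits f l n v')"
proof
  fix \<sigma> assume "\<sigma> \<in> set (sample_hits f l n v)"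
  then obtain y where y: "list_encode \<sigma> < length v"
    "clocked (sample_query l v) (length v) f [prod_encode (n, list_encode \<sigma>)] = Suc y"
    unfolding sample_hits_iff by blast
  have "clocked (sample_query l v') (length v') f [prod_encode (n, list_encode \<sigma>)] = Suc y"
    using sample_query_mono[OF _ assms] prefix_length_le[OF assms] y(2) by (rule clocked_mono)
  moreover have "list_encode \<sigma> < length v'" using y(1) prefix_length_le[OF assms] by simp
  ultimately show "\<sigma> \<in> set (sample_hits f l n v')" unfolding sample_hits_iff by blast
qed

lemma distinct_sample_hits: "distinct (sample_hits f l n v)"
proof -
  have "inj list_decode" by (rule inj_list_decode)
  then show ?thesis
    unfolding sample_hits_def by (simp add: distinct_map inj_on_def)
qed

lemma computable_sample_hits:
  assumes "computable \<beta>s N" "computable \<beta>s V"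
  shows "computable \<beta>s (\<lambda>x. sample_hits f l (N x) (V x))"
proof -
  have *: "sample_hits f l n v =
    filter (\<lambda>\<sigma>. clocked (sample_query l v) (length v) f [code (n, \<sigma>)] \<noteq> 0)
      (map (\<lambda>c. list_decode c) [0..<length v])" for n v
    by (simp add: sample_hits_def code_Pair code_nat_list code_nat_def)
  show ?thesis unfolding *
    by (intro computable_intros computable_clocked computable_sample_query
      computable_compose[OF assms(1)] computable_compose[OF assms(2)] assms)
qed

lemma prefix_iff_take: "prefix \<sigma> \<rho> \<longleftrightarrow> take (length \<sigma>) \<rho> = \<sigma>"
  by (metis append_eq_conv_conj prefixE take_is_prefix)

text \<open>
  The trimmed sets \<open>R n\<close> form a test without oracles. Trimming loses nothing at \<open>\<alpha>\<close>: for the true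
  oracles every finite part of \<open>C\<close> has weight below the bound, because \<open>C\<close> is prefix-free there.
\<close>

lemma independent_component_random:
  fixes Ys :: "(nat \<Rightarrow> nat) list"
  assumes \<Omega>: "recursively_enumerable \<Omega>" and P: "set_pmf P \<subseteq> \<Omega>" "computable_pmf \<Omega> P"
    and X: "partial_recursive_on \<Omega> X" "X \<in> \<Omega> \<rightarrow> \<Omega>'"
    and Ys: "\<And>Y. Y \<in> set Ys \<Longrightarrow> partial_recursive_on \<Omega> Y"
    and indep: "map_pmf (\<lambda>a. (X a, map (\<lambda>Y. Y a) Ys)) P =
      pair_pmf (map_pmf X P) (map_pmf (\<lambda>a. map (\<lambda>Y. Y a) Ys) P)"
    and \<alpha>: "ensemble \<Omega> P \<alpha>"
  shows "ml_random_rel \<Omega>' (map_pmf X P) (map (\<lambda>Y. smap Y \<alpha>) Ys) (smap X \<alpha>)"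
proof -
  let ?Q = "map_pmf X P" and ?\<beta>s = "map (\<lambda>Y. smap Y \<alpha>) Ys" and ?l = "length Ys"
  define Z where "Z a = map (\<lambda>Y. Y a) Ys" for a
  have \<alpha>_\<Omega>: "\<alpha> \<in> streams \<Omega>" using \<alpha> by (simp add: ensemble_def)
  have \<gamma>: "smap X \<alpha> \<in> streams \<Omega>'"
    using \<alpha>_\<Omega> X(2) by (auto simp: streams_iff_snth)
  have Q_\<Omega>': "set_pmf ?Q \<subseteq> \<Omega>'" using P(1) X(2) by auto
  have "\<exists>n\<ge>1. smap X \<alpha> \<notin> cyl \<Omega>' (C `` {n})" if C: "ml_test_rel \<Omega>' ?Q ?\<beta>s C" for C
  proof (rule ccontr)
    assume "\<not> (\<exists>n\<ge>1. smap X \<alpha> \<notin> cyl \<Omega>' (C `` {n}))"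
    then have hit: "smap X \<alpha> \<in> cyl \<Omega>' (C `` {n})" if "n \<ge> 1" for n using that by blast
    from C obtain f where
      f: "C = {(n, \<sigma>) \<in> {1..} \<times> lists \<Omega>'. halts ?\<beta>s f [prod_encode (n, list_encode \<sigma>)]}"
      and small: "small_sections \<Omega>' ?Q C"
      unfolding ml_test_rel_def by blast
    define H where "H n v = sample_hits f ?l (Suc n) v" for n v
    \<comment> \<open>Level \<open>Suc n\<close> of \<open>C\<close> is used because the limit of the trimmed events only satisfies a weak inequality.\<close>
    define R' where "R' n w \<longleftrightarrow> (\<exists>\<sigma>\<in>set (H n (map snd w)). prefix \<sigma> (map fst w)) \<and>
      (\<Sum>\<sigma>\<leftarrow>H n (map snd w). weight ?Q \<sigma>) < (1/2) ^ Suc n" for n w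
    define R where "R n \<tau> \<longleftrightarrow> \<tau> \<in> lists \<Omega> \<and> R' n (map (\<lambda>a. (X a, Z a)) \<tau>)" for n \<tau>
    have "partial_recursive_on \<Omega> (\<lambda>a. list_encode (map (\<lambda>Y. Y a) (X # Ys)))"
      by (rule partial_recursive_list_encode[OF _ \<Omega>]) (use X(1) Ys in auto)
    then obtain F :: "nat \<Rightarrow> nat \<Rightarrow> nat" where
      F: "\<And>\<beta>s. computable \<beta>s (\<lambda>z. F (fst z) (snd z))"
      "\<And>a s. F a s = 0 \<or> F a s = Suc (list_encode (map (\<lambda>Y. Y a) (X # Ys))) \<and> a \<in> \<Omega>"
      "\<And>a s t. F a s \<noteq> 0 \<Longrightarrow> s \<le> t \<Longrightarrow> F a t \<noteq> 0"
      "\<And>a. a \<in> \<Omega> \<Longrightarrow> \<exists>s. F a s \<noteq> 0"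
      by (rule partial_recursive_clocked) (rule that)
    have R'_semi: "semidecidable [] (\<lambda>z. R' (fst z) (snd z))"
      unfolding R'_def
    proof (rule semidecidable_conj)
      show "semidecidable [] (\<lambda>z. \<exists>\<sigma>\<in>set (H (fst z) (map snd (snd z))).
          prefix \<sigma> (map fst (snd z)))"
        unfolding prefix_iff_take H_def
        by (intro semidecidable_computable computable_intros computable_sample_hits)
      have "computable [] (\<lambda>z. (H (fst z) (map snd (snd z)), Suc (fst z)))"
        unfolding H_def by (intro computable_intros computable_sample_hits)
      from semidecidable_compose[OF semidecidable_weight_less[OF P X(1)] this]
      show "semidecidable [] (\<lambda>z. (\<Sum>\<sigma>\<leftarrow>H (fst z) (map snd (snd z)). weight ?Q \<sigma>) <
          (1/2) ^ Suc (fst z))" by simp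
    qed
    \<comment> \<open>\<open>W\<close> computes the values of \<open>X\<close> and \<open>Z\<close> from the clocked version \<open>F\<close> of the list of all components.\<close>
    define W where "W \<tau> s = map (\<lambda>a. case list_decode (F a s - 1) of [] \<Rightarrow> (0, []) | x # xs \<Rightarrow> (x, xs)) \<tau>"
      for \<tau> s
    have R_iff: "R n \<tau> \<longleftrightarrow> (\<exists>s. (\<forall>a\<in>set \<tau>. F a s \<noteq> 0) \<and> R' n (W \<tau> s))" for n \<tau>
    proof -
      have "\<tau> \<in> lists \<Omega> \<longleftrightarrow> (\<forall>a\<in>set \<tau>. \<exists>s. F a s \<noteq> 0)"
        using F(2,4) unfolding in_lists_conv_set by metis
      also have "\<dots> \<longleftrightarrow> (\<exists>s. \<forall>a\<in>set \<tau>. F a s \<noteq> 0)"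
        by (rule common_clock) (rule F(3))
      finally have lists: "\<tau> \<in> lists \<Omega> \<longleftrightarrow> (\<exists>s. \<forall>a\<in>set \<tau>. F a s \<noteq> 0)" .
      have W: "W \<tau> s = map (\<lambda>a. (X a, Z a)) \<tau>" if "\<forall>a\<in>set \<tau>. F a s \<noteq> 0" for s
      proof -
        have "F a s = Suc (list_encode (X a # Z a))" if "a \<in> set \<tau>" for a
          using F(2)[of a s] that \<open>\<forall>a\<in>set \<tau>. F a s \<noteq> 0\<close> by (simp add: Z_def)
        then show ?thesis unfolding W_def
          by (intro map_cong refl) (simp del: list_encode.simps)
      qed
      show ?thesis
      proof
        assume "R n \<tau>"
        then obtain s where s: "\<forall>a\<in>set \<tau>. F a s \<noteq> 0" and "R' n (map (\<lambda>a. (X a, Z a)) \<tau>)"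
          unfolding R_def lists by blast
        then show "\<exists>s. (\<forall>a\<in>set \<tau>. F a s \<noteq> 0) \<and> R' n (W \<tau> s)"
          by (intro exI[of _ s]) (simp only: W[OF s] simp_thms)
      next
        assume "\<exists>s. (\<forall>a\<in>set \<tau>. F a s \<noteq> 0) \<and> R' n (W \<tau> s)"
        then obtain s where s: "\<forall>a\<in>set \<tau>. F a s \<noteq> 0" and "R' n (W \<tau> s)" by blast
        then have "R' n (map (\<lambda>a. (X a, Z a)) \<tau>)" by (simp only: W[OF s])
        with s show "R n \<tau>" unfolding R_def lists by blast
      qed
    qed
    have semi: "semidecidable [] (\<lambda>z. R (fst z) (snd z))"
      unfolding R_iff
    proof (rule semidecidable_ex, rule semidecidable_conj)
      show "semidecidable [] (\<lambda>z. \<forall>a\<in>set (snd (fst z)). F a (snd z) \<noteq> 0)"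
        by (intro semidecidable_computable computable_intros computable_compose2[OF F(1)])
      have "computable [] (\<lambda>z. (fst (fst z), W (snd (fst z)) (snd z)))"
        unfolding W_def by (intro computable_intros computable_compose2[OF F(1)])
      from semidecidable_compose[OF R'_semi this]
      show "semidecidable [] (\<lambda>z. R' (fst (fst z)) (W (snd (fst z)) (snd z)))" by simp
    qed
    have R_small: "measure (bernoulli P) (cyl \<Omega> {\<tau>. R n \<tau>}) < (1/2) ^ n" for n
    proof -
      have "measure_pmf.prob (replicate_pmf L P) {\<tau>. \<exists>l\<le>L. take l \<tau> \<in> {\<tau>. R n \<tau>}} \<le> (1/2) ^ Suc n" for L
      proof -
        let ?E = "{w. \<exists>l\<le>L. \<exists>\<sigma>\<in>set (H n (map snd (take l w))). prefix \<sigma> (map fst (take l w)) \<and>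
          (\<Sum>\<sigma>\<leftarrow>H n (map snd (take l w)). weight ?Q \<sigma>) < (1/2) ^ Suc n}"
        have "measure_pmf.prob (replicate_pmf L P) {\<tau>. \<exists>l\<le>L. take l \<tau> \<in> {\<tau>. R n \<tau>}} \<le>
          measure_pmf.prob (replicate_pmf L P) (map (\<lambda>a. (X a, Z a)) -` ?E)"
          by (rule measure_pmf.finite_measure_mono) (auto simp: R_def R'_def take_map)
        also have "\<dots> = measure_pmf.prob (replicate_pmf L (map_pmf (\<lambda>a. (X a, Z a)) P)) ?E"
          by (simp only: measure_map_pmf[symmetric] map_replicate_pmf)
        also have "\<dots> \<le> (1/2) ^ Suc n"
          unfolding Z_def indep
          by (rule prob_trimmed_le) (auto simp: H_def dest: sample_hits_mono)
        finally show ?thesis .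
      qed
      then have "measure (bernoulli P) (cyl \<Omega> {\<tau>. R n \<tau>}) \<le> (1/2) ^ Suc n"
        by (rule measure_cyl_le)
      also have "\<dots> < (1/2) ^ n" by simp
      finally show ?thesis .
    qed
    obtain n where n: "n \<ge> 1" "\<And>k. \<not> R n (stake k \<alpha>)"
      using ml_random_rel_avoids[OF ensemble_ml_random_rel[OF \<alpha> \<Omega>] semi R_small] by blast
    obtain l \<sigma> where \<sigma>: "stake l (smap X \<alpha>) = \<sigma>" "(Suc n, \<sigma>) \<in> C"
      using hit[of "Suc n"] by (auto simp: cyl_def)
    define q where "q s = sample_query ?l (map Z (stake s \<alpha>))" for s
    have q_mono: "q t xs = Suc y" if "s \<le> t" "q s xs = Suc y" for s t xs y
    proof -
      have "prefix (map Z (stake s \<alpha>)) (map Z (stake t \<alpha>))"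
        using that(1) take_is_prefix[of s "stake t \<alpha>"]
        by (intro map_mono_prefix) (simp add: take_stake min_def)
      with that(2) show ?thesis unfolding q_def by (rule sample_query_mono)
    qed
    have q_eval: "(\<exists>s. q s xs = Suc y) \<longleftrightarrow> eval ?\<beta>s Query xs y" for xs y
      unfolding q_def Z_def[abs_def] by (rule sample_query_eval)
    obtain y where y: "eval ?\<beta>s f [prod_encode (Suc n, list_encode \<sigma>)] y"
      using \<sigma>(2) by (auto simp: f halts_def)
    have "\<exists>s. clocked (q s) s f [prod_encode (Suc n, list_encode \<sigma>)] = Suc y"
    proof (rule clocked_complete[OF _ _ y])
      show "s \<le> t \<Longrightarrow> q s xs = Suc y \<Longrightarrow> q t xs = Suc y" for s t xs y by (rule q_mono)
      show "eval ?\<beta>s Query xs y \<Longrightarrow> \<exists>s. q s xs = Suc y" for xs y unfolding q_eval .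
    qed
    then obtain s where s: "clocked (q s) s f [prod_encode (Suc n, list_encode \<sigma>)] = Suc y"
      by blast
    define k where "k = max (max s l) (Suc (list_encode \<sigma>))"
    have k: "s \<le> k" "l \<le> k" "list_encode \<sigma> < k" by (auto simp: k_def)
    have "clocked (q k) k f [prod_encode (Suc n, list_encode \<sigma>)] = Suc y"
      using q_mono[OF k(1)] k(1) s by (rule clocked_mono)
    then have "\<sigma> \<in> set (H n (map Z (stake k \<alpha>)))"
      unfolding H_def sample_hits_iff using k(3) by (simp add: q_def)
    moreover have "prefix \<sigma> (map X (stake k \<alpha>))"
    proof -
      have "\<sigma> = take l (map X (stake k \<alpha>))" using \<sigma>(1) k(2) by (simp add: take_map take_stake min_def)
      then show ?thesis using take_is_prefix by metis
    qed
    moreover have "(\<Sum>\<sigma>\<leftarrow>H n (map Z (stake k \<alpha>)). weight ?Q \<sigma>) < (1/2) ^ Suc n"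
    proof -
      let ?ys = "H n (map Z (stake k \<alpha>))"
      have "(\<Sum>\<sigma>\<leftarrow>?ys. weight ?Q \<sigma>) = (\<Sum>\<sigma>\<in>set ?ys. weight ?Q \<sigma>)"
        by (intro sum_list_distinct_conv_sum_set) (simp add: H_def distinct_sample_hits)
      also have "\<dots> = (\<Sum>\<sigma>\<in>set ?ys \<inter> lists \<Omega>'. weight ?Q \<sigma>)"
      proof (rule sum.mono_neutral_right)
        show "\<forall>\<sigma>\<in>set ?ys - set ?ys \<inter> lists \<Omega>'. weight ?Q \<sigma> = 0"
        proof
          fix \<sigma> assume "\<sigma> \<in> set ?ys - set ?ys \<inter> lists \<Omega>'"
          then obtain x where "x \<in> set \<sigma>" "x \<notin> \<Omega>'" by (auto simp: in_lists_conv_set)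
          moreover from this have "pmf ?Q x = 0" using Q_\<Omega>' unfolding set_pmf_eq by blast
          ultimately have "0 \<in> set (map (pmf ?Q) \<sigma>)" by (metis image_eqI set_map)
          then show "weight ?Q \<sigma> = 0" unfolding weight_def by (simp add: prod_list_zero_iff)
        qed
      qed auto
      also have "\<dots> \<le> measure (bernoulli ?Q) (cyl \<Omega>' (C `` {Suc n}))"
        unfolding weight_def
      proof (rule sum_weights_prefix_free[OF Q_\<Omega>'])
        show "set ?ys \<inter> lists \<Omega>' \<subseteq> C `` {Suc n}"
        proof
          fix \<sigma> assume \<sigma>: "\<sigma> \<in> set ?ys \<inter> lists \<Omega>'"
          then obtain y where "clocked (q k) k f [prod_encode (Suc n, list_encode \<sigma>)] = Suc y"
            by (auto simp: H_def sample_hits_iff q_def)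
          then have "eval ?\<beta>s f [prod_encode (Suc n, list_encode \<sigma>)] y"
          proof (rule clocked_sound[rotated])
            show "eval ?\<beta>s Query xs y" if "q k xs = Suc y" for xs y
              unfolding q_eval[symmetric] using that by blast
          qed
          then show "\<sigma> \<in> C `` {Suc n}" using \<sigma> by (auto simp: f halts_def)
        qed
        show "C `` {Suc n} \<subseteq> lists \<Omega>'" by (auto simp: f)
        show "prefix_free (C `` {Suc n})" using small by (simp add: small_sections_def)
      qed simp
      also have "\<dots> < (1/2) ^ Suc n"
        using small[unfolded small_sections_def, rule_format, of "Suc n"] by simp
      finally show ?thesis .
    qed
    moreover have "stake k \<alpha> \<in> lists \<Omega>"
      using \<alpha>_\<Omega> by (auto simp: in_lists_conv_set in_set_conv_nth streams_iff_snth)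
    moreover have "map fst (map (\<lambda>a. (X a, Z a)) (stake k \<alpha>)) = map X (stake k \<alpha>)"
      "map snd (map (\<lambda>a. (X a, Z a)) (stake k \<alpha>)) = map Z (stake k \<alpha>)" by simp_all
    ultimately have "R n (stake k \<alpha>)" unfolding R_def R'_def by metis
    with n(2) show False by blast
  qed
  with \<gamma> show ?thesis by (simp add: ml_random_rel_def)
qed


section \<open>Independence and joint frequencies\<close>

lemma prob_restrict_support:
  assumes "set_pmf P \<subseteq> \<Omega>"
  shows "measure_pmf.prob P {a \<in> \<Omega>. Q a} = measure_pmf.prob P {a. Q a}"
  by (rule measure_pmf.finite_measure_eq_AE) (use assms in \<open>auto simp: AE_measure_pmf_iff\<close>)

lemma sums_prob_fibres:
  fixes X :: "'a \<Rightarrow> nat"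
  shows "(\<lambda>y. measure_pmf.prob P {a. X a = y \<and> Q a}) sums measure_pmf.prob P {a. Q a}"
proof -
  have "(\<lambda>y. measure_pmf.prob P {a. X a = y \<and> Q a}) sums
      measure_pmf.prob P (\<Union>y. {a. X a = y \<and> Q a})"
    by (rule measure_pmf.finite_measure_UNION) (auto simp: disjoint_family_on_def)
  also have "(\<Union>y. {a. X a = y \<and> Q a}) = {a. Q a}" by auto
  finally show ?thesis .
qed

text \<open>
  The first components are summed out one by one. The statement is extended to values outside
  the ranges \<open>\<Omega>' i\<close>, where both sides vanish, so that the sums run over all natural numbers.
\<close>

lemma indep_rvs_tail:
  assumes P: "set_pmf P \<subseteq> \<Omega>" and X: "\<And>i. i \<in> {1..n} \<Longrightarrow> X i \<in> \<Omega> \<rightarrow> \<Omega>' i"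
    and indep: "indep_rvs \<Omega> P n \<Omega>' X" and k: "1 \<le> k" "k \<le> Suc n"
  shows "measure_pmf.prob P {a. \<forall>i\<in>{k..n}. X i a = x i} =
    (\<Prod>i=k..n. measure_pmf.prob P {a. X i a = x i})"
  using k
proof (induction k arbitrary: x rule: nat_induct_at_least)
  case base
  show ?case
  proof (cases "x \<in> Pi {1..n} \<Omega>'")
    case True
    then show ?thesis
      using indep unfolding indep_rvs_def prob_restrict_support[OF P] by blast
  next
    case False
    then obtain i where i: "i \<in> {1..n}" "x i \<notin> \<Omega>' i" unfolding Pi_iff by blast
    have "measure_pmf.prob P {a. X i a = x i} = 0"
      using P Pi_mem[OF X[OF i(1)]] i(2) by (fastforce simp: measure_pmf_zero_iff)
    moreover have "measure_pmf.prob P {a. \<forall>i\<in>{1..n}. X i a = x i} \<le> measure_pmf.prob P {a. X i a = x i}"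
      using i(1) by (intro measure_pmf.finite_measure_mono) auto
    ultimately have "measure_pmf.prob P {a. \<forall>i\<in>{1..n}. X i a = x i} = 0"
      by (simp add: measure_le_0_iff)
    moreover have "(\<Prod>i=1..n. measure_pmf.prob P {a. X i a = x i}) = 0"
      using i(1) \<open>measure_pmf.prob P {a. X i a = x i} = 0\<close> by (intro prod_zero) auto
    ultimately show ?thesis by simp
  qed
next
  case (Suc k)
  let ?p = "\<lambda>i y. measure_pmf.prob P {a. X i a = y}"
  have split: "{k..n} = insert k {Suc k..n}" using Suc.prems by auto
  have "measure_pmf.prob P {a. X k a = y \<and> (\<forall>i\<in>{Suc k..n}. X i a = x i)} =
      ?p k y * (\<Prod>i=Suc k..n. ?p i (x i))" for y
  proof -
    have "{a. X k a = y \<and> (\<forall>i\<in>{Suc k..n}. X i a = x i)} = {a. \<forall>i\<in>{k..n}. X i a = (x(k := y)) i}"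
      unfolding split by auto
    also have "measure_pmf.prob P \<dots> = (\<Prod>i=k..n. ?p i ((x(k := y)) i))"
      using Suc.prems by (intro Suc.IH) simp
    also have "\<dots> = ?p k y * (\<Prod>i=Suc k..n. ?p i ((x(k := y)) i))"
      unfolding split by (subst prod.insert) simp_all
    also have "(\<Prod>i=Suc k..n. ?p i ((x(k := y)) i)) = (\<Prod>i=Suc k..n. ?p i (x i))"
      by (rule prod.cong) auto
    finally show ?thesis .
  qed
  with sums_prob_fibres[of P "X k" "\<lambda>a. \<forall>i\<in>{Suc k..n}. X i a = x i"]
  have "(\<lambda>y. ?p k y * (\<Prod>i=Suc k..n. ?p i (x i))) sums
      measure_pmf.prob P {a. \<forall>i\<in>{Suc k..n}. X i a = x i}" by simp
  moreover have "(\<lambda>y. ?p k y) sums 1"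
    using sums_prob_fibres[of P "X k" "\<lambda>_. True"] by simp
  then have "(\<lambda>y. ?p k y * (\<Prod>i=Suc k..n. ?p i (x i))) sums (1 * (\<Prod>i=Suc k..n. ?p i (x i)))"
    by (rule sums_mult2)
  ultimately show ?case using sums_unique2 by fastforce
qed

lemma indep_rvs_pair:
  assumes P: "set_pmf P \<subseteq> \<Omega>" and X: "\<And>i. i \<in> {1..n} \<Longrightarrow> X i \<in> \<Omega> \<rightarrow> \<Omega>' i"
    and indep: "indep_rvs \<Omega> P n \<Omega>' X" and k: "1 \<le> k" "k \<le> n"
  shows "map_pmf (\<lambda>a. (X k a, map (\<lambda>Y. Y a) (map X [k + 1..<n + 1]))) P =
    pair_pmf (map_pmf (X k) P) (map_pmf (\<lambda>a. map (\<lambda>Y. Y a) (map X [k + 1..<n + 1])) P)"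
proof (rule pmf_eqI)
  fix z :: "nat \<times> nat list"
  obtain y zs where z: "z = (y, zs)" by fastforce
  let ?js = "[k + 1..<n + 1]"
  let ?Z = "\<lambda>a. map (\<lambda>Y. Y a) (map X ?js)"
  have 1: "pmf (map_pmf (\<lambda>a. (X k a, ?Z a)) P) z = measure_pmf.prob P {a. X k a = y \<and> ?Z a = zs}"
    by (simp add: pmf_map vimage_def z)
  have 2: "pmf (pair_pmf (map_pmf (X k) P) (map_pmf ?Z P)) z =
      measure_pmf.prob P {a. X k a = y} * measure_pmf.prob P {a. ?Z a = zs}"
    by (simp add: pmf_pair pmf_map vimage_def z)
  show "pmf (map_pmf (\<lambda>a. (X k a, ?Z a)) P) z = pmf (pair_pmf (map_pmf (X k) P) (map_pmf ?Z P)) z"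
  proof (cases "length zs = n - k")
    case False
    then have "?Z a \<noteq> zs" for a by (auto dest: arg_cong[of _ _ length])
    then show ?thesis unfolding 1 2 by simp
  next
    case True
    define x where "x i = (if i = k then y else zs ! (i - (k + 1)))" for i
    have Z: "?Z a = zs \<longleftrightarrow> (\<forall>i\<in>{Suc k..n}. X i a = x i)" for a
    proof
      assume Z: "?Z a = zs"
      show "\<forall>i\<in>{Suc k..n}. X i a = x i"
      proof
        fix i assume i: "i \<in> {Suc k..n}"
        then have "?Z a ! (i - (k + 1)) = X i a" by (auto simp: nth_append simp del: upt_Suc)
        then show "X i a = x i" using i unfolding Z by (simp add: x_def)
      qed
    next
      assume *: "\<forall>i\<in>{Suc k..n}. X i a = x i"
      show "?Z a = zs"
      proof (rule nth_equalityI)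
        show "length (?Z a) = length zs" using True by (simp del: upt_Suc)
        fix i assume "i < length (?Z a)"
        then have i: "i < n - k" by (simp del: upt_Suc)
        then have "?Z a ! i = X (k + 1 + i) a" by (simp del: upt_Suc)
        also have "\<dots> = zs ! i" using *[rule_format, of "k + 1 + i"] i by (simp add: x_def)
        finally show "?Z a ! i = zs ! i" .
      qed
    qed
    have split: "{k..n} = insert k {Suc k..n}" using k by auto
    have "{a. X k a = y \<and> ?Z a = zs} = {a. \<forall>i\<in>{k..n}. X i a = x i}"
      unfolding Z split by (auto simp: x_def)
    then have "pmf (map_pmf (\<lambda>a. (X k a, ?Z a)) P) z = (\<Prod>i=k..n. measure_pmf.prob P {a. X i a = x i})"
      unfolding 1 using indep_rvs_tail[OF P X indep, of k x] k by simp
    also have "\<dots> = measure_pmf.prob P {a. X k a = x k} *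
        (\<Prod>i=Suc k..n. measure_pmf.prob P {a. X i a = x i})"
      unfolding split by (subst prod.insert) simp_all
    also have "\<dots> = measure_pmf.prob P {a. X k a = y} * measure_pmf.prob P {a. ?Z a = zs}"
      unfolding Z using indep_rvs_tail[OF P X indep, of "Suc k" x] k by (simp add: x_def)
    finally show ?thesis unfolding 2 .
  qed
qed

text \<open>
  Downward induction on \<open>k\<close>: relative to the oracles, the positions where the later components
  have the prescribed values are computable, and the \<open>k\<close>-th component has the right frequency along them.
  For \<open>k = n\<close> there are no later components, and the randomness of \<open>\<alpha>\<close> itself is used.
\<close>

lemma components_ml_random_frequencies:
  fixes X :: "nat \<Rightarrow> nat \<Rightarrow> nat" and x :: "nat \<Rightarrow> nat"
  assumes \<Omega>: "recursively_enumerable \<Omega>"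
    and X: "\<And>i. i \<in> {1..n} \<Longrightarrow> partial_recursive_on \<Omega> (X i)"
    and \<alpha>: "ensemble \<Omega> P \<alpha>" and comp: "components_ml_random n \<Omega>' P X \<alpha>"
    and k: "1 \<le> k" "k \<le> Suc n"
  shows "(\<lambda>j. (\<Sum>m<2^j. of_bool (\<forall>i\<in>{k..n}. X i (\<alpha> !! m) = x i)) / 2 ^ j) \<longlonglongrightarrow>
    (\<Prod>i=k..n. measure_pmf.prob P {a. X i a = x i})"
  using k(2,1)
proof (induction k rule: inc_induct)
  case base
  then show ?case by simp
next
  case (step k)
  define b where "b m \<longleftrightarrow> (\<forall>i\<in>{Suc k..n}. X i (\<alpha> !! m) = x i)" for m
  define p where "p = measure_pmf.prob P {a. X k a = x k}"
  define c where "c k j = (\<Sum>m<2^j. of_bool (\<forall>i\<in>{k..n}. X i (\<alpha> !! m) = x i)) / (2::real) ^ j" for k j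
  have split: "{k..n} = insert k {Suc k..n}" using step by auto
  have "(\<lambda>j. (\<Sum>m<2^j. of_bool (b m) * (of_bool (X k (\<alpha> !! m) = x k) - p)) / 2 ^ j) \<longlonglongrightarrow> 0"
  proof (cases "k = n")
    case True
    have "partial_recursive_on \<Omega> (X k)" using X step True by simp
    then obtain F :: "nat \<Rightarrow> nat \<Rightarrow> nat" where F: "\<And>\<beta>s. computable \<beta>s (\<lambda>z. F (fst z) (snd z))"
      "\<And>a s. F a s = 0 \<or> F a s = Suc (X k a) \<and> a \<in> \<Omega>"
      "\<And>a s t. F a s \<noteq> 0 \<Longrightarrow> s \<le> t \<Longrightarrow> F a t \<noteq> 0"
      "\<And>a. a \<in> \<Omega> \<Longrightarrow> \<exists>s. F a s \<noteq> 0"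
      by (rule partial_recursive_clocked) (rule that)
    have b: "b = (\<lambda>_. True)" using True by (auto simp: b_def)
    show ?thesis unfolding b p_def
    proof (rule frequency_along_powers[OF ensemble_ml_random_rel[OF \<alpha> \<Omega>] computable_const F(1)])
      show "F a s \<noteq> 0 \<Longrightarrow> F a s = Suc (X k a)" for a s using F(2)[of a s] by simp
    qed (use F(3,4) in simp_all)
  next
    case False
    then have kn: "1 \<le> k" "k < n" using step by auto
    let ?\<beta>s = "map (\<lambda>j. smap (X j) \<alpha>) [k + 1..<n + 1]"
    have random: "ml_random_rel (\<Omega>' k) (map_pmf (X k) P) ?\<beta>s (smap (X k) \<alpha>)"
      using comp kn by (auto simp: components_ml_random_def simp del: upt_Suc)
    have b_eq: "b m \<longleftrightarrow> map (\<lambda>i. (?\<beta>s ! i) !! m) [0..<n - k] = map x [k + 1..<n + 1]" for m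
    proof -
      have 1: "map (\<lambda>i. (?\<beta>s ! i) !! m) [0..<n - k] = map (\<lambda>i. X i (\<alpha> !! m)) [k + 1..<n + 1]"
        by (rule nth_equalityI) (simp_all del: upt_Suc)
      show ?thesis unfolding 1 map_eq_conv b_def by (auto simp del: upt_Suc)
    qed
    have "computable ?\<beta>s b"
      unfolding b_eq
      by (intro computable_intros computable_fixed_map computable_oracle) (auto simp del: upt_Suc)
    moreover have "computable ?\<beta>s (\<lambda>z::nat \<times> nat. Suc (fst z))" by (intro computable_intros)
    ultimately have "(\<lambda>j. (\<Sum>m<2^j. of_bool (b m) * (of_bool (smap (X k) \<alpha> !! m = x k) -
        measure_pmf.prob (map_pmf (X k) P) {a. a = x k})) / 2 ^ j) \<longlonglongrightarrow> 0"
      by (rule frequency_along_powers[OF random]) simp_all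
    moreover have "measure_pmf.prob (map_pmf (X k) P) {a. a = x k} = p"
      by (simp add: p_def vimage_def)
    ultimately show ?thesis by simp
  qed
  also have "(\<lambda>j. (\<Sum>m<2^j. of_bool (b m) * (of_bool (X k (\<alpha> !! m) = x k) - p)) / 2 ^ j) =
      (\<lambda>j. c k j - p * c (Suc k) j)"
  proof
    fix j :: nat
    have "(\<Sum>m<2^j. of_bool (b m) * (of_bool (X k (\<alpha> !! m) = x k) - p)) =
      (\<Sum>m<2^j. of_bool (\<forall>i\<in>{k..n}. X i (\<alpha> !! m) = x i) -
        p * of_bool (\<forall>i\<in>{Suc k..n}. X i (\<alpha> !! m) = x i))"
      unfolding split by (intro sum.cong) (auto simp: b_def)
    also have "\<dots> = c k j * 2 ^ j - p * (c (Suc k) j * 2 ^ j)"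
      unfolding c_def sum_subtractf sum_distrib_left[symmetric] by simp
    finally show "(\<Sum>m<2^j. of_bool (b m) * (of_bool (X k (\<alpha> !! m) = x k) - p)) / 2 ^ j =
        c k j - p * c (Suc k) j" by (simp add: field_simps)
  qed
  finally have "(\<lambda>j. c k j - p * c (Suc k) j) \<longlonglongrightarrow> 0" .
  moreover have "c (Suc k) \<longlonglongrightarrow> (\<Prod>i=Suc k..n. measure_pmf.prob P {a. X i a = x i})"
    using step.IH unfolding c_def by simp
  then have "(\<lambda>j. p * c (Suc k) j) \<longlonglongrightarrow> p * (\<Prod>i=Suc k..n. measure_pmf.prob P {a. X i a = x i})"
    by (rule tendsto_mult_left)
  ultimately have "(\<lambda>j. (c k j - p * c (Suc k) j) + p * c (Suc k) j) \<longlonglongrightarrow>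
      0 + p * (\<Prod>i=Suc k..n. measure_pmf.prob P {a. X i a = x i})"
    by (rule tendsto_add)
  moreover have "p * (\<Prod>i=Suc k..n. measure_pmf.prob P {a. X i a = x i}) =
      (\<Prod>i=k..n. measure_pmf.prob P {a. X i a = x i})"
    unfolding split by (subst prod.insert) (simp_all add: p_def)
  ultimately show ?case unfolding c_def by simp
qed

lemma ensemble_joint_frequencies:
  fixes X :: "nat \<Rightarrow> nat \<Rightarrow> nat" and x :: "nat \<Rightarrow> nat"
  assumes \<Omega>: "recursively_enumerable \<Omega>"
    and X: "\<And>i. i \<in> {1..n} \<Longrightarrow> partial_recursive_on \<Omega> (X i)"
    and \<alpha>: "ensemble \<Omega> P \<alpha>"
  shows "(\<lambda>j. (\<Sum>m<2^j. of_bool (\<forall>i\<in>{1..n}. X i (\<alpha> !! m) = x i)) / 2 ^ j) \<longlonglongrightarrow>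
    measure_pmf.prob P {a. \<forall>i\<in>{1..n}. X i a = x i}"
proof -
  let ?Y = "\<lambda>a. list_encode (map (\<lambda>i. X i a) [1..<n + 1])"
  let ?y = "list_encode (map x [1..<n + 1])"
  have Y: "?Y a = ?y \<longleftrightarrow> (\<forall>i\<in>{1..n}. X i a = x i)" for a
    unfolding list_encode_eq map_eq_conv by (auto simp del: upt_Suc)
  have "partial_recursive_on \<Omega> ?Y"
    by (rule partial_recursive_list_encode[OF X \<Omega>]) (auto simp del: upt_Suc)
  then obtain F :: "nat \<Rightarrow> nat \<Rightarrow> nat" where F: "\<And>\<beta>s. computable \<beta>s (\<lambda>z. F (fst z) (snd z))"
    "\<And>a s. F a s = 0 \<or> F a s = Suc (?Y a) \<and> a \<in> \<Omega>"
    "\<And>a s t. F a s \<noteq> 0 \<Longrightarrow> s \<le> t \<Longrightarrow> F a t \<noteq> 0"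
    "\<And>a. a \<in> \<Omega> \<Longrightarrow> \<exists>s. F a s \<noteq> 0"
    by (rule partial_recursive_clocked) (rule that)
  let ?p = "measure_pmf.prob P {a. \<forall>i\<in>{1..n}. X i a = x i}"
  have "(\<lambda>j. (\<Sum>m<2^j. of_bool True * (of_bool (?Y (\<alpha> !! m) = ?y) -
      measure_pmf.prob P {a. ?Y a = ?y})) / 2 ^ j) \<longlonglongrightarrow> 0"
  proof (rule frequency_along_powers[OF ensemble_ml_random_rel[OF \<alpha> \<Omega>] computable_const F(1)])
    show "F a s \<noteq> 0 \<Longrightarrow> F a s = Suc (?Y a)" for a s using F(2)[of a s] by metis
  qed (use F(3,4) in blast)+
  then have "(\<lambda>j. (\<Sum>m<2^j. of_bool (\<forall>i\<in>{1..n}. X i (\<alpha> !! m) = x i) - ?p) / 2 ^ j) \<longlonglongrightarrow> 0"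
    unfolding Y by simp
  moreover have "(\<Sum>m<2^j. of_bool (\<forall>i\<in>{1..n}. X i (\<alpha> !! m) = x i) - ?p) / 2 ^ j =
      (\<Sum>m<2^j. of_bool (\<forall>i\<in>{1..n}. X i (\<alpha> !! m) = x i)) / 2 ^ j - ?p" for j
    unfolding sum_subtractf by (simp add: diff_divide_distrib)
  ultimately show ?thesis by (simp only: LIM_zero_iff)
qed

theorem theorem62:
  fixes \<Omega> :: "nat set" and n :: nat and \<Omega>' :: "nat \<Rightarrow> nat set"
    and P :: "nat pmf" and X :: "nat \<Rightarrow> nat \<Rightarrow> nat"
  assumes "n \<ge> 1"
    and "re_infinite \<Omega>"
    and "\<And>i. i \<in> {1..n} \<Longrightarrow> re_infinite (\<Omega>' i)"
    and "P \<in> discrete_prob_spaces \<Omega>"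
    and "\<And>i. i \<in> {1..n} \<Longrightarrow> X i \<in> \<Omega> \<rightarrow> \<Omega>' i"
    and "\<And>i. i \<in> {1..n} \<Longrightarrow> partial_recursive_on \<Omega> (X i)"
    and "computable_pmf \<Omega> P"
  shows "(indep_rvs \<Omega> P n \<Omega>' X \<longleftrightarrow>
      (\<forall>\<alpha>. ensemble \<Omega> P \<alpha> \<longrightarrow> components_ml_random n \<Omega>' P X \<alpha>)) \<and>
    ((\<forall>\<alpha>. ensemble \<Omega> P \<alpha> \<longrightarrow> components_ml_random n \<Omega>' P X \<alpha>) \<longleftrightarrow>
      (\<exists>\<alpha>. ensemble \<Omega> P \<alpha> \<and> components_ml_random n \<Omega>' P X \<alpha>))"
proof -
  have \<Omega>: "recursively_enumerable \<Omega>" using assms(2) by (simp add: re_infinite_def)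
  have P: "set_pmf P \<subseteq> \<Omega>" using assms(4) by (simp add: discrete_prob_spaces_def)
  note X = assms(5) and rec = assms(6)
  have i_ii: "components_ml_random n \<Omega>' P X \<alpha>" if "indep_rvs \<Omega> P n \<Omega>' X" "ensemble \<Omega> P \<alpha>" for \<alpha>
    unfolding components_ml_random_def
  proof
    fix k assume "k \<in> {1..n - 1}"
    then have k: "1 \<le> k" "k \<le> n" "k \<in> {1..n}" by auto
    have "ml_random_rel (\<Omega>' k) (map_pmf (X k) P)
        (map (\<lambda>Y. smap Y \<alpha>) (map X [k + 1..<n + 1])) (smap (X k) \<alpha>)"
    proof (rule independent_component_random[OF \<Omega> P assms(7) rec[OF k(3)] X[OF k(3)]])
      show "partial_recursive_on \<Omega> Y" if "Y \<in> set (map X [k + 1..<n + 1])" for Y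
        using that rec by (auto simp del: upt_Suc)
      show "map_pmf (\<lambda>a. (X k a, map (\<lambda>Y. Y a) (map X [k + 1..<n + 1]))) P =
        pair_pmf (map_pmf (X k) P) (map_pmf (\<lambda>a. map (\<lambda>Y. Y a) (map X [k + 1..<n + 1])) P)"
        by (rule indep_rvs_pair[OF P X that(1) k(1,2)])
    qed (rule that(2))
    then show "ml_random_rel (\<Omega>' k) (map_pmf (X k) P)
        (map (\<lambda>j. smap (X j) \<alpha>) [k + 1..<n + 1]) (smap (X k) \<alpha>)"
      by (simp add: o_def del: upt_Suc)
  qed
  have iii_i: "indep_rvs \<Omega> P n \<Omega>' X" if "ensemble \<Omega> P \<alpha>" "components_ml_random n \<Omega>' P X \<alpha>" for \<alpha>
    unfolding indep_rvs_def prob_restrict_support[OF P]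
  proof
    fix x
    show "measure_pmf.prob P {a. \<forall>i\<in>{1..n}. X i a = x i} =
        (\<Prod>i=1..n. measure_pmf.prob P {a. X i a = x i})"
      using LIMSEQ_unique[OF ensemble_joint_frequencies[OF \<Omega> rec that(1), where x = x]
          components_ml_random_frequencies[OF \<Omega> rec that, where k = 1 and x = x]] by simp
  qed
  obtain \<alpha> where "ensemble \<Omega> P \<alpha>" using ensemble_exists[OF P] by blast
  with i_ii iii_i show ?thesis by blast
qed

end
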